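(* Let $(X,\rho,\mu)$ be a space of homogeneous type satisfying the standing assumptions listed in the context, and let $T$ be a Calderón--Zygmund operator on $X$ as defined in the context. Let $1<p<\infty$, $\theta>0$ and $0<\lambda<1$. Then $T$ is bounded in the grand Morrey space $L^{p),\theta,\lambda}(X,\mu)$; that is, there is a constant $C>0$ such that $\|Tf\|_{L^{p),\theta,\lambda}(X,\mu)}\le C\|f\|_{L^{p),\theta,\lambda}(X,\mu)}$ for all $f\in L^{p),\theta,\lambda}(X,\mu)$.
   Context: Standing assumptions on $(X,\rho,\mu)$. $X$ is a topological space with a complete measure $\mu$ such that the compactly supported continuous functions are dense in $L^1(X,\mu)$, and $\rho:X\times X\to[0,\infty)$ is a quasi-metric: (i) $\rho(x,y)=0$ iff $x=y$; (ii) there is $a_1>0$ with $\rho(x,y)\le a_1(\rho(x,z)+\rho(z,y))$ for all $x,y,z\in X$; (iii) there is $a_0>0$ with $\rho(x,y)\le a_0\rho(y,x)$ for all $x,y\in X$. Balls $B(x,r)=\{y\in X:\rho(x,y)<r\}$ are measurable with $0<\mu(B(x,r))<\infty$ for all $x\in X$, $r>0$; for every neighborhood $V$ of $x\in X$ there is $r>0$ with $B(x,r)\subset V$; $\mu\{x\}=0$ for all $x\in X$; $d:=\operatorname{diam}(X)=\sup\{\rho(x,y):x,y\in X\}<\infty$; $B(x,R)\setminus B(x,r)\ne\emptyset$ for all $x\in X$ and $0<r<R<d$; and $\mu$ is doubling: there is $c>0$ with $\mu(B(x,2r))\le c\,\mu(B(x,r))$ for all $x\in X$, $r>0$. Calderón--Zygmund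 operator. $Tf(x)=\mathrm{p.v.}\int_X k(x,y)f(y)\,d\mu(y)$ (the limit as $\epsilon\to0+$ of the integral over $\{y:\rho(x,y)>\epsilon\}$), where $k:X\times X\setminus\{(x,x):x\in X\}\to\mathbb{R}$ is measurable and, for some constant $c>0$, $$|k(x,y)|\le\frac{c}{\mu B(x,\rho(x,y))},\qquad x\ne y,$$ $$|k(x_1,y)-k(x_2,y)|+|k(y,x_1)-k(y,x_2)|\le c\,\omega\!\left(\frac{\rho(x_2,x_1)}{\rho(x_2,y)}\right)\frac{1}{\mu B(x_2,\rho(x_2,y))}$$ for all $x_1,x_2,y$ with $\rho(x_2,y)>c\,\rho(x_1,x_2)$; here $\omega$ is a positive non-decreasing function on $(0,\infty)$ satisfying the $\Delta_2$ condition $\omega(2t)\le c\,\omega(t)$ ($t>0$) and the Dini condition $\int_0^1\frac{\omega(t)}{t}\,dt<\infty$. (The symbol $c$ may denote different constants in different inequalities.) It is also assumed that for all $f\in L^{2}(X,\mu)$ the limit $Tf(x)$ exists for almost every $x\in X$ and that $T$ is bounded in $L^{2}(X,\mu)$. Grand Morrey space. For $1<p<\infty$, $\theta>0$, $0\le\lambda<1$, $L^{p),\theta,\lambda}(X,\mu)$ is the class of measurable $f:X\to\mathbb{R}$ for which $$\|f\|_{L^{p),\theta,\lambda}(X,\mu)}=\sup_{0<\varepsilon<p-1}\ \sup_{x\in X,\ 0<r<d}\left[\frac{\varepsilon^{\theta}}{(\mu(B(x,r)))^{\lambda}}\int_{B(x,r)}|f(y)|^{p-\varepsilon}\,d\mu(y)\right]^{\frac{1}{p-\varepsilon}}<\infty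 .$$ *)

theory Defs
  imports "HOL-Analysis.Analysis"
begin

definition qball :: "('a \<Rightarrow> 'a \<Rightarrow> real) \<Rightarrow> 'a \<Rightarrow> real \<Rightarrow> 'a set" where
  "qball \<rho> x r = {y. \<rho> x y < r}"

definition qdiam :: "('a \<Rightarrow> 'a \<Rightarrow> real) \<Rightarrow> real" where
  "qdiam \<rho> = (SUP (x, y). \<rho> x y)"

definition continuous_compact_support :: "('a::topological_space \<Rightarrow> real) \<Rightarrow> bool" where
  "continuous_compact_support g \<longleftrightarrow> continuous_on UNIV g \<and> compact (closure {x. g x \<noteq> 0})"

locale homogeneous_type_space = complete_measure M
  for M :: "'a::topological_space measure" +
  fixes \<rho> :: "'a \<Rightarrow> 'a \<Rightarrow> real"
  assumes space_eq_UNIV: "space M = UNIV"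
    and compact_support_integrable: "\<And>g. continuous_compact_support g \<Longrightarrow> integrable M g"
    and compact_support_dense:
      "\<And>f e. integrable M f \<Longrightarrow> e > 0 \<Longrightarrow>
         \<exists>g. continuous_compact_support g \<and> (LINT x|M. \<bar>f x - g x\<bar>) < e"
    and rho_nonneg: "\<And>x y. \<rho> x y \<ge> 0"
    and rho_eq_0_iff: "\<And>x y. \<rho> x y = 0 \<longleftrightarrow> x = y"
    and rho_quasi_triangle: "\<exists>a\<^sub>1>0. \<forall>x y z. \<rho> x y \<le> a\<^sub>1 * (\<rho> x z + \<rho> z y)"
    and rho_quasi_sym: "\<exists>a\<^sub>0>0. \<forall>x y. \<rho> x y \<le> a\<^sub>0 * \<rho> y x"
    and qball_sets: "\<And>x r. qball \<rho> x r \<in> sets M"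
    and qball_emeasure: "\<And>x r. r > 0 \<Longrightarrow> 0 < emeasure M (qball \<rho> x r) \<and> emeasure M (qball \<rho> x r) < \<infinity>"
    and qball_in_neighborhood: "\<And>x V. x \<in> interior V \<Longrightarrow> \<exists>r>0. qball \<rho> x r \<subseteq> V"
    and singleton_null: "\<And>x. {x} \<in> null_sets M"
    and rho_bounded: "bdd_above (range (\<lambda>(x, y). \<rho> x y))"
    and annulus_nonempty:
      "\<And>x r R. 0 < r \<Longrightarrow> r < R \<Longrightarrow> R < qdiam \<rho> \<Longrightarrow> qball \<rho> x R - qball \<rho> x r \<noteq> {}"
    and doubling:
      "\<exists>c>0. \<forall>x. \<forall>r>0. measure M (qball \<rho> x (2 * r)) \<le> c * measure M (qball \<rho> x r)"

definition dini_modulus :: "(real \<Rightarrow> real) \<Rightarrow> bool" where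
  "dini_modulus \<omega> \<longleftrightarrow>
     (\<forall>t>0. \<omega> t > 0) \<and> mono_on {0<..} \<omega> \<and>
     (\<exists>c>0. \<forall>t>0. \<omega> (2 * t) \<le> c * \<omega> t) \<and>
     set_integrable lborel {0<..<1} (\<lambda>t. \<omega> t / t)"

text \<open>
  The kernel is defined off the diagonal and \<open>\<omega>\<close> on the positive reals only; the values of the
  total functions \<open>k\<close> and \<open>\<omega>\<close> elsewhere are irrelevant. This is why the smoothness estimate asks
  for \<open>x\<^sub>1 \<noteq> y\<close> and \<open>x\<^sub>1 \<noteq> x\<^sub>2\<close> (\<open>x\<^sub>2 \<noteq> y\<close> follows from the condition on \<open>\<rho>\<close>); for
  \<open>x\<^sub>1 = x\<^sub>2\<close> its left-hand side vanishes.
\<close>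
definition cz_kernel ::
  "'a measure \<Rightarrow> ('a \<Rightarrow> 'a \<Rightarrow> real) \<Rightarrow> (real \<Rightarrow> real) \<Rightarrow> ('a \<Rightarrow> 'a \<Rightarrow> real) \<Rightarrow> bool" where
  "cz_kernel M \<rho> \<omega> k \<longleftrightarrow>
     (\<lambda>(x, y). k x y) \<in> borel_measurable (restrict_space (M \<Otimes>\<^sub>M M) {(x, y). x \<noteq> y}) \<and>
     (\<exists>c>0. \<forall>x y. x \<noteq> y \<longrightarrow> \<bar>k x y\<bar> \<le> c / measure M (qball \<rho> x (\<rho> x y))) \<and>
     (\<exists>b>0. \<exists>c>0. \<forall>x\<^sub>1 x\<^sub>2 y. x\<^sub>1 \<noteq> x\<^sub>2 \<longrightarrow> x\<^sub>1 \<noteq> y \<longrightarrow> \<rho> x\<^sub>2 y > b * \<rho> x\<^sub>1 x\<^sub>2 \<longrightarrow>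
        \<bar>k x\<^sub>1 y - k x\<^sub>2 y\<bar> + \<bar>k y x\<^sub>1 - k y x\<^sub>2\<bar>
          \<le> c * \<omega> (\<rho> x\<^sub>2 x\<^sub>1 / \<rho> x\<^sub>2 y) * (1 / measure M (qball \<rho> x\<^sub>2 (\<rho> x\<^sub>2 y))))"

text \<open>
  Integrability of the truncations is part of the principal value, since the Bochner integral of
  a non-integrable function is \<open>0\<close> by convention.
\<close>
definition has_pv_integral ::
  "'a measure \<Rightarrow> ('a \<Rightarrow> 'a \<Rightarrow> real) \<Rightarrow> ('a \<Rightarrow> 'a \<Rightarrow> real) \<Rightarrow> ('a \<Rightarrow> real) \<Rightarrow> 'a \<Rightarrow> real \<Rightarrow> bool" where
  "has_pv_integral M \<rho> k f x l \<longleftrightarrow>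
     (\<forall>\<epsilon>>0. set_integrable M {y. \<rho> x y > \<epsilon>} (\<lambda>y. k x y * f y)) \<and>
     ((\<lambda>\<epsilon>. LINT y:{y. \<rho> x y > \<epsilon>}|M. k x y * f y) \<longlongrightarrow> l) (at_right 0)"

definition cz_op ::
  "'a measure \<Rightarrow> ('a \<Rightarrow> 'a \<Rightarrow> real) \<Rightarrow> ('a \<Rightarrow> 'a \<Rightarrow> real) \<Rightarrow> ('a \<Rightarrow> real) \<Rightarrow> 'a \<Rightarrow> real" where
  "cz_op M \<rho> k f x = (THE l. has_pv_integral M \<rho> k f x l)"

definition cz_op_defined ::
  "'a measure \<Rightarrow> ('a \<Rightarrow> 'a \<Rightarrow> real) \<Rightarrow> ('a \<Rightarrow> 'a \<Rightarrow> real) \<Rightarrow> ('a \<Rightarrow> real) \<Rightarrow> bool" where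
  "cz_op_defined M \<rho> k f \<longleftrightarrow> (AE x in M. \<exists>l. has_pv_integral M \<rho> k f x l)"

definition L2_space :: "'a measure \<Rightarrow> ('a \<Rightarrow> real) set" where
  "L2_space M = {f \<in> borel_measurable M. integrable M (\<lambda>x. (f x)\<^sup>2)}"

definition L2_norm :: "'a measure \<Rightarrow> ('a \<Rightarrow> real) \<Rightarrow> real" where
  "L2_norm M f = sqrt (LINT x|M. (f x)\<^sup>2)"

definition calderon_zygmund_operator ::
  "'a measure \<Rightarrow> ('a \<Rightarrow> 'a \<Rightarrow> real) \<Rightarrow> ('a \<Rightarrow> 'a \<Rightarrow> real) \<Rightarrow> bool" where
  "calderon_zygmund_operator M \<rho> k \<longleftrightarrow>
     (\<exists>\<omega>. dini_modulus \<omega> \<and> cz_kernel M \<rho> \<omega> k) \<and>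
     (\<forall>f \<in> L2_space M. cz_op_defined M \<rho> k f) \<and>
     (\<exists>C>0. \<forall>f \<in> L2_space M.
        cz_op M \<rho> k f \<in> L2_space M \<and> L2_norm M (cz_op M \<rho> k f) \<le> C * L2_norm M f)"

definition grand_morrey_index ::
  "('a \<Rightarrow> 'a \<Rightarrow> real) \<Rightarrow> real \<Rightarrow> (real \<times> 'a \<times> real) set" where
  "grand_morrey_index \<rho> p = {0<..<p - 1} \<times> UNIV \<times> {0<..<qdiam \<rho>}"

definition grand_morrey_term ::
  "'a measure \<Rightarrow> ('a \<Rightarrow> 'a \<Rightarrow> real) \<Rightarrow> real \<Rightarrow> real \<Rightarrow> real \<Rightarrow> ('a \<Rightarrow> real) \<Rightarrow> real \<times> 'a \<times> real \<Rightarrow> real" where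
  "grand_morrey_term M \<rho> p \<theta> \<kappa> f = (\<lambda>(\<epsilon>, x, r).
     (\<epsilon> powr \<theta> / measure M (qball \<rho> x r) powr \<kappa> *
       (LINT y:qball \<rho> x r|M. \<bar>f y\<bar> powr (p - \<epsilon>))) powr (1 / (p - \<epsilon>)))"

definition grand_morrey_norm ::
  "'a measure \<Rightarrow> ('a \<Rightarrow> 'a \<Rightarrow> real) \<Rightarrow> real \<Rightarrow> real \<Rightarrow> real \<Rightarrow> ('a \<Rightarrow> real) \<Rightarrow> real" where
  "grand_morrey_norm M \<rho> p \<theta> \<kappa> f =
     (SUP i \<in> grand_morrey_index \<rho> p. grand_morrey_term M \<rho> p \<theta> \<kappa> f i)"

text \<open>
  Finiteness of the supremum means that every integral is finite and that the resulting set of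
  reals is bounded above; on such \<open>f\<close> the real-valued \<open>grand_morrey_norm\<close> is the actual supremum.
\<close>
definition grand_morrey_space ::
  "'a measure \<Rightarrow> ('a \<Rightarrow> 'a \<Rightarrow> real) \<Rightarrow> real \<Rightarrow> real \<Rightarrow> real \<Rightarrow> ('a \<Rightarrow> real) set" where
  "grand_morrey_space M \<rho> p \<theta> \<kappa> = {f \<in> borel_measurable M.
     (\<forall>(\<epsilon>, x, r) \<in> grand_morrey_index \<rho> p.
        set_integrable M (qball \<rho> x r) (\<lambda>y. \<bar>f y\<bar> powr (p - \<epsilon>))) \<and>
     bdd_above (grand_morrey_term M \<rho> p \<theta> \<kappa> f ` grand_morrey_index \<rho> p)}"

end

theory Submission
  imports Defs
begin

text \<open>
  The quasi-metric is only used through the relations \<open>E k x y \<longleftrightarrow> \<rho> x y < R * \<delta> ^ k\<close> with \<open>\<delta>\<close> so small that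
  a chain of three steps at scale \<open>k + 1\<close>, in either direction, is one step at scale \<open>k\<close>; this removes
  all quasi-metric constants. Since balls \<open>{x. \<rho> x y < r}\<close> around the second argument need not be
  measurable, every set that occurs is built from the balls \<open>{y. E k x y}\<close> and from dyadic cubes of
  Christ type, of which there are finitely many on each scale because \<open>X\<close> is bounded and doubling.

  The Calderon-Zygmund decomposition \<open>f = g + b\<close> along stopping cubes gives, for integrable \<open>f\<close>, at once
  the almost everywhere existence of the principal value and the weak type (1,1) of \<open>T\<close>: off the thickened
  stopping cubes the truncations of \<open>T b\<close> differ from a truncation of the absolutely convergent integral of
  \<open>(K x y - K x (ctr y)) * b y\<close> by an average of \<open>\<bar>b\<bar>\<close> over a small ball, which vanishes in the limit by
  Lebesgue differentiation. No maximal truncation is needed. A good-lambda inequality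
  \<open>\<mu> {\<bar>T f\<bar> > 3 t} \<le> C * \<gamma> * \<mu> {\<bar>T f\<bar> > t} + \<mu> {M f > \<gamma> * t}\<close>, obtained by stopping on the density of
  \<open>{\<bar>T f\<bar> > t}\<close> in a cube, then bounds \<open>T\<close> on \<open>L\<^sup>s\<close> uniformly for \<open>s\<close> in compact subsets of \<open>(1, \<infinity>)\<close>.

  On a ball, the near part of \<open>f\<close> is controlled by this bound and the far part by summing averages over
  the larger concentric balls, where reverse doubling and \<open>\<kappa> < 1\<close> give a geometric series. This bounds
  \<open>T\<close> on Morrey spaces uniformly for exponents \<open>p - \<epsilon>\<close> with \<open>\<epsilon> \<le> (p - 1) / 2\<close>; the remaining \<open>\<epsilon>\<close>
  follow from \<open>\<epsilon> = (p - 1) / 2\<close> by Hoelder's inequality.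
\<close>

section \<open>Dyadic cubes\<close>

text \<open>The operator is assumed to exist and to be bounded on L^2 only, while a function of the
  grand Morrey space lies in L^s merely for s < p, and p may be below 2; so existence and
  measurability of the principal value have to be proved along with the estimates. As no maximal
  truncation is controlled, the level sets of |T f| are merely measurable, and the Whitney cubes of
  an open set, from which good-lambda inequalities usually start, are not at hand. A cube that is
  maximal for containing a fixed proportion of {|T f| > t} serves instead: its parent contains a
  small proportion, so most points of the cube satisfy |T f| \<le> t, and one of them is the
  comparison point. The case distinction in \<epsilon> is forced by the constant of the L^s bound,
  which contains 1 / (s - 1) and explodes as the exponent p - \<epsilon> tends to 1. In that range
  the weight is bounded above and below, so nothing is lost by descending from a fixed larger
  exponent on a space of finite measure; near \<epsilon> = 0, where the weight degenerates, the
  exponent has to be kept.\<close>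

locale scaled_space = finite_measure M for M :: "'a measure" +
  fixes E :: "nat \<Rightarrow> 'a \<Rightarrow> 'a \<Rightarrow> bool" and D :: real
  assumes space_M: "space M = UNIV"
    and E_0: "E 0 x y"
    and E_refl: "E k x x"
    and E_step: "E (Suc k) x y \<or> E (Suc k) y x \<Longrightarrow> E (Suc k) y z \<or> E (Suc k) z y
      \<Longrightarrow> E (Suc k) z w \<or> E (Suc k) w z \<Longrightarrow> E k x w"
    and E_sets: "{y. E k x y} \<in> sets M"
    and E_pos: "0 < measure M {y. E k x y}"
    and E_doubling: "measure M {y. E k x y} \<le> D * measure M {y. E (Suc k) x y}"
begin

section \<open>Chains of relations and doubling for the balls \<open>U\<close>\<close>

definition near :: "nat \<Rightarrow> 'a \<Rightarrow> 'a \<Rightarrow> bool" where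
  "near k x y \<longleftrightarrow> E k x y \<or> E k y x"

abbreviation U :: "nat \<Rightarrow> 'a \<Rightarrow> 'a set" where
  "U k x \<equiv> {y. E k x y}"

lemma near_refl [simp]: "near k x x"
  by (simp add: near_def E_refl)

lemma near_sym: "near k x y \<Longrightarrow> near k y x"
  by (auto simp: near_def)

lemma E_near: "E k x y \<Longrightarrow> near k x y"
  and E_near': "E k x y \<Longrightarrow> near k y x"
  by (auto simp: near_def)

lemma near_Suc: "near (Suc k) x y \<Longrightarrow> E k x y"
  using E_step[of k x y y y] E_refl by (auto simp: near_def)

lemma near_mono: "j \<le> k \<Longrightarrow> near k x y \<Longrightarrow> near j x y"
proof (induction k)
  case (Suc k)
  show ?case
  proof (cases "j = Suc k")
    case False
    then have "j \<le> k" using Suc.prems by simp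
    then show ?thesis using Suc.IH E_near[OF near_Suc[OF Suc.prems(2)]] by blast
  qed (use Suc in simp)
qed simp

lemma E_mono: "j \<le> k \<Longrightarrow> E k x y \<Longrightarrow> E j x y"
proof (induction k)
  case (Suc k)
  show ?case
  proof (cases "j = Suc k")
    case False
    then have "j \<le> k" using Suc.prems by simp
    then show ?thesis using Suc.IH near_Suc[OF E_near[OF Suc.prems(2)]] by blast
  qed (use Suc in simp)
qed simp

text \<open>All points are related at scale 0, so the truncated differences \<open>a - 1\<close> are
  harmless: where one of them is cut off, \<open>j\<close> is 0 and nothing is claimed. This is what
  permits radii such as \<open>k - d\<close> throughout.\<close>

lemma chain3:
  assumes "near a x y" "near b y z" "near c z w" "j \<le> a - 1" "j \<le> b - 1" "j \<le> c - 1"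
  shows "E j x w"
proof (cases j)
  case 0
  then show ?thesis by (simp add: E_0)
next
  case (Suc i)
  then have "near (Suc j) x y" "near (Suc j) y z" "near (Suc j) z w"
    using assms by (auto intro: near_mono[OF _ assms(1)] near_mono[OF _ assms(2)] near_mono[OF _ assms(3)])
  then show ?thesis unfolding near_def by (rule E_step)
qed

lemma chain2:
  assumes "near a x y" "near b y z" "j \<le> a - 1" "j \<le> b - 1"
  shows "E j x z"
  using chain3[OF assms(1,2) near_refl[of "Suc j"] assms(3,4)] by simp

lemma chain1: "near a x y \<Longrightarrow> j \<le> a - 1 \<Longrightarrow> E j x y"
  using chain2[OF _ near_refl[of "Suc j"]] by simp

lemma U_sets [measurable]: "U k x \<in> sets M" by (rule E_sets)

lemma sets_UNIV [simp, measurable]: "UNIV \<in> sets M"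
  using sets.top[of M] by (simp add: space_M)

lemma U_0: "U 0 x = UNIV" by (simp add: E_0)

lemma U_mono: "j \<le> k \<Longrightarrow> U k x \<subseteq> U j x" by (auto intro: E_mono)

lemma m_mono: "A \<subseteq> B \<Longrightarrow> B \<in> sets M \<Longrightarrow> measure M A \<le> measure M B"
  by (cases "A \<in> sets M") (auto intro: finite_measure_mono simp: measure_notin_sets)

lemma D_ge_1: "1 \<le> D"
proof -
  have "measure M (U 1 undefined) \<le> measure M (U 0 undefined)"
    by (intro m_mono U_mono) auto
  also have "\<dots> \<le> D * measure M (U 1 undefined)" using E_doubling[of 0 undefined] by simp
  finally show ?thesis using E_pos[of 1 undefined] by (simp add: mult_le_cancel_right1)
qed

lemma m_UNIV_pos: "0 < measure M UNIV"
  using E_pos[of 0 undefined] by (simp add: U_0)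

lemma U_doubling_add: "measure M (U k x) \<le> D ^ n * measure M (U (k + n) x)"
proof (induction n)
  case (Suc n)
  have "D ^ n * measure M (U (k + n) x) \<le> D ^ n * (D * measure M (U (Suc (k + n)) x))"
    using D_ge_1 by (intro mult_left_mono E_doubling) auto
  with Suc show ?case by (simp add: mult_ac)
qed simp

lemma U_doubling:
  assumes "j \<le> i + c"
  shows "measure M (U i x) \<le> D ^ c * measure M (U j x)"
proof (cases "i \<le> j")
  case True
  then obtain n where n: "j = i + n" "n \<le> c" using assms by (metis le_Suc_ex nat_add_left_cancel_le)
  have "measure M (U i x) \<le> D ^ n * measure M (U j x)" using U_doubling_add n by simp
  also have "\<dots> \<le> D ^ c * measure M (U j x)"
    using n D_ge_1 by (intro mult_right_mono power_increasing) auto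
  finally show ?thesis .
next
  case False
  then have "measure M (U i x) \<le> measure M (U j x)" by (intro m_mono U_mono) auto
  also have "\<dots> \<le> D ^ c * measure M (U j x)"
    using mult_right_mono[OF one_le_power[OF D_ge_1, of c] measure_nonneg[of M "U j x"]] by simp
  finally show ?thesis .
qed

lemma U_near_subset: "near a x y \<Longrightarrow> i \<le> a - 1 \<Longrightarrow> i \<le> j - 1 \<Longrightarrow> U j x \<subseteq> U i y"
  by (auto intro: chain2 near_sym E_near)

text \<open>Moving the centre costs one scale, by \<open>U_near_subset\<close>, and doubling pays
  for the rest; hence \<open>j + 1\<close> in the hypothesis where \<open>U_doubling\<close> has
  \<open>j\<close>.\<close>

lemma U_near_doubling:
  assumes "near a x y" "i \<le> a" "j + 1 \<le> i + c"
  shows "measure M (U i x) \<le> D ^ c * measure M (U j y)"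
proof -
  have "U i x \<subseteq> U (i - 1) y" using assms by (intro U_near_subset[of a]) auto
  then have "measure M (U i x) \<le> measure M (U (i - 1) y)" by (intro m_mono) auto
  also have "\<dots> \<le> D ^ c * measure M (U j y)" using assms(3) by (intro U_doubling) simp
  finally show ?thesis .
qed

section \<open>Finite nets\<close>

definition separated :: "nat \<Rightarrow> 'a set \<Rightarrow> bool" where
  "separated k S \<longleftrightarrow> (\<forall>x\<in>S. \<forall>y\<in>S. x \<noteq> y \<longrightarrow> \<not> near k x y)"

text \<open>The balls of the next scale around the points are disjoint, and iterated doubling down
  from scale 0, where the ball is the whole space, gives each of them at least the fraction
  \<open>1 / D ^ Suc k\<close> of the total mass.\<close>

lemma card_separated:
  assumes "separated k S" "finite S"
  shows "real (card S) \<le> D ^ Suc k"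
proof -
  have dis: "disjoint_family_on (U (Suc k)) S"
    unfolding disjoint_family_on_def
  proof (intro ballI impI)
    fix x y assume xy: "x \<in> S" "y \<in> S" "x \<noteq> y"
    have "\<not> (E (Suc k) x w \<and> E (Suc k) y w)" for w
      using xy assms(1) chain2[of "Suc k" x w "Suc k" y k] by (auto simp: separated_def near_def)
    then show "U (Suc k) x \<inter> U (Suc k) y = {}" by auto
  qed
  have *: "measure M UNIV \<le> D ^ Suc k * measure M (U (Suc k) x)" for x
    using U_doubling[of "Suc k" 0 "Suc k" x] by (simp add: U_0)
  have "real (card S) * measure M UNIV = (\<Sum>x\<in>S. measure M UNIV)" by simp
  also have "\<dots> \<le> (\<Sum>x\<in>S. D ^ Suc k * measure M (U (Suc k) x))" by (intro sum_mono *)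
  also have "\<dots> = D ^ Suc k * measure M (\<Union>x\<in>S. U (Suc k) x)"
    using assms dis by (subst finite_measure_finite_Union) (auto simp: sum_distrib_left)
  also have "\<dots> \<le> D ^ Suc k * measure M UNIV"
    using D_ge_1 by (intro mult_left_mono m_mono) auto
  finally show ?thesis using m_UNIV_pos by simp
qed

text \<open>A separated set of maximal cardinality is a net, since a point near none of its members
  could be added.\<close>

lemma net_exists: "\<exists>S. finite S \<and> separated k S \<and> (\<forall>x. \<exists>z\<in>S. near k z x)"
proof -
  let ?P = "\<lambda>S. finite S \<and> separated k S"
  have bd: "card S \<le> nat \<lfloor>D ^ Suc k\<rfloor>" if "?P S" for S
    using card_separated[of k S] that by (simp add: le_nat_floor)
  have "\<exists>S. ?P S \<and> (\<forall>S'. ?P S' \<longrightarrow> card S' \<le> card S)"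
    by (rule ex_has_greatest_nat[of ?P "{}" card "Suc (nat \<lfloor>D ^ Suc k\<rfloor>)"])
      (use bd in \<open>auto simp: separated_def le_imp_less_Suc less_imp_le\<close>)
  then obtain S where S: "?P S" "\<And>S'. ?P S' \<Longrightarrow> card S' \<le> card S" by blast
  have "\<exists>z\<in>S. near k z x" for x
  proof (rule ccontr)
    assume no: "\<not> ?thesis"
    then have "x \<notin> S" by auto
    moreover have "?P (insert x S)" using S(1) no by (auto simp: separated_def dest: near_sym)
    ultimately show False using S(2)[of "insert x S"] S(1) by simp
  qed
  with S show ?thesis by blast
qed

text \<open>\<open>A\<close> takes finitely many values, and each fibre is a finite intersection of
  measurable sets. A choice of the form \<open>SOME z. z \<in> A x\<close> depends on
  \<open>x\<close> only through \<open>A x\<close> and so becomes measurable; all choices of net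
  points that vary with \<open>x\<close> are cast in this form.\<close>

lemma finite_choice_sets:
  assumes "finite N" "\<And>x. A x \<subseteq> N" "\<And>z. z \<in> N \<Longrightarrow> {x. z \<in> A x} \<in> sets M"
  shows "{x. \<phi> (A x)} \<in> sets M"
proof -
  have "{x. A x = B} \<in> sets M" if "B \<subseteq> N" for B
  proof -
    have "{x. A x = B} = {x. \<forall>z\<in>N. z \<in> A x \<longleftrightarrow> z \<in> B}"
      using assms(2) that by blast
    also have "\<dots> = {x \<in> space M. \<forall>z\<in>N. z \<in> A x \<longleftrightarrow> z \<in> B}" by (auto simp: space_M)
    also have "\<dots> \<in> sets M"
    proof (rule sets.sets_Collect_finite_All[OF _ assms(1)])
      fix z assume z: "z \<in> N"
      have "{x \<in> space M. z \<in> A x \<longleftrightarrow> z \<in> B} =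
        (if z \<in> B then {x. z \<in> A x} else UNIV - {x. z \<in> A x})" by (auto simp: space_M)
      then show "{x \<in> space M. z \<in> A x \<longleftrightarrow> z \<in> B} \<in> sets M" using assms(3)[OF z] by auto
    qed
    finally show ?thesis .
  qed
  then have "(\<Union>B\<in>{B \<in> Pow N. \<phi> B}. {x. A x = B}) \<in> sets M"
    using assms(1) by (intro sets.finite_UN) auto
  also have "(\<Union>B\<in>{B \<in> Pow N. \<phi> B}. {x. A x = B}) = {x. \<phi> (A x)}" using assms(2) by auto
  finally show ?thesis .
qed

definition net :: "nat \<Rightarrow> 'a set" where
  "net k = (SOME S. finite S \<and> separated (3 * k) S \<and> (\<forall>x. \<exists>z\<in>S. near (3 * k) z x))"

lemma net: "finite (net k)" "separated (3 * k) (net k)" "\<exists>z\<in>net k. near (3 * k) z x"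
  using someI_ex[OF net_exists[of "3 * k"]] unfolding net_def by blast+

text \<open>Net points of level \<open>k\<close> are separated at scale \<open>3 * k\<close>, so at most one is near a given point
  at scale \<open>3 * k + 1\<close>; it has to be the parent, which gives the cubes their inner balls.\<close>

definition par :: "nat \<Rightarrow> 'a \<Rightarrow> 'a" where
  "par k w = (SOME z. z \<in> net k \<and> near (3 * k) z w \<and> (\<forall>z'\<in>net k. near (3 * k + 1) z' w \<longrightarrow> z' = z))"

lemma par:
  "par k w \<in> net k" "near (3 * k) (par k w) w"
  "z' \<in> net k \<Longrightarrow> near (3 * k + 1) z' w \<Longrightarrow> z' = par k w"
proof -
  have "\<exists>z. z \<in> net k \<and> near (3 * k) z w \<and> (\<forall>z'\<in>net k. near (3 * k + 1) z' w \<longrightarrow> z' = z)"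
  proof (cases "\<exists>z\<in>net k. near (3 * k + 1) z w")
    case True
    then obtain z where z: "z \<in> net k" "near (3 * k + 1) z w" by blast
    have "z' = z" if "z' \<in> net k" "near (3 * k + 1) z' w" for z'
    proof -
      have "near (3 * k) z' z"
        by (rule E_near, rule chain2[OF that(2) near_sym[OF z(2)]]) simp_all
      then show ?thesis using z(1) that(1) net(2)[of k] unfolding separated_def by blast
    qed
    then show ?thesis using z(1) near_mono[OF le_add1 z(2)] by blast
  qed (use net(3)[of k w] in auto)
  note * = someI_ex[OF this, folded par_def]
  show "par k w \<in> net k" "near (3 * k) (par k w) w"
    "z' \<in> net k \<Longrightarrow> near (3 * k + 1) z' w \<Longrightarrow> z' = par k w" using * by auto
qed

section \<open>Ancestors, approximating net points and the choice of cubes\<close>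

primrec anc :: "nat \<Rightarrow> nat \<Rightarrow> 'a \<Rightarrow> 'a" where
  "anc 0 k w = w"
| "anc (Suc n) k w = par k (anc n (Suc k) w)"

lemma anc_net: "w \<in> net (k + n) \<Longrightarrow> anc n k w \<in> net k"
  by (cases n) (auto simp: par)

text \<open>The bound does not deteriorate with \<open>n\<close>: the ancestor on level
  \<open>k + 1\<close> is within scale \<open>3 * k + 2\<close> of \<open>w\<close>, its parent is
  within scale \<open>3 * k\<close> of it, and one chain leads to scale \<open>3 * k - 1\<close>.
  The spacing of three scales per level stands in for summing a geometric series.\<close>

lemma anc_near: "E (3 * k - 1) (anc n k w) w"
proof (induction n arbitrary: k)
  case (Suc n)
  show ?case
    using chain2[OF par(2)[of k "anc n (Suc k) w"] E_near[OF Suc[of "Suc k"]], of "3 * k - 1"] by simp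
qed (simp add: E_refl)

text \<open>Chosen from a set, and with the unsymmetric relation in place of \<open>near\<close>, so
  that \<open>finite_choice_sets\<close> gives measurability in \<open>x\<close>.\<close>

definition approx :: "nat \<Rightarrow> 'a \<Rightarrow> 'a" where
  "approx n x = (SOME z. z \<in> {z \<in> net n. E (3 * n - 1) z x})"

lemma approx: "approx n x \<in> net n" "E (3 * n - 1) (approx n x) x"
proof -
  obtain z where "z \<in> net n" "near (3 * n) z x" using net(3)[of n x] by blast
  then have "\<exists>z. z \<in> {z \<in> net n. E (3 * n - 1) z x}" using chain1[of "3 * n" z x "3 * n - 1"] by blast
  from someI_ex[OF this, folded approx_def]
  show "approx n x \<in> net n" "E (3 * n - 1) (approx n x) x" by auto
qed

lemma approx_sets: "{x. \<phi> (approx n x)} \<in> sets M"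
  unfolding approx_def
  by (rule finite_choice_sets[OF net(1)[of n], where A = "\<lambda>x. {z \<in> net n. E (3 * n - 1) z x}"
        and \<phi> = "\<lambda>A. \<phi> (SOME z. z \<in> A)"]) auto

text \<open>A limsup of measurable sets. The ancestors of successive approximations of
  \<open>x\<close> need not stabilise, and \<open>x\<close> may belong to several of these sets on
  one level; \<open>centre\<close> picks one of them consistently over all levels.\<close>

definition reach :: "nat \<Rightarrow> 'a \<Rightarrow> 'a set" where
  "reach k z = {x. \<exists>\<^sub>F n in sequentially. anc n k (approx (k + n) x) = z}"

lemma reach_sets: "reach k z \<in> sets M"
proof -
  have "reach k z = (\<Inter>m. \<Union>n\<in>{m..}. {x. anc n k (approx (k + n) x) = z})"
    by (auto simp: reach_def frequently_sequentially)
  also have "\<dots> \<in> sets M"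
    by (intro sets.countable_INT sets.countable_UN') (auto intro!: approx_sets)
  finally show ?thesis .
qed

text \<open>Pigeonhole: infinitely many of the ancestor chains end in \<open>z\<close>, and
  infinitely many of those pass through the same child, because a level has finitely many net
  points.\<close>

lemma reach_child:
  assumes "x \<in> reach k z"
  shows "\<exists>z'. z' \<in> net (Suc k) \<and> par k z' = z \<and> x \<in> reach (Suc k) z'"
proof -
  have "\<exists>\<^sub>F n in sequentially. anc (Suc n) k (approx (k + Suc n) x) = z"
    unfolding frequently_sequentially
  proof
    fix m
    obtain n where "n \<ge> Suc m" "anc n k (approx (k + n) x) = z"
      using assms unfolding reach_def frequently_sequentially by blast
    then show "\<exists>n\<ge>m. anc (Suc n) k (approx (k + Suc n) x) = z"
      by (cases n) auto
  qed
  then have "\<exists>\<^sub>F n in sequentially. \<exists>z'\<in>net (Suc k).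
      anc n (Suc k) (approx (Suc k + n) x) = z' \<and> par k z' = z"
    by (rule frequently_elim1) (auto intro!: anc_net approx)
  then obtain z' where "z' \<in> net (Suc k)"
    "\<exists>\<^sub>F n in sequentially. anc n (Suc k) (approx (Suc k + n) x) = z' \<and> par k z' = z"
    using frequently_bex_finite[OF net(1)[of "Suc k"], where F = sequentially
        and P = "\<lambda>n z'. anc n (Suc k) (approx (Suc k + n) x) = z' \<and> par k z' = z"] by blast
  then show ?thesis
    unfolding reach_def by (auto simp: frequently_sequentially)
qed

text \<open>The choice proceeds from the root and only among children of the point already chosen,
  which makes the cubes nested by construction.\<close>

primrec centre :: "nat \<Rightarrow> 'a \<Rightarrow> 'a" where
  "centre 0 x = (SOME z. z \<in> net 0)"
| "centre (Suc k) x = (SOME z. z \<in> {z \<in> net (Suc k). par k z = centre k x \<and> x \<in> reach (Suc k) z})"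

lemma centre_reach: "centre k x \<in> net k \<and> x \<in> reach k (centre k x)"
proof (induction k)
  case 0
  have "z = z'" if "z \<in> net 0" "z' \<in> net 0" for z z'
    using that net(2)[of 0] by (auto simp: separated_def near_def E_0)
  moreover have "anc n 0 (approx n x) \<in> net 0" for n by (intro anc_net) (simp add: approx)
  moreover have z: "centre 0 x \<in> net 0" using net(3)[of 0 x] someI_ex[of "\<lambda>z. z \<in> net 0"] by auto
  ultimately have "anc n 0 (approx n x) = centre 0 x" for n by blast
  with z show ?case by (auto simp: reach_def frequently_sequentially)
next
  case (Suc k)
  then have "\<exists>z. z \<in> {z \<in> net (Suc k). par k z = centre k x \<and> x \<in> reach (Suc k) z}"
    using reach_child by blast
  from someI_ex[OF this] show ?case by simp
qed

lemma par_centre: "par k (centre (Suc k) x) = centre k x"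
proof -
  have "\<exists>z. z \<in> {z \<in> net (Suc k). par k z = centre k x \<and> x \<in> reach (Suc k) z}"
    using reach_child centre_reach by blast
  from someI_ex[OF this] show ?thesis by simp
qed

lemma centre_sets: "{x. centre k x = z} \<in> sets M"
proof (induction k arbitrary: z)
  case (Suc k)
  have "{x. z' \<in> {z \<in> net (Suc k). par k z = centre k x \<and> x \<in> reach (Suc k) z}} \<in> sets M"
    if "z' \<in> net (Suc k)" for z'
  proof -
    have "{x. z' \<in> {z \<in> net (Suc k). par k z = centre k x \<and> x \<in> reach (Suc k) z}} =
      {x. centre k x = par k z'} \<inter> reach (Suc k) z'" using that by auto
    then show ?thesis using Suc reach_sets by simp
  qed
  then show ?case
    using finite_choice_sets[OF net(1)[of "Suc k"],
        where A = "\<lambda>x. {z \<in> net (Suc k). par k z = centre k x \<and> x \<in> reach (Suc k) z}"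
        and \<phi> = "\<lambda>A. (SOME z. z \<in> A) = z"] by simp
qed simp

lemma reach_witness:
  assumes "x \<in> reach k z"
  obtains n where "n \<ge> 2" "anc n k (approx (k + n) x) = z"
  using assms unfolding reach_def frequently_sequentially by blast

lemma centre_near: "E (3 * (k - 1)) (centre k x) x"
proof -
  obtain n where n: "n \<ge> 2" "anc n k (approx (k + n) x) = centre k x"
    using reach_witness centre_reach by metis
  show ?thesis
    using chain2[OF E_near[OF anc_near[of k n "approx (k + n) x"]] E_near[OF approx(2)[of "k + n" x]]] n
    by auto
qed

text \<open>On an ancestor chain from an approximation of \<open>y\<close> to
  \<open>centre k y\<close>, the member of level \<open>k + 1\<close> is still within scale
  \<open>3 * k + 1\<close> of \<open>centre k x\<close>, and \<open>par\<close> sends every such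
  point to that net point.\<close>

lemma centre_inner:
  assumes "near (3 * k + 2) (centre k x) y"
  shows "centre k y = centre k x"
proof -
  obtain n where n: "n \<ge> 2" "anc n k (approx (k + n) y) = centre k y"
    using reach_witness centre_reach by metis
  then obtain n' where n': "n = Suc n'" by (cases n) auto
  let ?w = "approx (k + n) y" and ?u = "anc n' (Suc k) (approx (k + n) y)"
  have "E (3 * k + 1) (centre k x) ?u"
    by (rule chain3[OF assms E_near'[OF approx(2)[of "k + n" y]]
          E_near'[OF anc_near[of "Suc k" n' ?w]]]) (use n in auto)
  then have "centre k x = par k ?u" using centre_reach by (intro par(3)) (auto simp: near_def)
  with n n' show ?thesis by simp
qed

end

text \<open>The properties of \<open>centre\<close> after passing to every third scale, where one
  level is one scale: the cube lies between the balls of scales \<open>k + 1\<close> and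
  \<open>k - 1\<close> around its centre.\<close>

locale cube_space = scaled_space M E D for M :: "'a measure" and E D +
  fixes \<pi> :: "nat \<Rightarrow> 'a \<Rightarrow> 'a"
  assumes \<pi>_finite: "finite (range (\<pi> k))"
    and \<pi>_sets: "{x. \<pi> k x = z} \<in> sets M"
    and \<pi>_0: "\<pi> 0 x = \<pi> 0 y"
    and \<pi>_refine: "\<pi> (Suc k) x = \<pi> (Suc k) y \<Longrightarrow> \<pi> k x = \<pi> k y"
    and \<pi>_near: "E (k - 1) (\<pi> k x) x"
    and \<pi>_inner: "near (Suc k) (\<pi> k x) y \<Longrightarrow> \<pi> k y = \<pi> k x"

lemma (in scaled_space) scaled_space_rescale: "scaled_space M (\<lambda>k. E (3 * k)) (D ^ 3)"
proof (rule scaled_space.intro[OF finite_measure_axioms scaled_space_axioms.intro])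
  show "E (3 * k) x w" if "E (3 * Suc k) x y \<or> E (3 * Suc k) y x"
    "E (3 * Suc k) y z \<or> E (3 * Suc k) z y" "E (3 * Suc k) z w \<or> E (3 * Suc k) w z" for k x y z w
    by (rule chain3[OF that[folded near_def]]) simp_all
  show "measure M (U (3 * k) x) \<le> D ^ 3 * measure M (U (3 * Suc k) x)" for k x
    by (rule U_doubling) simp
  show "E (3 * 0) x y" for x y by (simp add: E_0)
qed (rule space_M E_refl E_pos E_sets)+

lemma (in scaled_space) cube_space_exists:
  "\<exists>\<pi>. cube_space M (\<lambda>k. E (3 * k)) (D ^ 3) \<pi>"
proof -
  have near: "near (3 * k + 2) (centre k x) y"
    if "scaled_space.near (\<lambda>k. E (3 * k)) (Suc k) (centre k x) y" for k x y
  proof (rule near_mono)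
    show "near (3 * Suc k) (centre k x) y"
      using that by (simp only: scaled_space.near_def[OF scaled_space_rescale] near_def)
  qed simp
  have refine: "centre k x = centre k y" if "centre (Suc k) x = centre (Suc k) y" for k x y
    using arg_cong[OF that, of "par k"] unfolding par_centre .
  have fin: "finite (range (centre k))" for k
    by (rule finite_subset[OF _ net(1)[of k]]) (use centre_reach[of k] in blast)
  have c0: "centre 0 x = centre 0 y" for x y by simp
  have "cube_space_axioms M (\<lambda>k. E (3 * k)) centre"
  proof (rule cube_space_axioms.intro)
    show "E (3 * (k - 1)) (centre k x) x" for k x by (rule centre_near)
    show "centre k y = centre k x"
      if "scaled_space.near (\<lambda>k. E (3 * k)) (Suc k) (centre k x) y" for k x y
      using that by (intro centre_inner near)
  qed (fact fin centre_sets c0 refine)+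
  with scaled_space_rescale show ?thesis unfolding cube_space_def by blast
qed

section \<open>Stopping cubes\<close>

lemma set_integrable_of_integrable:
  fixes f :: "'a \<Rightarrow> real"
  assumes "integrable M f" "A \<in> sets M"
  shows "set_integrable M A f"
  using integrable_mult_indicator[OF assms(2,1)] by (simp add: set_integrable_def)

lemma set_integral_le_subset:
  fixes f :: "'a \<Rightarrow> real"
  assumes "set_integrable M B f" "A \<in> sets M" "A \<subseteq> B" "\<And>x. x \<in> B \<Longrightarrow> 0 \<le> f x"
  shows "(LINT x:A|M. f x) \<le> (LINT x:B|M. f x)"
  unfolding set_lebesgue_integral_def
proof (rule integral_mono)
  show "integrable M (\<lambda>x. indicator A x *\<^sub>R f x)"
    using set_integrable_subset[OF assms(1-3)] by (simp add: set_integrable_def)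
qed (use assms in \<open>auto simp: set_integrable_def indicator_def\<close>)

text \<open>The exceptional sets for \<open>1 / Suc n\<close> need not be nested, but their
  intersection is null, and off it one of them is avoided. This turns weak type estimates into
  statements almost everywhere.\<close>

lemma (in finite_measure) AE_of_small_exceptions:
  assumes "\<And>e::real. 0 < e \<Longrightarrow> \<exists>S\<in>sets M. measure M S \<le> e \<and> (AE x in M. x \<notin> S \<longrightarrow> P x)"
  shows "AE x in M. P x"
proof -
  have "\<exists>S. S \<in> sets M \<and> measure M S \<le> 1 / real (Suc n) \<and> (AE x in M. x \<notin> S \<longrightarrow> P x)" for n
    using assms[of "1 / real (Suc n)"] by auto
  then obtain S where "\<forall>n. S n \<in> sets M \<and> measure M (S n) \<le> 1 / real (Suc n) \<and>
      (AE x in M. x \<notin> S n \<longrightarrow> P x)" using choice[of "\<lambda>n S. S \<in> sets M \<and> measure M S \<le> 1 / real (Suc n) \<and>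
      (AE x in M. x \<notin> S \<longrightarrow> P x)"] by blast
  then have S: "\<And>n. S n \<in> sets M" "\<And>n. measure M (S n) \<le> 1 / real (Suc n)"
    "\<And>n. AE x in M. x \<notin> S n \<longrightarrow> P x" by auto
  have "measure M (\<Inter>n. S n) \<le> 0"
  proof (rule LIMSEQ_le_const)
    show "(\<lambda>n. 1 / real (Suc n)) \<longlonglongrightarrow> 0"
      using LIMSEQ_inverse_real_of_nat by (simp add: inverse_eq_divide)
    show "\<exists>N. \<forall>n\<ge>N. measure M (\<Inter>n. S n) \<le> 1 / real (Suc n)"
    proof (intro exI[of _ 0] allI impI)
      fix n
      have "measure M (\<Inter>n. S n) \<le> measure M (S n)" using S(1) by (intro finite_measure_mono) auto
      also have "\<dots> \<le> 1 / real (Suc n)" by (rule S(2))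
      finally show "measure M (\<Inter>n. S n) \<le> 1 / real (Suc n)" .
    qed
  qed
  then have "(\<Inter>n. S n) \<in> null_sets M"
    using S(1) measure_nonneg[of M "\<Inter>n. S n"]
    by (intro null_setsI) (auto simp: emeasure_eq_measure intro: antisym)
  then have "AE x in M. x \<notin> (\<Inter>n. S n)" by (rule AE_not_in)
  moreover have "AE x in M. \<forall>n. x \<notin> S n \<longrightarrow> P x" using S(3) unfolding AE_all_countable by blast
  ultimately show ?thesis by (auto elim: eventually_elim2)
qed

context cube_space
begin

section \<open>Volumes of cubes and families of maximal cubes\<close>

abbreviation Q :: "nat \<Rightarrow> 'a \<Rightarrow> 'a set" where
  "Q k z \<equiv> {x. \<pi> k x = z}"

lemma Q_sets [measurable]: "Q k z \<in> sets M" by (rule \<pi>_sets)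

lemma \<pi>_refine_le: "j \<le> k \<Longrightarrow> \<pi> k x = \<pi> k y \<Longrightarrow> \<pi> j x = \<pi> j y"
  by (induction k) (auto simp: le_Suc_eq dest: \<pi>_refine)

lemma \<pi>_near_le: "j \<le> k - 1 \<Longrightarrow> E j (\<pi> k x) x"
  using E_mono \<pi>_near by blast

lemma Q_subset_U: "j \<le> k - 1 \<Longrightarrow> Q k (\<pi> k x) \<subseteq> U j (\<pi> k x)"
proof
  fix y assume "j \<le> k - 1" "y \<in> Q k (\<pi> k x)"
  then show "y \<in> U j (\<pi> k x)" using \<pi>_near_le[of j k y] by simp
qed

text \<open>The cube contains the ball of scale \<open>k + 1\<close> around its centre, which
  accounts for the 1 in \<open>d + 1\<close>. For \<open>z\<close> outside the range of
  \<open>\<pi> k\<close> the set \<open>Q k z\<close> is empty, hence the form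
  \<open>\<pi> k x\<close>.\<close>

lemma U_le_Q: "measure M (U (k - d) (\<pi> k x)) \<le> D ^ (d + 1) * measure M (Q k (\<pi> k x))"
proof -
  have "measure M (U (k - d) (\<pi> k x)) \<le> D ^ (d + 1) * measure M (U (Suc k) (\<pi> k x))"
    by (rule U_doubling) simp
  also have "U (Suc k) (\<pi> k x) \<subseteq> Q k (\<pi> k x)"
    using \<pi>_inner E_near by blast
  then have "D ^ (d + 1) * measure M (U (Suc k) (\<pi> k x)) \<le> D ^ (d + 1) * measure M (Q k (\<pi> k x))"
    using D_ge_1 by (intro mult_left_mono m_mono) auto
  finally show ?thesis .
qed

lemma Q_pos: "0 < measure M (Q k (\<pi> k x))"
proof -
  have "U (Suc k) (\<pi> k x) \<subseteq> Q k (\<pi> k x)"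
    using \<pi>_inner E_near by blast
  then have "measure M (U (Suc k) (\<pi> k x)) \<le> measure M (Q k (\<pi> k x))" by (intro m_mono) auto
  with E_pos[of "Suc k" "\<pi> k x"] show ?thesis by simp
qed

text \<open>The larger cube lies in the ball around the centre of the smaller one that is three
  scales above level \<open>Suc k\<close>; the fourth power of \<open>D\<close> is the case
  \<open>d = 3\<close> of \<open>U_le_Q\<close>.\<close>

lemma Q_parent: "measure M (Q k (\<pi> k x)) \<le> D ^ 4 * measure M (Q (Suc k) (\<pi> (Suc k) x))"
proof -
  have "Q k (\<pi> k x) \<subseteq> U (Suc k - 3) (\<pi> (Suc k) x)"
  proof
    fix y assume "y \<in> Q k (\<pi> k x)"
    then have "E (k - 1) (\<pi> k x) y" using \<pi>_near[of k y] by auto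
    with \<pi>_near[of k x] \<pi>_near[of "Suc k" x] show "y \<in> U (Suc k - 3) (\<pi> (Suc k) x)"
      by (auto intro!: chain3[of "Suc k - 1" _ x "k - 1" "\<pi> k x" "k - 1"] simp: near_def)
  qed
  then have "measure M (Q k (\<pi> k x)) \<le> measure M (U (Suc k - 3) (\<pi> (Suc k) x))"
    by (intro m_mono) auto
  then show ?thesis using U_le_Q[of "Suc k" 3 x] by simp
qed

text \<open>A family of cubes is a predicate on level and centre; \<open>top P\<close> singles out its maximal
  members and \<open>stop P\<close> is their union.\<close>

definition top :: "(nat \<Rightarrow> 'a \<Rightarrow> bool) \<Rightarrow> nat \<Rightarrow> 'a \<Rightarrow> bool" where
  "top P k x \<longleftrightarrow> P k (\<pi> k x) \<and> (\<forall>j<k. \<not> P j (\<pi> j x))"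

definition stop :: "(nat \<Rightarrow> 'a \<Rightarrow> bool) \<Rightarrow> 'a set" where
  "stop P = {x. \<exists>k. P k (\<pi> k x)}"

definition cubes :: "(nat \<Rightarrow> 'a \<Rightarrow> bool) \<Rightarrow> (nat \<times> 'a) set" where
  "cubes P = {(k, z). \<exists>x. z = \<pi> k x \<and> top P k x}"

definition thick :: "nat \<Rightarrow> (nat \<Rightarrow> 'a \<Rightarrow> bool) \<Rightarrow> 'a set" where
  "thick d P = (\<Union>(k, z)\<in>cubes P. U (k - d) z)"

lemma stop_top: "x \<in> stop P \<longleftrightarrow> (\<exists>k. top P k x)"
  unfolding stop_def top_def using exists_least_iff[of "\<lambda>k. P k (\<pi> k x)"] by auto

lemma top_unique: "top P k x \<Longrightarrow> top P j x \<Longrightarrow> k = j"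
  unfolding top_def by (meson linorder_neqE_nat)

text \<open>Maximality of a cube can be read off at any of its points, because two points of one
  cube share all larger cubes.\<close>

lemma cubes_top: "(k, z) \<in> cubes P \<Longrightarrow> \<pi> k x = z \<Longrightarrow> top P k x"
proof -
  assume "(k, z) \<in> cubes P" "\<pi> k x = z"
  then obtain y where y: "\<pi> k x = \<pi> k y" "top P k y" by (auto simp: cubes_def)
  have "\<pi> j x = \<pi> j y" if "j \<le> k" for j using \<pi>_refine_le[OF that y(1)] .
  then show ?thesis using y(2) by (auto simp: top_def)
qed

lemma cubes_finite: "finite {(k, z) \<in> cubes P. k < n}"
proof (rule finite_subset)
  show "{(k, z) \<in> cubes P. k < n} \<subseteq> (\<Union>k<n. (\<lambda>z. (k, z)) ` range (\<pi> k))"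
    by (auto simp: cubes_def)
qed (auto intro: \<pi>_finite)

lemma cubes_countable: "countable (cubes P)"
proof -
  have "cubes P = (\<Union>n. {(k, z) \<in> cubes P. k < n})" by auto
  then show ?thesis
    using countable_UN[OF countableI_type, of UNIV "\<lambda>n. {(k, z) \<in> cubes P. k < n}"]
      countable_finite[OF cubes_finite] by metis
qed

lemma stop_UN: "stop P = (\<Union>(k, z)\<in>cubes P. Q k z)"
proof
  show "stop P \<subseteq> (\<Union>(k, z)\<in>cubes P. Q k z)"
    by (fastforce simp: stop_top cubes_def)
  show "(\<Union>(k, z)\<in>cubes P. Q k z) \<subseteq> stop P"
    using cubes_top by (fastforce simp: stop_top)
qed

lemma stop_sets [measurable]: "stop P \<in> sets M"
  unfolding stop_UN by (rule sets.countable_UN'[OF cubes_countable]) auto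

lemma thick_sets [measurable]: "thick d P \<in> sets M"
  unfolding thick_def by (rule sets.countable_UN'[OF cubes_countable]) auto

lemma stop_subset_thick:
  assumes "1 \<le> d"
  shows "stop P \<subseteq> thick d P"
proof
  fix x assume "x \<in> stop P"
  then obtain k where "top P k x" by (auto simp: stop_top)
  moreover have "E (k - d) (\<pi> k x) x" using assms by (intro \<pi>_near_le) auto
  ultimately show "x \<in> thick d P" by (auto simp: thick_def cubes_def)
qed

text \<open>Only finitely many cubes have level below \<open>n\<close>, so sums over all stopping
  cubes are obtained as limits of finite sums.\<close>

definition stop_upto :: "(nat \<Rightarrow> 'a \<Rightarrow> bool) \<Rightarrow> nat \<Rightarrow> 'a set" where
  "stop_upto P n = (\<Union>(k, z)\<in>{(k, z) \<in> cubes P. k < n}. Q k z)"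

lemma stop_upto_sets [measurable]: "stop_upto P n \<in> sets M"
  unfolding stop_upto_def using cubes_finite by (intro sets.finite_UN) auto

lemma stop_upto_disjoint: "disjoint_family_on (\<lambda>(k, z). Q k z) {(k, z) \<in> cubes P. k < n}"
  unfolding disjoint_family_on_def by (auto; metis cubes_top top_unique)

lemma stop_upto: "incseq (stop_upto P)" "(\<Union>n. stop_upto P n) = stop P"
proof -
  show "incseq (stop_upto P)" unfolding incseq_def stop_upto_def by fastforce
  show "(\<Union>n. stop_upto P n) = stop P" unfolding stop_UN stop_upto_def by fastforce
qed

text \<open>Summation over the disjoint maximal cubes in a form that hides the sum. With
  \<open>h - t\<close> or \<open>c - indicator G\<close> for \<open>\<phi>\<close> an estimate on
  each cube becomes one on the union; applied to a function and its negative it sums vanishing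
  means.\<close>

lemma stop_integral_nonneg:
  fixes \<phi> :: "'a \<Rightarrow> real"
  assumes \<phi>: "integrable M \<phi>" and Q: "\<And>k z. (k, z) \<in> cubes P \<Longrightarrow> 0 \<le> (LINT y:Q k z|M. \<phi> y)"
  shows "0 \<le> (LINT y:stop P|M. \<phi> y)"
proof -
  have "(\<lambda>n. LINT y:stop_upto P n|M. \<phi> y) \<longlonglongrightarrow> (LINT y:(\<Union>n. stop_upto P n)|M. \<phi> y)"
    by (rule set_integral_cont_up)
      (auto simp: stop_upto(1) intro!: set_integrable_of_integrable \<phi> sets.countable_UN)
  moreover have "0 \<le> (LINT y:stop_upto P n|M. \<phi> y)" for n
  proof -
    have "(LINT y:stop_upto P n|M. \<phi> y) =
      (\<Sum>i\<in>{(k, z) \<in> cubes P. k < n}. LINT y:(case i of (k, z) \<Rightarrow> Q k z)|M. \<phi> y)"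
      unfolding stop_upto_def
      by (rule set_integral_finite_Union[OF cubes_finite stop_upto_disjoint])
        (auto intro!: set_integrable_of_integrable \<phi>)
    also have "\<dots> \<ge> 0" by (rule sum_nonneg) (use Q in auto)
    finally show ?thesis .
  qed
  ultimately show ?thesis unfolding stop_upto(2) by (intro LIMSEQ_le_const) auto
qed

text \<open>The enlarged balls overlap and are only counted with subadditivity; disjointness enters
  after each ball has been traded for its cube.\<close>

lemma measure_thick_le: "measure M (thick d P) \<le> D ^ (d + 1) * measure M (stop P)"
proof -
  define T where "T n = (\<Union>(k, z)\<in>{(k, z) \<in> cubes P. k < n}. U (k - d) z)" for n
  have T_sets: "T n \<in> sets M" for n unfolding T_def using cubes_finite by (intro sets.finite_UN) auto
  have "incseq T" unfolding incseq_def T_def by fastforce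
  moreover have "(\<Union>n. T n) = thick d P" unfolding T_def thick_def by fastforce
  ultimately have "(\<lambda>n. measure M (T n)) \<longlonglongrightarrow> measure M (thick d P)"
    using finite_Lim_measure_incseq[of T] T_sets by auto
  moreover have "measure M (T n) \<le> D ^ (d + 1) * measure M (stop P)" for n
  proof -
    let ?I = "{(k, z) \<in> cubes P. k < n}"
    have "measure M (T n) \<le> (\<Sum>i\<in>?I. measure M (case i of (k, z) \<Rightarrow> U (k - d) z))"
      unfolding T_def by (rule finite_measure_subadditive_finite[OF cubes_finite]) auto
    also have "\<dots> \<le> (\<Sum>i\<in>?I. D ^ (d + 1) * measure M (case i of (k, z) \<Rightarrow> Q k z))"
    proof (rule sum_mono)
      fix i assume "i \<in> ?I"
      then obtain k x where "i = (k, \<pi> k x)" by (auto simp: cubes_def)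
      then show "measure M (case i of (k, z) \<Rightarrow> U (k - d) z) \<le> D ^ (d + 1) * measure M (case i of (k, z) \<Rightarrow> Q k z)"
        using U_le_Q by simp
    qed
    also have "\<dots> = D ^ (d + 1) * measure M (stop_upto P n)"
      unfolding stop_upto_def sum_distrib_left[symmetric]
      by (subst finite_measure_finite_Union[OF cubes_finite _ stop_upto_disjoint]) auto
    also have "\<dots> \<le> D ^ (d + 1) * measure M (stop P)"
      using D_ge_1 stop_upto(2)[of P] by (intro mult_left_mono m_mono) auto
    finally show ?thesis .
  qed
  ultimately show ?thesis by (intro LIMSEQ_le_const2) auto
qed

lemma set_integral_const': "A \<in> sets M \<Longrightarrow> (LINT y:A|M. c) = c * measure M A" for c :: real
  by (simp add: set_lebesgue_integral_def emeasure_eq_measure)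

lemma set_integrable_const [simp, intro]: "A \<in> sets M \<Longrightarrow> set_integrable M A (\<lambda>_. c :: real)"
  by (intro set_integrable_of_integrable) auto

text \<open>The maximal function is only used through its superlevel sets; its averages are taken over the
  balls \<open>U (k - d) z\<close>, which are larger than the cube \<open>Q k z\<close>.\<close>

definition big_avg :: "nat \<Rightarrow> ('a \<Rightarrow> real) \<Rightarrow> real \<Rightarrow> nat \<Rightarrow> 'a \<Rightarrow> bool" where
  "big_avg d f s k z \<longleftrightarrow> s * measure M (U (k - d) z) < (LINT y:U (k - d) z|M. \<bar>f y\<bar>)"

definition big_mean :: "('a \<Rightarrow> real) \<Rightarrow> real \<Rightarrow> nat \<Rightarrow> 'a \<Rightarrow> bool" where
  "big_mean f t k z \<longleftrightarrow> t * measure M (Q k z) < (LINT y:Q k z|M. f y)"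

text \<open>Maximal cubes are disjoint, so this Chebyshev bound needs no covering argument and
  carries no power of \<open>D\<close>.\<close>

lemma measure_stop_big_mean:
  assumes "integrable M h" "0 < t"
  shows "t * measure M (stop (big_mean h t)) \<le> (LINT y:stop (big_mean h t)|M. h y)"
proof -
  have "0 \<le> (LINT y:stop (big_mean h t)|M. (h y - t))"
  proof (rule stop_integral_nonneg)
    fix k z assume "(k, z) \<in> cubes (big_mean h t)"
    then have "big_mean h t k z" by (auto simp: cubes_def top_def)
    then show "0 \<le> (LINT y:Q k z|M. (h y - t))"
      using assms by (simp add: set_integral_diff set_integrable_of_integrable set_integral_const' big_mean_def)
  qed (use assms in auto)
  then show ?thesis
    using assms by (simp add: set_integral_diff set_integrable_of_integrable set_integral_const')
qed

lemma measure_stop_big_mean_le: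
  assumes "integrable M h" "0 < t"
  shows "measure M (stop (big_mean (\<lambda>y. \<bar>h y\<bar>) t)) \<le> (LINT y|M. \<bar>h y\<bar>) / t"
proof -
  have "(LINT y:stop (big_mean (\<lambda>y. \<bar>h y\<bar>) t)|M. \<bar>h y\<bar>) \<le> (LINT y:UNIV|M. \<bar>h y\<bar>)"
    using assms by (intro set_integral_le_subset set_integrable_of_integrable) auto
  also have "\<dots> = (LINT y|M. \<bar>h y\<bar>)" using set_integral_space[of M "\<lambda>y. \<bar>h y\<bar>"] assms by (simp add: space_M)
  finally show ?thesis
    using measure_stop_big_mean[of "\<lambda>y. \<bar>h y\<bar>" t] assms by (simp add: field_simps)
qed

text \<open>If all cubes of level \<open>k\<close> that meet the ball had mean at most
  \<open>s / D\<close>, the average over the ball could not exceed \<open>s\<close>: these cubes are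
  disjoint and lie in the ball one scale larger, which has at most \<open>D\<close> times the
  measure. So a cube with large mean meets the ball, and the maximal cube above it has a thickening
  that reaches \<open>x\<close>.\<close>

lemma big_avg_thick:
  assumes h: "integrable M h" and s: "0 < s" and d: "1 \<le> d"
  shows "stop (big_avg d h s) \<subseteq> thick (d + 2) (big_mean (\<lambda>y. \<bar>h y\<bar>) (s / D))"
proof
  let ?P = "big_mean (\<lambda>y. \<bar>h y\<bar>) (s / D)"
  fix x assume "x \<in> stop (big_avg d h s)"
  then obtain k where k: "big_avg d h s k (\<pi> k x)" by (auto simp: stop_def)
  let ?z = "\<pi> k x"
  obtain y where y: "E (k - d) ?z y" "?P k (\<pi> k y)"
  proof (rule ccontr)
    assume "\<not> thesis"
    with that have no: "\<And>y. E (k - d) ?z y \<Longrightarrow> \<not> ?P k (\<pi> k y)" by blast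
    let ?I = "\<pi> k ` U (k - d) ?z"
    have fin: "finite ?I" by (rule finite_subset[OF _ \<pi>_finite[of k]]) auto
    have dis: "disjoint_family_on (Q k) ?I" by (auto simp: disjoint_family_on_def)
    let ?W = "\<Union>w\<in>?I. Q k w"
    have W: "?W \<in> sets M" using fin by (intro sets.finite_UN) auto
    have "(LINT y:U (k - d) ?z|M. \<bar>h y\<bar>) \<le> (LINT y:?W|M. \<bar>h y\<bar>)"
      using h W by (intro set_integral_le_subset set_integrable_of_integrable) auto
    also have "\<dots> = (\<Sum>w\<in>?I. LINT y:Q k w|M. \<bar>h y\<bar>)"
      using h by (intro set_integral_finite_Union fin dis set_integrable_of_integrable) auto
    also have "\<dots> \<le> (\<Sum>w\<in>?I. s / D * measure M (Q k w))"
      using no by (intro sum_mono) (auto simp: big_mean_def not_less)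
    also have "\<dots> = s / D * measure M ?W"
      by (subst finite_measure_finite_Union[OF fin _ dis]) (auto simp: sum_distrib_left)
    also have "\<dots> \<le> s / D * measure M (U (k - d - 1) ?z)"
    proof (intro mult_left_mono m_mono)
      show "?W \<subseteq> U (k - d - 1) ?z"
      proof
        fix v assume "v \<in> ?W"
        then obtain y where y: "E (k - d) ?z y" "\<pi> k v = \<pi> k y" by auto
        show "v \<in> U (k - d - 1) ?z"
          using chain3[OF E_near[OF y(1)] E_near'[OF \<pi>_near[of k y]], of "k - 1" v "k - d - 1"]
            \<pi>_near[of k v] y d by (auto simp: near_def)
      qed
    qed (use s D_ge_1 in auto)
    also have "\<dots> \<le> s / D * (D * measure M (U (k - d) ?z))"
      using U_doubling[of "k - d" "k - d - 1" 1 ?z] s D_ge_1 by (intro mult_left_mono) auto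
    also have "\<dots> = s * measure M (U (k - d) ?z)" using D_ge_1 by simp
    finally show False using k by (simp add: big_avg_def)
  qed
  then have "y \<in> stop ?P" by (auto simp: stop_def)
  then obtain j where j: "top ?P j y" by (auto simp: stop_top)
  have "j \<le> k" using j y(2) by (meson top_def not_le_imp_less)
  then have "E (j - (d + 2)) (\<pi> j y) x"
    by (intro chain3[OF E_near[OF \<pi>_near[of j y]] E_near'[OF y(1)] E_near[OF \<pi>_near[of k x]]]) auto
  then show "x \<in> thick (d + 2) ?P" using j by (auto simp: thick_def cubes_def)
qed

end

section \<open>The maximal function and differentiation\<close>

context cube_space
begin

lemma integral_UNIV: "(LINT y:UNIV|M. f y) = (LINT y|M. f y)" for f :: "'a \<Rightarrow> real"
  by (simp add: set_lebesgue_integral_def)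

lemma set_integral_le_all:
  fixes f :: "'a \<Rightarrow> real"
  assumes "integrable M f" "A \<in> sets M" "\<And>y. 0 \<le> f y"
  shows "(LINT y:A|M. f y) \<le> (LINT y|M. f y)"
  using set_integral_le_subset[OF set_integrable_of_integrable[OF assms(1) sets_UNIV] assms(2)] assms(3)
  by (simp add: integral_UNIV)

lemma stop_mono: "(\<And>k z. P k z \<Longrightarrow> P' k z) \<Longrightarrow> stop P \<subseteq> stop P'"
  by (auto simp: stop_def)

text \<open>The maximal theorem for L^1. Of the exponent \<open>d + 4\<close>, the part
  \<open>d + 3\<close> comes from thickening and 1 from the threshold \<open>s / D\<close>.\<close>

lemma weak_type:
  assumes h: "integrable M h" and s: "0 < s" and d: "1 \<le> d"
  shows "measure M (stop (big_avg d h s)) \<le> D ^ (d + 4) / s * (LINT y|M. \<bar>h y\<bar>)"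
proof -
  let ?P = "big_mean (\<lambda>y. \<bar>h y\<bar>) (s / D)"
  have "measure M (stop (big_avg d h s)) \<le> measure M (thick (d + 2) ?P)"
    using big_avg_thick[OF assms] by (intro m_mono) auto
  also have "\<dots> \<le> D ^ (d + 2 + 1) * measure M (stop ?P)" by (rule measure_thick_le)
  also have "\<dots> \<le> D ^ (d + 2 + 1) * ((LINT y|M. \<bar>h y\<bar>) / (s / D))"
    using measure_stop_big_mean_le[OF h, of "s / D"] s D_ge_1 by (intro mult_left_mono) auto
  also have "\<dots> = D ^ (d + 4) / s * (LINT y|M. \<bar>h y\<bar>)"
    by (simp add: eval_nat_numeral power_add)
  finally show ?thesis .
qed

text \<open>Values up to \<open>s / 2\<close> add at most \<open>s / 2\<close> to an average, so
  only the part of \<open>f\<close> above that height counts. With the full L^1 norm on the right,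
  integration over all heights against a power of \<open>s\<close> would diverge.\<close>

lemma weak_type_truncated:
  assumes f: "integrable M f" and s: "0 < s" and d: "1 \<le> d"
  shows "measure M (stop (big_avg d f s)) \<le> 2 * D ^ (d + 4) / s * (LINT y:{y. s / 2 < \<bar>f y\<bar>}|M. \<bar>f y\<bar>)"
proof -
  let ?A = "{y. s / 2 < \<bar>f y\<bar>}"
  let ?f = "\<lambda>y. indicator ?A y * f y"
  have [measurable]: "f \<in> borel_measurable M" using f by auto
  have A: "?A \<in> sets M"
  proof -
    have "{y \<in> space M. s / 2 < \<bar>f y\<bar>} \<in> sets M" by measurable
    then show ?thesis by (simp add: space_M)
  qed
  have f': "integrable M ?f" using integrable_mult_indicator[OF A f] by simp
  have "big_avg d ?f (s / 2) k z" if "big_avg d f s k z" for k z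
  proof -
    let ?B = "U (k - d) z"
    have "(LINT y:?B|M. \<bar>f y\<bar>) \<le> (LINT y:?B|M. s / 2 + \<bar>?f y\<bar>)"
      using f f' s by (intro set_integral_mono set_integral_add set_integrable_of_integrable Bochner_Integration.integrable_add)
        (auto simp: indicator_def)
    also have "\<dots> = s / 2 * measure M ?B + (LINT y:?B|M. \<bar>?f y\<bar>)"
      using f' by (subst set_integral_add) (auto simp: set_integral_const' intro!: set_integrable_of_integrable)
    finally show ?thesis using that by (simp add: big_avg_def)
  qed
  then have "measure M (stop (big_avg d f s)) \<le> measure M (stop (big_avg d ?f (s / 2)))"
    by (intro m_mono stop_mono) auto
  also have "\<dots> \<le> D ^ (d + 4) / (s / 2) * (LINT y|M. \<bar>?f y\<bar>)"
    using weak_type[OF f' _ d, of "s / 2"] s by simp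
  also have "(LINT y|M. \<bar>?f y\<bar>) = (LINT y:?A|M. \<bar>f y\<bar>)"
    unfolding set_lebesgue_integral_def by (simp add: abs_mult)
  finally show ?thesis by (simp add: field_simps)
qed

end

locale lebesgue_cube_space = cube_space M E D \<pi>
  for M :: "'a measure" and E D \<pi> +
  assumes dense: "integrable M f \<Longrightarrow> 0 < e \<Longrightarrow> \<exists>g. integrable M g \<and> (LINT x|M. \<bar>f x - g x\<bar>) < e \<and>
    (\<forall>x. \<forall>r>0. \<exists>n. \<forall>y. E n x y \<longrightarrow> \<bar>g y - g x\<bar> < (r :: real))"
begin

text \<open>With \<open>h = f - g\<close> the oscillation of \<open>f\<close> at \<open>x\<close> is
  at most that of the continuous \<open>g\<close>, plus \<open>|h x|\<close>, plus the average of
  \<open>|h|\<close>. Each gets \<open>e / 3\<close>; the last two fail only on sets whose measure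
  is a multiple of the L^1 norm of \<open>h\<close>.\<close>

lemma differentiation_eps:
  assumes f: "integrable M f" and d: "1 \<le> d" and e: "0 < e"
  shows "AE x in M. \<exists>n. \<forall>k\<ge>n. (LINT y:U (k - d) (\<pi> k x)|M. \<bar>f y - f x\<bar>) \<le> e * measure M (U (k - d) (\<pi> k x))"
proof (rule AE_of_small_exceptions)
  fix \<eta> :: real assume \<eta>: "0 < \<eta>"
  \<comment> \<open>The constant of the maximal theorem and the constant 1 of Markov's inequality,
    both at height \<open>e / 3\<close>.\<close>
  let ?K = "3 * (D ^ (d + 4) + 1) / e"
  have K: "0 < ?K" using e D_ge_1 by (intro divide_pos_pos mult_pos_pos add_pos_pos) auto
  obtain g where g: "integrable M g" "(LINT x|M. \<bar>f x - g x\<bar>) < \<eta> / ?K"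
    and cont: "\<And>x r. 0 < r \<Longrightarrow> \<exists>n. \<forall>y. E n x y \<longrightarrow> \<bar>g y - g x\<bar> < r"
    using dense[OF f divide_pos_pos[OF \<eta> K]] by blast
  let ?h = "\<lambda>x. f x - g x"
  have h: "integrable M ?h" using f g by auto
  let ?B = "{x \<in> space M. e / 3 \<le> \<bar>?h x\<bar>}"
  let ?S = "stop (big_avg d ?h (e / 3)) \<union> ?B"
  have B: "?B \<in> sets M" using h by measurable
  have "measure M ?B \<le> (LINT x|M. \<bar>?h x\<bar>) / (e / 3)"
    using h e by (intro integral_Markov_inequality_measure[where A = "{}"]) auto
  then have "measure M ?S \<le> D ^ (d + 4) / (e / 3) * (LINT x|M. \<bar>?h x\<bar>) + (LINT x|M. \<bar>?h x\<bar>) / (e / 3)"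
    using weak_type[OF h _ d, of "e / 3"] e B
    by (intro order_trans[OF measure_Un_le] add_mono) auto
  also have "\<dots> = ?K * (LINT x|M. \<bar>?h x\<bar>)" by (simp add: field_simps add_divide_distrib)
  also have "\<dots> \<le> ?K * (\<eta> / ?K)" using g(2) K by (intro mult_left_mono) auto
  also have "\<dots> = \<eta>"
    using K by (metis less_irrefl nonzero_mult_div_cancel_left times_divide_eq_right)
  finally have "measure M ?S \<le> \<eta>" .
  moreover have "\<exists>n. \<forall>k\<ge>n. (LINT y:U (k - d) (\<pi> k x)|M. \<bar>f y - f x\<bar>) \<le> e * measure M (U (k - d) (\<pi> k x))"
    if x: "x \<notin> ?S" for x
  proof -
    obtain n where n: "\<And>y. E n x y \<Longrightarrow> \<bar>g y - g x\<bar> < e / 3" using cont[of "e / 3" x] e by auto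
    show ?thesis
    proof (intro exI[of _ "n + d + 2"] allI impI)
      fix k assume k: "n + d + 2 \<le> k"
      let ?V = "U (k - d) (\<pi> k x)"
      have near: "E n x y" if "y \<in> ?V" for y
        using k that by (intro chain2[OF E_near'[OF \<pi>_near[of k x]] E_near[of "k - d" "\<pi> k x" y]]) auto
      have hx: "\<bar>?h x\<bar> < e / 3" using x by (simp add: space_M)
      have "\<not> big_avg d ?h (e / 3) k (\<pi> k x)" using x by (auto simp: stop_def)
      then have av: "(LINT y:?V|M. \<bar>?h y\<bar>) \<le> e / 3 * measure M ?V" by (simp add: big_avg_def)
      have "(LINT y:?V|M. \<bar>f y - f x\<bar>) \<le> (LINT y:?V|M. \<bar>?h y\<bar> + 2 * e / 3)"
      proof (rule set_integral_mono)
        show "\<bar>f y - f x\<bar> \<le> \<bar>?h y\<bar> + 2 * e / 3" if "y \<in> ?V" for y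
          using n[OF near[OF that]] hx by linarith
      qed (use f h in \<open>auto intro!: set_integrable_of_integrable\<close>)
      also have "\<dots> = (LINT y:?V|M. \<bar>?h y\<bar>) + 2 * e / 3 * measure M ?V"
        using h by (subst set_integral_add) (auto simp: set_integral_const' intro!: set_integrable_of_integrable)
      also have "\<dots> \<le> e * measure M ?V" using av by simp
      finally show "(LINT y:?V|M. \<bar>f y - f x\<bar>) \<le> e * measure M ?V" .
    qed
  qed
  ultimately show "\<exists>S\<in>sets M. measure M S \<le> \<eta> \<and> (AE x in M. x \<notin> S \<longrightarrow> (\<exists>n. \<forall>k\<ge>n.
      (LINT y:U (k - d) (\<pi> k x)|M. \<bar>f y - f x\<bar>) \<le> e * measure M (U (k - d) (\<pi> k x))))"
    using B by (intro bexI[of _ ?S]) auto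
qed

lemma differentiation:
  assumes f: "integrable M f" and d: "1 \<le> d"
  shows "AE x in M. \<forall>e>0. \<exists>n. \<forall>k\<ge>n.
    (LINT y:U (k - d) (\<pi> k x)|M. \<bar>f y - f x\<bar>) \<le> e * measure M (U (k - d) (\<pi> k x))"
proof -
  have "AE x in M. \<forall>i::nat. \<exists>n. \<forall>k\<ge>n. (LINT y:U (k - d) (\<pi> k x)|M. \<bar>f y - f x\<bar>)
      \<le> 1 / real (Suc i) * measure M (U (k - d) (\<pi> k x))"
    unfolding AE_all_countable by (intro allI differentiation_eps assms) auto
  then show ?thesis
  proof (rule eventually_mono, intro allI impI)
    fix x and e :: real
    assume *: "\<forall>i::nat. \<exists>n. \<forall>k\<ge>n. (LINT y:U (k - d) (\<pi> k x)|M. \<bar>f y - f x\<bar>)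
      \<le> 1 / real (Suc i) * measure M (U (k - d) (\<pi> k x))" and "0 < e"
    then obtain i where i: "1 / real (Suc i) < e" by (metis nat_approx_posE)
    from * obtain n where n: "\<forall>k\<ge>n. (LINT y:U (k - d) (\<pi> k x)|M. \<bar>f y - f x\<bar>)
      \<le> 1 / real (Suc i) * measure M (U (k - d) (\<pi> k x))" by blast
    show "\<exists>n. \<forall>k\<ge>n. (LINT y:U (k - d) (\<pi> k x)|M. \<bar>f y - f x\<bar>) \<le> e * measure M (U (k - d) (\<pi> k x))"
    proof (intro exI[of _ n] allI impI)
      fix k assume "n \<le> k"
      with n have "(LINT y:U (k - d) (\<pi> k x)|M. \<bar>f y - f x\<bar>)
        \<le> 1 / real (Suc i) * measure M (U (k - d) (\<pi> k x))" by blast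
      also have "\<dots> \<le> e * measure M (U (k - d) (\<pi> k x))" using i by (intro mult_right_mono) auto
      finally show "(LINT y:U (k - d) (\<pi> k x)|M. \<bar>f y - f x\<bar>) \<le> e * measure M (U (k - d) (\<pi> k x))" .
    qed
  qed
qed

lemma not_stop_le:
  assumes f: "integrable M f"
  shows "AE x in M. x \<notin> stop (big_mean f t) \<longrightarrow> f x \<le> t"
proof (rule eventually_mono[OF differentiation[OF f order_refl]], intro impI, rule ccontr)
  fix x
  assume x: "x \<notin> stop (big_mean f t)" and less: "\<not> f x \<le> t"
    and *: "\<forall>e>0. \<exists>n. \<forall>k\<ge>n. (LINT y:U (k - 1) (\<pi> k x)|M. \<bar>f y - f x\<bar>) \<le> e * measure M (U (k - 1) (\<pi> k x))"
  \<comment> \<open>Passing from the ball to the cube costs \<open>D\<^sup>2\<close>, so this choice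
    leaves half of \<open>f x - t\<close>.\<close>
  let ?e = "(f x - t) / (2 * D\<^sup>2)"
  have e: "0 < ?e" using less D_ge_1 by simp
  then obtain k where k: "(LINT y:U (k - 1) (\<pi> k x)|M. \<bar>f y - f x\<bar>) \<le> ?e * measure M (U (k - 1) (\<pi> k x))"
    using * by blast
  let ?Q = "Q k (\<pi> k x)"
  have "f x * measure M ?Q - (LINT y:?Q|M. f y) = (LINT y:?Q|M. f x - f y)"
    using f by (subst set_integral_diff) (auto simp: set_integral_const' intro!: set_integrable_of_integrable)
  also have "\<dots> \<le> (LINT y:?Q|M. \<bar>f y - f x\<bar>)"
    using f by (intro set_integral_mono set_integrable_of_integrable) auto
  also have "\<dots> \<le> (LINT y:U (k - 1) (\<pi> k x)|M. \<bar>f y - f x\<bar>)"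
    using f Q_subset_U[of "k - 1" k x] by (intro set_integral_le_subset set_integrable_of_integrable) auto
  also have "\<dots> \<le> ?e * (D\<^sup>2 * measure M ?Q)"
    using U_le_Q[of k 1 x] e by (intro order_trans[OF k] mult_left_mono) (auto simp: power2_eq_square)
  also have "\<dots> = (f x - t) / 2 * measure M ?Q" using D_ge_1 by simp
  also have "\<dots> < (f x - t) * measure M ?Q" using less Q_pos[of k x] by simp
  finally have "t * measure M ?Q < (LINT y:?Q|M. f y)" by (simp add: algebra_simps)
  then show False using x by (auto simp: stop_def big_mean_def)
qed

text \<open>A ball around \<open>x\<close> sits in a ball of comparable measure around the centre of
  the cube of \<open>x\<close> one level further down, so differentiation along cube centres carries
  over.\<close>

lemma ball_differentiation:
  assumes f: "integrable M f"
  shows "AE x in M. \<forall>e>0. \<exists>n. \<forall>k\<ge>n. (LINT y:U k x|M. \<bar>f y - f x\<bar>) \<le> e * measure M (U k x)"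
  using differentiation[OF f, of 2, simplified]
proof (rule eventually_mono, intro allI impI)
  fix x and e :: real assume "0 < e"
    and *: "\<forall>e>0. \<exists>n. \<forall>k\<ge>n. (LINT y:U (k - 2) (\<pi> k x)|M. \<bar>f y - f x\<bar>) \<le> e * measure M (U (k - 2) (\<pi> k x))"
  let ?e = "e / D\<^sup>2"
  have e: "0 < ?e" using \<open>0 < e\<close> D_ge_1 by simp
  then obtain n where n: "\<And>k. k \<ge> n \<Longrightarrow> (LINT y:U (k - 2) (\<pi> k x)|M. \<bar>f y - f x\<bar>) \<le> ?e * measure M (U (k - 2) (\<pi> k x))"
    using * by blast
  show "\<exists>n. \<forall>k\<ge>n. (LINT y:U k x|M. \<bar>f y - f x\<bar>) \<le> e * measure M (U k x)"
  proof (intro exI[of _ n] allI impI)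
    fix k assume k: "n \<le> k"
    let ?z = "\<pi> (Suc k) x"
    have near: "near k ?z x" using \<pi>_near[of "Suc k" x] by (auto intro: E_near)
    have "(LINT y:U k x|M. \<bar>f y - f x\<bar>) \<le> (LINT y:U (k - 1) ?z|M. \<bar>f y - f x\<bar>)"
      using f U_near_subset[OF near_sym[OF near], of "k - 1" k]
      by (intro set_integral_le_subset set_integrable_of_integrable) auto
    also have "\<dots> \<le> ?e * measure M (U (k - 1) ?z)" using n[of "Suc k"] k by (simp add: numeral_2_eq_2)
    also have "\<dots> \<le> ?e * (D\<^sup>2 * measure M (U k x))"
      using e by (intro mult_left_mono U_near_doubling[OF near]) auto
    also have "\<dots> = e * measure M (U k x)" using D_ge_1 by simp
    finally show "(LINT y:U k x|M. \<bar>f y - f x\<bar>) \<le> e * measure M (U k x)" .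
  qed
qed

end

section \<open>Kernels and principal values\<close>

text \<open>The discrete form of a Calderon-Zygmund kernel: \<open>w j\<close> stands for a multiple
  of the modulus at the ratio \<open>\<delta> ^ j\<close>, so that \<open>w_summable\<close> is the
  Dini condition, and the gap \<open>q\<close> says how far \<open>y\<close> must be for smoothness
  to apply. \<open>A\<close> is the size constant, \<open>B\<close> the bound on L^2.\<close>

locale kernel_space = lebesgue_cube_space M E D \<pi> + complete_measure M
  for M :: "'a measure" and E D \<pi> +
  fixes \<rho> K :: "'a \<Rightarrow> 'a \<Rightarrow> real" and R \<delta> A B :: real and q :: nat and w :: "nat \<Rightarrow> real"
  assumes E_iff: "E n x y \<longleftrightarrow> \<rho> x y < R * \<delta> ^ n"
    and R_pos: "0 < R" and \<delta>: "0 < \<delta>" "\<delta> < 1"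
    and \<rho>_separates: "\<rho> x y \<le> 0 \<Longrightarrow> x = y"
    and \<rho>_measurable: "\<rho> x \<in> borel_measurable M"
    and K_measurable: "(\<lambda>(x, y). K x y) \<in> borel_measurable (M \<Otimes>\<^sub>M M)"
    and K_size: "\<not> E n x y \<Longrightarrow> \<bar>K x y\<bar> \<le> A / measure M {v. E n x v}"
    and K_smooth: "E m z x \<Longrightarrow> \<not> E n z y \<Longrightarrow> n + q \<le> m \<Longrightarrow>
      \<bar>K x y - K z y\<bar> \<le> w (m - n) / measure M {v. E n z v} \<and>
      \<bar>K y x - K y z\<bar> \<le> w (m - n) / measure M {v. E n z v}"
    and A_pos: "0 < A" and B_pos: "0 < B"
    and w_nonneg: "0 \<le> w n" and w_summable: "summable w"
    and T_defined: "f \<in> L2_space M \<Longrightarrow> cz_op_defined M \<rho> K f"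
    and T_L2: "f \<in> L2_space M \<Longrightarrow> cz_op M \<rho> K f \<in> L2_space M \<and>
      L2_norm M (cz_op M \<rho> K f) \<le> B * L2_norm M f"
begin

lemma R\<delta>_tendsto: "(\<lambda>n. R * \<delta> ^ n) \<longlonglongrightarrow> 0"
  using \<delta> by (auto intro!: tendsto_mult_right_zero LIMSEQ_power_zero)

lemma separation:
  assumes "\<And>n. E n x y" shows "x = y"
proof (rule \<rho>_separates)
  show "\<rho> x y \<le> 0"
    using assms by (intro LIMSEQ_le_const[OF R\<delta>_tendsto]) (auto simp: E_iff intro: less_imp_le)
qed

lemma K_measurable_right [measurable]: "K x \<in> borel_measurable M"
  using measurable_compose[OF measurable_Pair1' K_measurable, of x] by (simp add: space_M)

lemma K_measurable_left [measurable]: "(\<lambda>x. K x y) \<in> borel_measurable M"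
  using measurable_compose[OF measurable_Pair2' K_measurable, of y] by (simp add: space_M)

lemma shell:
  assumes "\<not> E N z y"
  obtains n where "1 \<le> n" "n \<le> N" "E (n - 1) z y" "\<not> E n z y"
proof -
  define n where "n = (LEAST n. \<not> E n z y)"
  have n: "\<not> E n z y" "n \<le> N" unfolding n_def using assms by (rule LeastI, rule Least_le)
  have "n \<noteq> 0" using n(1) E_0 by metis
  then have "E (n - 1) z y" using not_less_Least[of "n - 1" "\<lambda>n. \<not> E n z y"] by (auto simp: n_def)
  with n \<open>n \<noteq> 0\<close> that show thesis by (metis One_nat_def Suc_leI gr0I)
qed

text \<open>Only the term of the shell containing \<open>y\<close> is used; adding the other terms,
  with indicators of full balls, gives a majorant that no longer depends on the shell and can be
  integrated termwise.\<close>

lemma K_smooth_sum: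
  assumes "E m z x" "\<not> E N z y" "N + q \<le> m"
  shows "\<bar>K x y - K z y\<bar> \<le> (\<Sum>n=1..N. w (m - n) / measure M (U n z) * indicator (U (n - 1) z) y)"
    and "\<bar>K y x - K y z\<bar> \<le> (\<Sum>n=1..N. w (m - n) / measure M (U n z) * indicator (U (n - 1) z) y)"
proof -
  obtain n where n: "1 \<le> n" "n \<le> N" "E (n - 1) z y" "\<not> E n z y" using shell assms(2) by blast
  have le: "w (m - n) / measure M (U n z) \<le>
    (\<Sum>n=1..N. w (m - n) / measure M (U n z) * indicator (U (n - 1) z) y)"
    using n w_nonneg
    by (intro order_trans[OF _ member_le_sum[of n]]) (auto intro!: mult_nonneg_nonneg divide_nonneg_nonneg)
  note * = K_smooth[OF assms(1) n(4), of]
  show "\<bar>K x y - K z y\<bar> \<le> (\<Sum>n=1..N. w (m - n) / measure M (U n z) * indicator (U (n - 1) z) y)"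
    "\<bar>K y x - K y z\<bar> \<le> (\<Sum>n=1..N. w (m - n) / measure M (U n z) * indicator (U (n - 1) z) y)"
    using * le n(2) assms(3) by force+
qed

definition W :: real where "W = suminf w"

lemma W_nonneg: "0 \<le> W"
  unfolding W_def using w_summable w_nonneg by (rule suminf_nonneg)

lemma w_sum_le: "N \<le> m \<Longrightarrow> (\<Sum>n=1..N. w (m - n)) \<le> W"
proof -
  assume "N \<le> m"
  then have "inj_on (\<lambda>n. m - n) {1..N}" by (auto simp: inj_on_def)
  then have "(\<Sum>n=1..N. w (m - n)) = sum w ((\<lambda>n. m - n) ` {1..N})" by (simp add: sum.reindex)
  also have "\<dots> \<le> W" unfolding W_def using w_nonneg by (intro sum_le_suminf w_summable) auto
  finally show ?thesis .
qed

text \<open>Hoermander's condition. The term of index \<open>n\<close> contributes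
  \<open>w (m - n)\<close> times a ratio of measures of consecutive balls, which is at most
  \<open>D\<close>.\<close>

lemma K_smooth_integral:
  assumes "E m z y" "N + q \<le> m"
  shows "(\<integral>\<^sup>+x. indicator {x. \<not> E N z x} x * ennreal \<bar>K x y - K x z\<bar> \<partial>M) \<le> ennreal (D * W)"
proof -
  let ?s = "\<lambda>x. \<Sum>n=1..N. w (m - n) / measure M (U n z) * indicator (U (n - 1) z) x :: real"
  have s_nonneg: "0 \<le> ?s x" for x using w_nonneg by (intro sum_nonneg) auto
  have ind: "integrable M (indicator (U j z) :: 'a \<Rightarrow> real)" for j
    by (intro integrable_real_indicator) (auto simp: less_top[symmetric])
  have s_int: "integrable M ?s" using ind
    by (intro Bochner_Integration.integrable_sum integrable_mult_right)
  have "(\<integral>\<^sup>+x. indicator {x. \<not> E N z x} x * ennreal \<bar>K x y - K x z\<bar> \<partial>M) \<le> (\<integral>\<^sup>+x. ennreal (?s x) \<partial>M)"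
    using K_smooth_sum(2)[OF assms(1) _ assms(2)] s_nonneg
    by (intro nn_integral_mono) (auto simp: indicator_def intro!: ennreal_leI)
  also have "\<dots> = ennreal (LINT x|M. ?s x)"
    using s_int s_nonneg by (intro nn_integral_eq_integral) auto
  also have "(LINT x|M. ?s x) = (\<Sum>n=1..N. w (m - n) / measure M (U n z) * measure M (U (n - 1) z))"
    by (subst Bochner_Integration.integral_sum, intro integrable_mult_right ind) (simp add: space_M)
  also have "\<dots> \<le> (\<Sum>n=1..N. w (m - n) * D)"
  proof (rule sum_mono)
    fix n assume "n \<in> {1..N}"
    then have "measure M (U (n - 1) z) \<le> D * measure M (U n z)"
      using E_doubling[of "n - 1" z] by simp
    then have "measure M (U (n - 1) z) / measure M (U n z) \<le> D"
      using E_pos[of n z] by (simp add: divide_le_eq)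
    from mult_left_mono[OF this w_nonneg[of "m - n"]]
    show "w (m - n) / measure M (U n z) * measure M (U (n - 1) z) \<le> w (m - n) * D"
      by (simp only: times_divide_eq_left times_divide_eq_right)
  qed
  also have "\<dots> = D * (\<Sum>n=1..N. w (m - n))" by (simp add: sum_distrib_left mult.commute)
  also have "\<dots> \<le> D * W" using w_sum_le[of N m] assms(2) D_ge_1 by (intro mult_left_mono) auto
  finally show ?thesis by (simp add: ennreal_leI)
qed

lemma K_size_mult: "\<not> E n x y \<Longrightarrow> \<bar>K x y * c\<bar> \<le> A / measure M (U n x) * \<bar>c\<bar>"
  unfolding abs_mult by (intro mult_right_mono K_size) auto

lemma K_integrable:
  assumes f: "integrable M f" and V: "V \<in> sets M" "\<And>y. y \<in> V \<Longrightarrow> \<not> E n x y"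
  shows "set_integrable M V (\<lambda>y. K x y * f y)"
proof (rule set_integrable_bound)
  show "set_integrable M V (\<lambda>y. A / measure M (U n x) * f y)"
    using f V by (intro set_integrable_of_integrable) auto
  show "set_borel_measurable M V (\<lambda>y. K x y * f y)"
    using f V(1) unfolding set_borel_measurable_def by measurable
  show "AE y in M. y \<in> V \<longrightarrow> norm (K x y * f y) \<le> norm (A / measure M (U n x) * f y)"
  proof (intro AE_I2 impI)
    fix y assume "y \<in> V"
    have "0 \<le> A / measure M (U n x)" using A_pos by simp
    then show "norm (K x y * f y) \<le> norm (A / measure M (U n x) * f y)"
      using K_size_mult[OF V(2)[OF \<open>y \<in> V\<close>], of "f y"]
      by (simp only: real_norm_def abs_mult abs_of_nonneg)
  qed
qed

lemma K_integral_le: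
  assumes f: "integrable M f" and V: "V \<in> sets M" "\<And>y. y \<in> V \<Longrightarrow> \<not> E n x y"
  shows "(LINT y:V|M. \<bar>K x y * f y\<bar>) \<le> A / measure M (U n x) * (LINT y:V|M. \<bar>f y\<bar>)"
proof -
  have "(LINT y:V|M. \<bar>K x y * f y\<bar>) \<le> (LINT y:V|M. A / measure M (U n x) * \<bar>f y\<bar>)"
    using f V by (intro set_integral_mono set_integrable_abs[OF K_integrable[OF assms]] K_size_mult)
      (auto intro!: set_integrable_of_integrable)
  then show ?thesis by simp
qed

section \<open>Truncations and principal values\<close>

lemma truncation_sets: "{y. \<epsilon> < \<rho> x y} \<in> sets M"
proof -
  have "{y \<in> space M. \<epsilon> < \<rho> x y} \<in> sets M" using \<rho>_measurable by measurable
  then show ?thesis by (simp add: space_M)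
qed

lemma truncation_scale:
  assumes "0 < \<epsilon>" "\<epsilon> < R * \<delta> ^ n"
  obtains j where "n \<le> j" "R * \<delta> ^ Suc j \<le> \<epsilon>" "\<epsilon> < R * \<delta> ^ j"
proof -
  have "\<exists>j. R * \<delta> ^ Suc j \<le> \<epsilon>"
  proof -
    obtain j where "\<delta> ^ j < \<epsilon> / R" using real_arch_pow_inv[of "\<epsilon> / R" \<delta>] assms R_pos \<delta> by auto
    then have "R * \<delta> ^ j < \<epsilon>" using R_pos by (simp add: field_simps)
    moreover have "R * \<delta> ^ Suc j \<le> R * \<delta> ^ j" using R_pos \<delta> by (intro mult_left_mono power_decreasing) auto
    ultimately show ?thesis by (intro exI[of _ j]) linarith
  qed
  then have ex: "R * \<delta> ^ Suc (LEAST j. R * \<delta> ^ Suc j \<le> \<epsilon>) \<le> \<epsilon>" by (rule LeastI_ex)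
  let ?j = "LEAST j. R * \<delta> ^ Suc j \<le> \<epsilon>"
  have n: "n \<le> ?j"
  proof (rule ccontr)
    assume "\<not> n \<le> ?j"
    then have "R * \<delta> ^ n \<le> R * \<delta> ^ Suc ?j" using R_pos \<delta> by (intro mult_left_mono power_decreasing) auto
    with assms ex show False by linarith
  qed
  have "\<epsilon> < R * \<delta> ^ ?j"
  proof (cases ?j)
    case 0
    then show ?thesis using assms n by simp
  next
    case (Suc i)
    then have "\<not> R * \<delta> ^ Suc i \<le> \<epsilon>" using not_less_Least[of i "\<lambda>j. R * \<delta> ^ Suc j \<le> \<epsilon>"] by auto
    then show ?thesis using Suc by auto
  qed
  with n ex that show thesis by blast
qed

lemma truncation_shell:
  assumes "R * \<delta> ^ Suc j \<le> \<epsilon>" "\<epsilon> < R * \<delta> ^ j"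
  shows "\<not> E j x y \<Longrightarrow> \<epsilon> < \<rho> x y" "\<epsilon> < \<rho> x y \<Longrightarrow> \<not> E (Suc j) x y"
  using assms by (auto simp: E_iff)

text \<open>The truncations lie between the complements of consecutive balls, so a principal value may be
  computed with any truncation sets of that kind.\<close>

lemma has_pv_integralI:
  assumes f: "integrable M f"
    and lim: "\<And>e. 0 < e \<Longrightarrow> \<exists>N. \<forall>n\<ge>N. \<forall>V\<in>sets M. (\<forall>y. \<not> E n x y \<longrightarrow> y \<in> V) \<longrightarrow>
      (\<forall>y\<in>V. \<not> E (Suc n) x y) \<longrightarrow> \<bar>(LINT y:V|M. K x y * f y) - l\<bar> < e"
  shows "has_pv_integral M \<rho> K f x l"
  unfolding has_pv_integral_def
proof (intro conjI allI impI)
  fix \<epsilon> :: real assume \<epsilon>: "0 < \<epsilon>"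
  show "set_integrable M {y. \<epsilon> < \<rho> x y} (\<lambda>y. K x y * f y)"
  proof (cases "\<epsilon> < R")
    case True
    then obtain j where "R * \<delta> ^ Suc j \<le> \<epsilon>" "\<epsilon> < R * \<delta> ^ j"
      using truncation_scale[OF \<epsilon>, of 0] by auto
    then show ?thesis
      using truncation_shell(2) by (intro K_integrable[OF f truncation_sets, of _ _ "Suc j"]) auto
  next
    case False
    have "\<not> \<epsilon> < \<rho> x y" for y using E_0[of x y] False by (simp add: E_iff)
    then have "{y. \<epsilon> < \<rho> x y} = {}" by blast
    then show ?thesis by simp
  qed
next
  show "((\<lambda>\<epsilon>. LINT y:{y. \<epsilon> < \<rho> x y}|M. K x y * f y) \<longlongrightarrow> l) (at_right 0)"
  proof (rule tendstoI)
    fix e :: real assume "0 < e"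
    obtain N where N: "\<forall>n\<ge>N. \<forall>V\<in>sets M. (\<forall>y. \<not> E n x y \<longrightarrow> y \<in> V) \<longrightarrow>
      (\<forall>y\<in>V. \<not> E (Suc n) x y) \<longrightarrow> \<bar>(LINT y:V|M. K x y * f y) - l\<bar> < e"
      by (rule exE[OF lim[OF \<open>0 < e\<close>]]) (rule that)
    have "\<forall>\<^sub>F \<epsilon> in at_right 0. \<epsilon> \<in> {0<..<R * \<delta> ^ N}"
      by (rule eventually_at_rightI[of 0 "R * \<delta> ^ N"]) (use R_pos \<delta> in auto)
    then show "\<forall>\<^sub>F \<epsilon> in at_right 0. dist (LINT y:{y. \<epsilon> < \<rho> x y}|M. K x y * f y) l < e"
    proof (rule eventually_mono)
      fix \<epsilon> assume "\<epsilon> \<in> {0<..<R * \<delta> ^ N}"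
      then obtain j where j: "N \<le> j" "R * \<delta> ^ Suc j \<le> \<epsilon>" "\<epsilon> < R * \<delta> ^ j"
        using truncation_scale[of \<epsilon> N] by auto
      show "dist (LINT y:{y. \<epsilon> < \<rho> x y}|M. K x y * f y) l < e"
        unfolding dist_real_def
        by (rule N[rule_format, OF j(1) truncation_sets])
          (use truncation_shell[OF j(2,3)] in blast)+
    qed
  qed
qed

lemma has_pv_integral_unique:
  "has_pv_integral M \<rho> K f x l \<Longrightarrow> has_pv_integral M \<rho> K f x l' \<Longrightarrow> l = l'"
  unfolding has_pv_integral_def by (auto intro: tendsto_unique[OF trivial_limit_at_right_real])

lemma cz_op_eq: "has_pv_integral M \<rho> K f x l \<Longrightarrow> cz_op M \<rho> K f x = l"
  unfolding cz_op_def by (rule the_equality) (auto intro: has_pv_integral_unique)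

lemma has_pv_integral_add:
  assumes "has_pv_integral M \<rho> K f x l" "has_pv_integral M \<rho> K g x l'"
  shows "has_pv_integral M \<rho> K (\<lambda>y. f y + g y) x (l + l')"
proof -
  have int: "set_integrable M {y. \<epsilon> < \<rho> x y} (\<lambda>y. K x y * f y)"
    "set_integrable M {y. \<epsilon> < \<rho> x y} (\<lambda>y. K x y * g y)" if "0 < \<epsilon>" for \<epsilon>
    using assms that by (auto simp: has_pv_integral_def)
  have "((\<lambda>\<epsilon>. (LINT y:{y. \<epsilon> < \<rho> x y}|M. K x y * f y) + (LINT y:{y. \<epsilon> < \<rho> x y}|M. K x y * g y))
      \<longlongrightarrow> l + l') (at_right 0)"
    using assms by (intro tendsto_add) (auto simp: has_pv_integral_def)
  moreover have "\<forall>\<^sub>F \<epsilon> in at_right 0. (LINT y:{y. \<epsilon> < \<rho> x y}|M. K x y * f y) +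
      (LINT y:{y. \<epsilon> < \<rho> x y}|M. K x y * g y) = (LINT y:{y. \<epsilon> < \<rho> x y}|M. K x y * (f y + g y))"
    using eventually_at_right_less[of "0::real"]
  proof (rule eventually_mono)
    fix \<epsilon> :: real assume "0 < \<epsilon>"
    then show "(LINT y:{y. \<epsilon> < \<rho> x y}|M. K x y * f y) + (LINT y:{y. \<epsilon> < \<rho> x y}|M. K x y * g y) =
        (LINT y:{y. \<epsilon> < \<rho> x y}|M. K x y * (f y + g y))"
      using set_integral_add(2)[OF int] by (simp add: distrib_left)
  qed
  ultimately have "((\<lambda>\<epsilon>. LINT y:{y. \<epsilon> < \<rho> x y}|M. K x y * (f y + g y)) \<longlongrightarrow> l + l') (at_right 0)"
    by (rule Lim_transform_eventually)
  moreover have "set_integrable M {y. \<epsilon> < \<rho> x y} (\<lambda>y. K x y * (f y + g y))" if "0 < \<epsilon>" for \<epsilon>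
    using set_integral_add(1)[OF int[OF that]] by (simp add: distrib_left)
  ultimately show ?thesis by (simp add: has_pv_integral_def)
qed

end

section \<open>Calderon-Zygmund decomposition\<close>

context cube_space
begin

definition lev :: "(nat \<Rightarrow> 'a \<Rightarrow> bool) \<Rightarrow> 'a \<Rightarrow> nat" where
  "lev P y = (LEAST k. P k (\<pi> k y))"

definition ctr :: "(nat \<Rightarrow> 'a \<Rightarrow> bool) \<Rightarrow> 'a \<Rightarrow> 'a" where
  "ctr P y = \<pi> (lev P y) y"

lemma lev_eq: "top P k y \<Longrightarrow> lev P y = k"
  unfolding top_def lev_def by (intro Least_equality) (auto simp: not_less[symmetric])

lemma lev_top: "y \<in> stop P \<Longrightarrow> top P (lev P y) y"
  using lev_eq by (metis stop_top)

lemma cubes_lev: "y \<in> stop P \<Longrightarrow> (lev P y, ctr P y) \<in> cubes P"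
  using lev_top by (auto simp: cubes_def ctr_def)

lemma lev_ctr_cube:
  assumes "(k, z) \<in> cubes P" "\<pi> k y = z"
  shows "lev P y = k" "ctr P y = z" "y \<in> stop P"
  using cubes_top[OF assms] assms(2) by (auto simp: lev_eq ctr_def stop_top)

lemma index_countable: "countable (SIGMA k:UNIV. range (\<pi> k))"
  by (intro countable_SIGMA) (auto intro: countable_finite \<pi>_finite)

text \<open>The target is a countable set, so the pair may be followed by an arbitrary function;
  this is how the kernel is evaluated at the centre \<open>ctr P y\<close>, which varies with
  \<open>y\<close>.\<close>

lemma index_measurable:
  "(\<lambda>y. (lev P y, ctr P y)) \<in> measurable M (count_space (SIGMA k:UNIV. range (\<pi> k)))"
proof -
  have P: "{y. P k (\<pi> k y)} \<in> sets M" for k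
  proof -
    have "{y. P k (\<pi> k y)} = (\<Union>z\<in>{z \<in> range (\<pi> k). P k z}. Q k z)" by auto
    also have "\<dots> \<in> sets M" using \<pi>_finite[of k] by (intro sets.finite_UN) auto
    finally show ?thesis .
  qed
  have "(\<lambda>y. P k (\<pi> k y)) \<in> measurable M (count_space UNIV)" for k
    using P[of k] by (simp add: pred_def[symmetric] Measurable.pred_def space_M)
  then have "lev P \<in> measurable M (count_space UNIV)"
    unfolding lev_def by (rule measurable_Least)
  then have lev: "lev P -` {k} \<inter> space M \<in> sets M" for k by (rule measurable_sets) auto
  have "(\<lambda>y. (lev P y, ctr P y)) -` {(k, z)} \<inter> space M = (lev P -` {k} \<inter> space M) \<inter> Q k z" for k z
    by (auto simp: ctr_def)
  then have "(\<lambda>y. (lev P y, ctr P y)) -` {a} \<inter> space M \<in> sets M" for a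
    using lev by (cases a) auto
  then show ?thesis
    unfolding measurable_count_space_eq_countable[OF index_countable] by (auto simp: ctr_def)
qed

lemma index_compose_measurable:
  assumes "\<And>k z. F k z \<in> borel_measurable N"
  shows "(\<lambda>(x, y). F (lev P y) (ctr P y) x) \<in> borel_measurable (N \<Otimes>\<^sub>M M)"
proof -
  have "(\<lambda>p. (case (lev P (snd p), ctr P (snd p)) of (k, z) \<Rightarrow> F k z) (fst p)) \<in> borel_measurable (N \<Otimes>\<^sub>M M)"
    by (rule measurable_compose_countable'[OF _ measurable_compose[OF measurable_snd index_measurable]
          index_countable]) (use assms in \<open>auto intro: measurable_compose[OF measurable_fst]\<close>)
  then show ?thesis by (simp add: case_prod_beta')
qed

lemma index_measurable': "(\<lambda>y. F (lev P y) (ctr P y)) \<in> measurable M (count_space UNIV)"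
proof -
  have "(\<lambda>y. case (lev P y, ctr P y) of (k, z) \<Rightarrow> F k z) \<in> measurable M (count_space UNIV)"
    by (rule measurable_compose[OF index_measurable]) simp
  then show ?thesis by simp
qed

lemma index_borel: "(\<lambda>y. F (lev P y) (ctr P y)) \<in> borel_measurable M" for F :: "nat \<Rightarrow> 'a \<Rightarrow> real"
proof -
  have "(\<lambda>y. case (lev P y, ctr P y) of (k, z) \<Rightarrow> F k z) \<in> borel_measurable M"
    by (rule measurable_compose[OF index_measurable]) simp
  then show ?thesis by simp
qed

lemma index_sets: "{y. \<phi> (lev P y) (ctr P y)} \<in> sets M"
  using measurable_sets[OF index_measurable'[where F = \<phi>], of "{True}"]
  by (simp add: vimage_def space_M)

end

lemma set_integral_abs_le: "\<bar>LINT x:A|M. f x\<bar> \<le> (LINT x:A|M. \<bar>f x\<bar>)" for f :: "'a \<Rightarrow> real"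
proof -
  have "\<bar>indicator A x *\<^sub>R f x\<bar> = indicator A x *\<^sub>R \<bar>f x\<bar>" for x by (simp add: indicator_def)
  then show ?thesis
    using integral_abs_bound[of M "\<lambda>x. indicator A x *\<^sub>R f x"] by (simp only: set_lebesgue_integral_def)
qed

context lebesgue_cube_space
begin

lemma stop_zero_integral:
  fixes \<psi> :: "'a \<Rightarrow> real"
  assumes "integrable M \<psi>" "\<And>y. y \<notin> stop P \<Longrightarrow> \<psi> y = 0"
    and "\<And>k z. (k, z) \<in> cubes P \<Longrightarrow> (LINT y:Q k z|M. \<psi> y) = 0"
  shows "(LINT y|M. \<psi> y) = 0"
proof -
  have "0 \<le> (LINT y:stop P|M. \<psi> y)" "0 \<le> (LINT y:stop P|M. - \<psi> y)"
    using assms by (intro stop_integral_nonneg; simp add: set_lebesgue_integral_def)+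
  moreover have "(LINT y:stop P|M. \<psi> y) = (LINT y|M. \<psi> y)"
    unfolding set_lebesgue_integral_def
    by (rule Bochner_Integration.integral_cong) (use assms(2) in \<open>auto simp: indicator_def\<close>)
  ultimately show ?thesis by (simp add: set_lebesgue_integral_def)
qed

text \<open>The assumption \<open>root\<close> keeps the whole space from being a stopping cube.
  Each stopping cube then has a parent that is not one, which bounds the means by
  \<open>D ^ 4 * t\<close>. Off the cubes |f| \<le> t holds almost everywhere by differentiation,
  and the two bounds together give the square integral of \<open>g\<close>.\<close>

lemma cz_decomposition:
  assumes f: "integrable M f" and t: "0 < t" and root: "(LINT y|M. \<bar>f y\<bar>) \<le> t * measure M UNIV"
  defines "P \<equiv> big_mean (\<lambda>y. \<bar>f y\<bar>) t"
  shows "\<exists>g. g \<in> L2_space M \<and> integrable M g \<and> (LINT y|M. (g y)\<^sup>2) \<le> (D ^ 8 + 1) * t * (LINT y|M. \<bar>f y\<bar>) \<and>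
    (\<forall>y. y \<notin> stop P \<longrightarrow> g y = f y) \<and>
    (LINT y|M. \<bar>f y - g y\<bar>) \<le> (D ^ 4 + 1) * (LINT y|M. \<bar>f y\<bar>) \<and>
    (\<forall>k z. (k, z) \<in> cubes P \<longrightarrow> (LINT y:Q k z|M. (f y - g y)) = 0)"
proof -
  let ?I = "LINT y|M. \<bar>f y\<bar>"
  define av where "av k z = (LINT y:Q k z|M. f y) / measure M (Q k z)" for k z
  define g where "g y = (if y \<in> stop P then av (lev P y) (ctr P y) else f y)" for y
  have [measurable]: "f \<in> borel_measurable M" using f by auto
  have [measurable]: "(\<lambda>y. av (lev P y) (ctr P y)) \<in> borel_measurable M" by (rule index_borel)
  have stop_meas: "Measurable.pred M (\<lambda>y. y \<in> stop P)"
    by (simp add: Measurable.pred_def space_M)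
  have g_meas [measurable]: "g \<in> borel_measurable M"
    unfolding g_def using stop_meas by measurable
  have av_le: "\<bar>av (lev P y) (ctr P y)\<bar> \<le> D ^ 4 * t" if y: "y \<in> stop P" for y
  proof -
    have top: "top P (lev P y) y" using lev_top[OF y] .
    have "\<not> P 0 (\<pi> 0 y)"
    proof -
      have "Q 0 (\<pi> 0 y) = UNIV" using \<pi>_0 by auto
      then show ?thesis using root by (simp add: P_def big_mean_def integral_UNIV)
    qed
    then have "lev P y \<noteq> 0" using top by (metis top_def)
    then obtain k where k: "lev P y = Suc k" by (cases "lev P y") auto
    have np: "\<not> P k (\<pi> k y)" using top k by (simp add: top_def)
    let ?Q = "Q (Suc k) (\<pi> (Suc k) y)"
    have "\<bar>LINT v:?Q|M. f v\<bar> \<le> (LINT v:?Q|M. \<bar>f v\<bar>)"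
      by (rule set_integral_abs_le)
    also have "\<dots> \<le> (LINT v:Q k (\<pi> k y)|M. \<bar>f v\<bar>)"
      using f by (intro set_integral_le_subset set_integrable_of_integrable) (auto dest: \<pi>_refine)
    also have "\<dots> \<le> t * measure M (Q k (\<pi> k y))" using np by (simp add: P_def big_mean_def)
    also have "\<dots> \<le> t * (D ^ 4 * measure M ?Q)" using t by (intro mult_left_mono Q_parent) auto
    finally show ?thesis
      using Q_pos[of "Suc k" y] k by (simp add: av_def ctr_def divide_le_eq mult_ac)
  qed
  have g_le: "\<bar>g y\<bar> \<le> D ^ 4 * t * indicator (stop P) y + \<bar>f y\<bar>" for y
    using av_le[of y] by (auto simp: g_def)
  have ind: "integrable M (\<lambda>y. c * indicator (stop P) y :: real)" for c
    by (intro integrable_mult_right integrable_real_indicator) (auto simp: less_top[symmetric])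
  have g_int: "integrable M g"
  proof (rule Bochner_Integration.integrable_bound)
    show "integrable M (\<lambda>y. D ^ 4 * t * indicator (stop P) y + \<bar>f y\<bar>)" using f ind by auto
    show "AE y in M. norm (g y) \<le> norm (D ^ 4 * t * indicator (stop P) y + \<bar>f y\<bar>)"
    proof (rule AE_I2)
      fix y show "norm (g y) \<le> norm (D ^ 4 * t * indicator (stop P) y + \<bar>f y\<bar>)"
        unfolding real_norm_def by (rule order_trans[OF g_le abs_ge_self])
    qed
  qed measurable
  have mstop: "t * measure M (stop P) \<le> ?I"
    using measure_stop_big_mean_le[OF f t] t by (simp add: P_def field_simps)
  have g2_le: "AE y in M. (g y)\<^sup>2 \<le> D ^ 8 * t\<^sup>2 * indicator (stop P) y + t * \<bar>f y\<bar>"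
    using not_stop_le[OF integrable_abs[OF f], of t, folded P_def]
  proof (rule eventually_mono)
    fix y assume y: "y \<notin> stop P \<longrightarrow> \<bar>f y\<bar> \<le> t"
    show "(g y)\<^sup>2 \<le> D ^ 8 * t\<^sup>2 * indicator (stop P) y + t * \<bar>f y\<bar>"
    proof (cases "y \<in> stop P")
      case True
      have "(g y)\<^sup>2 \<le> (D ^ 4 * t)\<^sup>2"
        using av_le[OF True] True by (simp add: g_def abs_le_square_iff[symmetric])
      also have "\<dots> = D ^ 8 * t\<^sup>2" by (simp add: power_mult_distrib power_mult[symmetric])
      finally show ?thesis using True t by (simp add: add_increasing2)
    next
      case False
      then have "(g y)\<^sup>2 = \<bar>f y\<bar> * \<bar>f y\<bar>" by (simp add: g_def power2_eq_square)
      also have "\<dots> \<le> t * \<bar>f y\<bar>" using y False by (intro mult_right_mono) auto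
      finally show ?thesis using False by simp
    qed
  qed
  have g2_bd: "integrable M (\<lambda>y. D ^ 8 * t\<^sup>2 * indicator (stop P) y + t * \<bar>f y\<bar>)"
    using f ind[of "D ^ 8 * t\<^sup>2"] by auto
  have g2_int: "integrable M (\<lambda>y. (g y)\<^sup>2)"
  proof (rule Bochner_Integration.integrable_bound[OF g2_bd])
    show "AE y in M. norm ((g y)\<^sup>2) \<le> norm (D ^ 8 * t\<^sup>2 * indicator (stop P) y + t * \<bar>f y\<bar>)"
      using g2_le by (rule eventually_mono) auto
  qed measurable
  have "(LINT y|M. (g y)\<^sup>2) \<le> (LINT y|M. D ^ 8 * t\<^sup>2 * indicator (stop P) y + t * \<bar>f y\<bar>)"
    by (rule integral_mono_AE[OF g2_int g2_bd g2_le])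
  also have "\<dots> = D ^ 8 * t * (t * measure M (stop P)) + t * ?I"
    using f ind[of "D ^ 8 * t\<^sup>2"]
    by (subst Bochner_Integration.integral_add) (auto simp: power2_eq_square space_M)
  also have "\<dots> \<le> D ^ 8 * t * ?I + t * ?I"
    using mstop t D_ge_1 by (intro add_right_mono mult_left_mono) auto
  finally have g2: "(LINT y|M. (g y)\<^sup>2) \<le> (D ^ 8 + 1) * t * ?I" by (simp add: algebra_simps)
  have "(LINT y|M. \<bar>f y - g y\<bar>) \<le> (LINT y|M. D ^ 4 * t * indicator (stop P) y + \<bar>f y\<bar>)"
  proof (rule integral_mono)
    show "\<bar>f y - g y\<bar> \<le> D ^ 4 * t * indicator (stop P) y + \<bar>f y\<bar>" for y
      using av_le[of y] by (auto simp: g_def)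
  qed (use f g_int ind in auto)
  also have "\<dots> = D ^ 4 * (t * measure M (stop P)) + ?I"
    using f ind[of "D ^ 4 * t"]
    by (subst Bochner_Integration.integral_add) (auto simp: space_M)
  also have "\<dots> \<le> D ^ 4 * ?I + ?I" using mstop D_ge_1 by (intro add_right_mono mult_left_mono) auto
  finally have b: "(LINT y|M. \<bar>f y - g y\<bar>) \<le> (D ^ 4 + 1) * ?I" by (simp add: algebra_simps)
  have "(LINT y:Q k z|M. (f y - g y)) = 0" if kz: "(k, z) \<in> cubes P" for k z
  proof -
    obtain x where x: "z = \<pi> k x" using kz by (auto simp: cubes_def)
    have "(LINT y:Q k z|M. g y) = (LINT y:Q k z|M. av k z)"
      using lev_ctr_cube[OF kz] by (intro set_lebesgue_integral_cong) (auto simp: g_def)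
    also have "\<dots> = (LINT y:Q k z|M. f y)"
      using Q_pos[of k x] by (simp add: set_integral_const' av_def x)
    finally show ?thesis
      using f g_int by (subst set_integral_diff) (auto intro!: set_integrable_of_integrable)
  qed
  with g2_int g_int g2 b show ?thesis by (intro exI[of _ g]) (auto simp: L2_space_def g_def)
qed

end

lemma integral_le_nn_integral:
  fixes f :: "'a \<Rightarrow> real"
  assumes "integrable M f" "(\<integral>\<^sup>+x. ennreal \<bar>f x\<bar> \<partial>M) \<le> ennreal c" "0 \<le> c"
  shows "(LINT x|M. \<bar>f x\<bar>) \<le> c"
proof -
  have "ennreal (LINT x|M. \<bar>f x\<bar>) = (\<integral>\<^sup>+x. ennreal \<bar>f x\<bar> \<partial>M)"
    using assms(1) by (intro nn_integral_eq_integral[symmetric]) auto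
  then show ?thesis using assms(2,3) by (metis ennreal_le_iff)
qed

context kernel_space
begin

text \<open>Away from the thickened stopping cubes, a function with mean zero on each of them has as
  principal value the integral against the kernel minus its value at the centre of the cube.\<close>

definition bad_kernel :: "(nat \<Rightarrow> 'a \<Rightarrow> bool) \<Rightarrow> ('a \<Rightarrow> real) \<Rightarrow> 'a \<Rightarrow> 'a \<Rightarrow> real" where
  "bad_kernel P b x y = indicator (- thick (q + 2) P) x * (indicator (stop P) y * ((K x y - K x (ctr P y)) * b y))"

definition bad_part :: "(nat \<Rightarrow> 'a \<Rightarrow> bool) \<Rightarrow> ('a \<Rightarrow> real) \<Rightarrow> 'a \<Rightarrow> real" where
  "bad_part P b x = (LINT y|M. bad_kernel P b x y)"

lemma outside_thick:
  assumes "x \<notin> thick (q + 2) P" "y \<in> stop P"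
  shows "\<not> E (lev P y - (q + 2)) (ctr P y) x"
  using cubes_lev[OF assms(2)] assms(1) by (auto simp: thick_def)

lemma ctr_near: "E (lev P y - 1) (ctr P y) y"
  unfolding ctr_def by (rule \<pi>_near)

lemma bad_kernel_measurable:
  assumes "b \<in> borel_measurable M"
  shows "(\<lambda>(x, y). bad_kernel P b x y) \<in> borel_measurable (M \<Otimes>\<^sub>M M)"
proof -
  have [measurable]: "(\<lambda>p. K (fst p) (snd p)) \<in> borel_measurable (M \<Otimes>\<^sub>M M)"
    using K_measurable by (simp add: case_prod_beta')
  have [measurable]: "(\<lambda>p. K (fst p) (ctr P (snd p))) \<in> borel_measurable (M \<Otimes>\<^sub>M M)"
    using index_compose_measurable[of "\<lambda>k z x. K x z" M P] by (simp add: case_prod_beta')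
  have [measurable]: "b \<in> borel_measurable M" by (rule assms)
  have [measurable]: "- thick (q + 2) P \<in> sets M" "stop P \<in> sets M"
    using sets.compl_sets[OF thick_sets[of "q + 2" P]] by (auto simp: space_M Compl_eq_Diff_UNIV)
  show ?thesis unfolding bad_kernel_def case_prod_beta' by measurable
qed

text \<open>For fixed \<open>y\<close> this is Hoermander's condition around the centre of the
  stopping cube of \<open>y\<close>; the points \<open>x\<close> too close to that centre lie in
  \<open>thick (q + 2) P\<close>.\<close>

lemma bad_kernel_integral:
  assumes b: "b \<in> borel_measurable M"
  shows "(\<integral>\<^sup>+x. ennreal \<bar>bad_kernel P b x y\<bar> \<partial>M) \<le> ennreal (D * W * \<bar>b y\<bar>)"
proof (cases "y \<in> stop P")
  case True
  let ?N = "lev P y - (q + 2)" and ?z = "ctr P y"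
  have "(\<integral>\<^sup>+x. ennreal \<bar>bad_kernel P b x y\<bar> \<partial>M) \<le>
    (\<integral>\<^sup>+x. ennreal \<bar>b y\<bar> * (indicator {x. \<not> E ?N ?z x} x * ennreal \<bar>K x y - K x ?z\<bar>) \<partial>M)"
    using outside_thick[OF _ True] True
    by (intro nn_integral_mono)
      (auto simp: bad_kernel_def indicator_def abs_mult ennreal_mult[symmetric] mult.commute)
  also have "\<dots> = ennreal \<bar>b y\<bar> * (\<integral>\<^sup>+x. indicator {x. \<not> E ?N ?z x} x * ennreal \<bar>K x y - K x ?z\<bar> \<partial>M)"
  proof (rule nn_integral_cmult)
    have "{x. \<not> E ?N ?z x} = space M - U ?N ?z" by (auto simp: space_M)
    then have "{x. \<not> E ?N ?z x} \<in> sets M" by auto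
    then show "(\<lambda>x. indicator {x. \<not> E ?N ?z x} x * ennreal \<bar>K x y - K x ?z\<bar>) \<in> borel_measurable M"
      by measurable
  qed
  also have "\<dots> \<le> ennreal \<bar>b y\<bar> * ennreal (D * W)"
  proof (rule mult_left_mono)
    show "(\<integral>\<^sup>+x. indicator {x. \<not> E ?N ?z x} x * ennreal \<bar>K x y - K x ?z\<bar> \<partial>M) \<le> ennreal (D * W)"
    \<comment> \<open>For \<open>?N = 0\<close> the domain of integration is empty. Otherwise the
      subtraction is not cut off, and the gap of \<open>q\<close> scales required for smoothness is
      really there.\<close>
    proof (cases "?N = 0")
      case True
      then show ?thesis by (simp add: E_0)
    next
      case False
      then show ?thesis using ctr_near[of P y] by (intro K_smooth_integral[of "lev P y - 1"]) auto
    qed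
  qed simp
  also have "\<dots> = ennreal (D * W * \<bar>b y\<bar>)"
    using W_nonneg D_ge_1 by (subst ennreal_mult[symmetric]) (auto simp: mult_ac)
  finally show ?thesis .
qed (simp add: bad_kernel_def)

text \<open>Tonelli with the integration over \<open>x\<close> done before that over
  \<open>y\<close>, the order in which the kernel difference is under control.\<close>

lemma bad_part:
  assumes b: "integrable M b"
  shows "integrable M (bad_part P b)" "(LINT x|M. \<bar>bad_part P b x\<bar>) \<le> D * W * (LINT y|M. \<bar>b y\<bar>)"
    "AE x in M. integrable M (bad_kernel P b x)"
proof -
  interpret P: pair_sigma_finite M M ..
  let ?k = "\<lambda>(x, y). bad_kernel P b x y"
  have b_meas: "b \<in> borel_measurable M" using b by auto
  have k_meas: "?k \<in> borel_measurable (M \<Otimes>\<^sub>M M)" by (rule bad_kernel_measurable[OF b_meas])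
  have ka_meas: "(\<lambda>p. ennreal \<bar>?k p\<bar>) \<in> borel_measurable (M \<Otimes>\<^sub>M M)" using k_meas by measurable
  have "(\<integral>\<^sup>+y. \<integral>\<^sup>+x. ennreal \<bar>bad_kernel P b x y\<bar> \<partial>M \<partial>M) \<le> (\<integral>\<^sup>+y. ennreal (D * W * \<bar>b y\<bar>) \<partial>M)"
    by (intro nn_integral_mono bad_kernel_integral b_meas)
  also have "\<dots> = ennreal (LINT y|M. D * W * \<bar>b y\<bar>)"
    using b W_nonneg D_ge_1 by (intro nn_integral_eq_integral) auto
  finally have yx: "(\<integral>\<^sup>+y. \<integral>\<^sup>+x. ennreal \<bar>bad_kernel P b x y\<bar> \<partial>M \<partial>M) \<le> ennreal (D * W * (LINT y|M. \<bar>b y\<bar>))"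
    by simp
  have int: "integrable (M \<Otimes>\<^sub>M M) ?k"
  proof (rule integrableI_bounded[OF k_meas])
    have "(\<integral>\<^sup>+p. ennreal (norm (?k p)) \<partial>(M \<Otimes>\<^sub>M M)) = (\<integral>\<^sup>+y. \<integral>\<^sup>+x. ennreal \<bar>bad_kernel P b x y\<bar> \<partial>M \<partial>M)"
      using P.nn_integral_snd[OF ka_meas] by simp
    also note yx
    also have "ennreal (D * W * (LINT y|M. \<bar>b y\<bar>)) < \<infinity>" by simp
    finally show "(\<integral>\<^sup>+p. ennreal (norm (?k p)) \<partial>(M \<Otimes>\<^sub>M M)) < \<infinity>" .
  qed
  show hint: "integrable M (bad_part P b)"
    using P.integrable_fst'[OF int] by (simp add: bad_part_def[abs_def])
  show ae: "AE x in M. integrable M (bad_kernel P b x)"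
    using P.AE_integrable_fst'[OF int] by simp
  have "(\<integral>\<^sup>+x. ennreal \<bar>bad_part P b x\<bar> \<partial>M) \<le> (\<integral>\<^sup>+x. \<integral>\<^sup>+y. ennreal \<bar>bad_kernel P b x y\<bar> \<partial>M \<partial>M)"
  proof (rule nn_integral_mono_AE, rule eventually_mono[OF ae])
    fix x assume "integrable M (bad_kernel P b x)"
    then show "ennreal \<bar>bad_part P b x\<bar> \<le> (\<integral>\<^sup>+y. ennreal \<bar>bad_kernel P b x y\<bar> \<partial>M)"
      using integral_norm_bound_ennreal[of M "bad_kernel P b x"] by (simp add: bad_part_def)
  qed
  also have "\<dots> = (\<integral>\<^sup>+y. \<integral>\<^sup>+x. ennreal \<bar>bad_kernel P b x y\<bar> \<partial>M \<partial>M)"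
    using P.Fubini[OF ka_meas] by simp
  also note yx
  finally show "(LINT x|M. \<bar>bad_part P b x\<bar>) \<le> D * W * (LINT y|M. \<bar>b y\<bar>)"
    using W_nonneg D_ge_1 by (intro integral_le_nn_integral[OF hint]) auto
qed

lemma bad_part_pv:
  assumes b: "integrable M b" and b0: "\<And>y. y \<notin> stop P \<Longrightarrow> b y = 0"
    and mean: "\<And>k z. (k, z) \<in> cubes P \<Longrightarrow> (LINT y:Q k z|M. b y) = 0"
  shows "AE x in M. x \<notin> thick (q + 2) P \<longrightarrow> has_pv_integral M \<rho> K b x (bad_part P b x)"
  using bad_part(3)[OF b, of P] ball_differentiation[OF b]
proof eventually_elim
  case (elim x)
  show ?case
  proof
    assume x: "x \<notin> thick (q + 2) P"
    then have bx: "b x = 0" using b0 stop_subset_thick[of "q + 2" P] by auto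
    have [measurable]: "b \<in> borel_measurable M" using b by auto
    \<comment> \<open>Truncation by whole stopping cubes, according to the position of their
      centres. It respects the vanishing means, so the kernel at the centre may be subtracted for
      free at every stage \<open>n\<close>.\<close>
    define V where "V n = {y \<in> stop P. \<not> E n x (ctr P y)}" for n
    have V_sets [measurable]: "V n \<in> sets M" for n
      using sets.Int[OF stop_sets[of P] index_sets[of "\<lambda>k z. \<not> E n x z" P]]
      by (simp add: V_def Int_def)
    \<comment> \<open>If \<open>y\<close> were close to \<open>x\<close>, then either its cube is
      small at scale \<open>n\<close> and the centre would be close too, or the cube is large and
      its thickening would contain \<open>x\<close>. The same dichotomy gives
      \<open>close\<close>.\<close>
    have far: "\<not> E (n + 2) x y" if "y \<in> V n" for n y
    proof
      assume xy: "E (n + 2) x y"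
      have y: "y \<in> stop P" "\<not> E n x (ctr P y)" using that by (auto simp: V_def)
      show False
      proof (cases "n + 2 \<le> lev P y - 1")
        case True
        then have "E n x (ctr P y)"
          by (intro chain2[OF E_near[OF xy] E_near'[OF ctr_near]]) auto
        with y show False by simp
      next
        case False
        then have "E (lev P y - (q + 2)) (ctr P y) x"
          by (intro chain2[OF E_near[OF ctr_near] E_near'[OF xy]]) auto
        with outside_thick[OF x y(1)] show False by simp
      qed
    qed
    have close: "E (n - 1) x y" if "y \<in> stop P" "E n x (ctr P y)" for n y
    proof (cases "n \<le> lev P y - 1")
      case True
      then show ?thesis by (intro chain2[OF E_near[OF that(2)] E_near[OF ctr_near]]) auto
    next
      case False
      then have "E (lev P y - (q + 2)) (ctr P y) x"
        by (intro chain1[OF E_near'[OF that(2)]]) auto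
      with outside_thick[OF x that(1)] show ?thesis by simp
    qed
    have ctr_int: "set_integrable M (V n) (\<lambda>y. K x (ctr P y) * b y)" for n
    proof (rule set_integrable_bound)
      show "set_integrable M (V n) (\<lambda>y. A / measure M (U n x) * b y)"
        using b by (intro set_integrable_of_integrable) auto
      have "(\<lambda>y. K x (ctr P y)) \<in> borel_measurable M" by (rule index_borel[of "\<lambda>k z. K x z"])
      then show "set_borel_measurable M (V n) (\<lambda>y. K x (ctr P y) * b y)"
        unfolding set_borel_measurable_def by measurable
      show "AE y in M. y \<in> V n \<longrightarrow> norm (K x (ctr P y) * b y) \<le> norm (A / measure M (U n x) * b y)"
      proof (intro AE_I2 impI)
        fix y assume "y \<in> V n"
        then have "\<not> E n x (ctr P y)" by (simp add: V_def)
        from K_size_mult[OF this, of "b y"] A_pos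
        show "norm (K x (ctr P y) * b y) \<le> norm (A / measure M (U n x) * b y)"
          unfolding real_norm_def abs_mult[of "A / measure M (U n x)"] by simp
      qed
    qed
    have ctr_zero: "(LINT y:V n|M. K x (ctr P y) * b y) = 0" for n
      unfolding set_lebesgue_integral_def
    proof (rule stop_zero_integral[where P = P])
      show "integrable M (\<lambda>y. indicator (V n) y *\<^sub>R (K x (ctr P y) * b y))"
        using ctr_int[of n] by (simp add: set_integrable_def)
      show "indicator (V n) y *\<^sub>R (K x (ctr P y) * b y) = 0" if "y \<notin> stop P" for y
        using that by (simp add: V_def)
      fix k z assume kz: "(k, z) \<in> cubes P"
      have "(LINT y:Q k z|M. indicator (V n) y *\<^sub>R (K x (ctr P y) * b y)) =
        (LINT y:Q k z|M. (if E n x z then 0 else K x z) * b y)"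
        using lev_ctr_cube[OF kz] by (intro set_lebesgue_integral_cong) (auto simp: V_def)
      also have "\<dots> = 0" using mean[OF kz] by simp
      finally show "(LINT y:Q k z|M. indicator (V n) y *\<^sub>R (K x (ctr P y) * b y)) = 0" .
    qed
    have main: "(\<lambda>n. LINT y:V n|M. (K x y - K x (ctr P y)) * b y) \<longlonglongrightarrow> bad_part P b x"
      unfolding bad_part_def set_lebesgue_integral_def
    proof (rule integral_dominated_convergence[where w = "\<lambda>y. \<bar>bad_kernel P b x y\<bar>"])
      have k: "bad_kernel P b x y = indicator (stop P) y * ((K x y - K x (ctr P y)) * b y)" for y
        using x by (simp add: bad_kernel_def)
      have [measurable]: "(\<lambda>y. K x (ctr P y)) \<in> borel_measurable M" by (rule index_borel[of "\<lambda>k z. K x z"])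
      show "(\<lambda>y. indicator (V n) y *\<^sub>R ((K x y - K x (ctr P y)) * b y)) \<in> borel_measurable M" for n
        by measurable
      show "AE y in M. (\<lambda>n. indicator (V n) y *\<^sub>R ((K x y - K x (ctr P y)) * b y)) \<longlonglongrightarrow> bad_kernel P b x y"
      proof (rule AE_I2)
        fix y
        show "(\<lambda>n. indicator (V n) y *\<^sub>R ((K x y - K x (ctr P y)) * b y)) \<longlonglongrightarrow> bad_kernel P b x y"
        proof (cases "y \<in> stop P")
          case True
          have "x \<noteq> ctr P y" using outside_thick[OF x True] E_refl by metis
          then obtain N where N: "\<not> E N x (ctr P y)" using separation by blast
          have "y \<in> V n" if "N \<le> n" for n using N E_mono[OF that] True by (auto simp: V_def)
          then have "\<forall>\<^sub>F n in sequentially. indicator (V n) y *\<^sub>R ((K x y - K x (ctr P y)) * b y) = bad_kernel P b x y"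
            unfolding eventually_sequentially using True by (intro exI[of _ N]) (simp add: k)
          then show ?thesis by (rule tendsto_eventually)
        qed (simp add: k V_def)
      qed
      show "AE y in M. norm (indicator (V n) y *\<^sub>R ((K x y - K x (ctr P y)) * b y)) \<le> \<bar>bad_kernel P b x y\<bar>" for n
        by (auto simp: k V_def indicator_def)
    qed (use elim(1) in auto)
    show "has_pv_integral M \<rho> K b x (bad_part P b x)"
    proof (rule has_pv_integralI[OF b])
      fix e :: real assume e: "0 < e"
      \<comment> \<open>The two kinds of truncation differ only between scales \<open>n - 1\<close>
        and \<open>n + 2\<close>, three doublings apart. Half of \<open>e\<close> is left for the
        convergence of the main term.\<close>
      let ?e = "e / (2 * (A * D ^ 3))"
      have "0 < ?e" using e A_pos D_ge_1 by simp
      then obtain N1 where N1: "\<And>k. N1 \<le> k \<Longrightarrow> (LINT y:U k x|M. \<bar>b y\<bar>) \<le> ?e * measure M (U k x)"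
        using elim(2) bx by force
      obtain N2 where N2: "\<And>n. N2 \<le> n \<Longrightarrow>
        \<bar>(LINT y:V n|M. (K x y - K x (ctr P y)) * b y) - bad_part P b x\<bar> < e / 2"
        using LIMSEQ_D[OF main, of "e / 2"] e by auto
      show "\<exists>N. \<forall>n\<ge>N. \<forall>V\<in>sets M. (\<forall>y. \<not> E n x y \<longrightarrow> y \<in> V) \<longrightarrow> (\<forall>y\<in>V. \<not> E (Suc n) x y) \<longrightarrow>
        \<bar>(LINT y:V|M. K x y * b y) - bad_part P b x\<bar> < e"
      proof (intro exI[of _ "N1 + N2 + 1"] allI ballI impI)
        fix n V' assume n: "N1 + N2 + 1 \<le> n" and V' [measurable]: "V' \<in> sets M"
          and V'1: "\<forall>y. \<not> E n x y \<longrightarrow> y \<in> V'" and V'2: "\<forall>y\<in>V'. \<not> E (Suc n) x y"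
        have i1: "set_integrable M V' (\<lambda>y. K x y * b y)"
          using V'2 by (intro K_integrable[OF b V', of "Suc n"]) auto
        have i2: "set_integrable M (V n) (\<lambda>y. K x y * b y)"
          using far by (intro K_integrable[OF b V_sets, of _ "n + 2"]) auto
        let ?S = "U (n - 1) x - U (n + 2) x"
        have i3: "set_integrable M ?S (\<lambda>y. K x y * b y)"
          by (intro K_integrable[OF b, of _ "n + 2"]) auto
        have "(LINT y:V n|M. (K x y - K x (ctr P y)) * b y) = (LINT y:V n|M. K x y * b y) - 0"
          using set_integral_diff(2)[OF i2 ctr_int[of n]] ctr_zero[of n] by (simp add: left_diff_distrib)
        then have "\<bar>(LINT y:V'|M. K x y * b y) - (LINT y:V n|M. (K x y - K x (ctr P y)) * b y)\<bar> =
          \<bar>LINT y|M. indicator V' y *\<^sub>R (K x y * b y) - indicator (V n) y *\<^sub>R (K x y * b y)\<bar>"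
          using i1 i2 by (simp add: set_lebesgue_integral_def set_integrable_def)
        also have "\<dots> \<le> (LINT y|M. \<bar>indicator V' y *\<^sub>R (K x y * b y) - indicator (V n) y *\<^sub>R (K x y * b y)\<bar>)"
          by (rule integral_abs_bound)
        also have "\<dots> \<le> (LINT y:?S|M. \<bar>K x y * b y\<bar>)"
          unfolding set_lebesgue_integral_def
        proof (rule integral_mono)
          show "integrable M (\<lambda>y. \<bar>indicator V' y *\<^sub>R (K x y * b y) - indicator (V n) y *\<^sub>R (K x y * b y)\<bar>)"
            using i1 i2 by (intro integrable_abs Bochner_Integration.integrable_diff) (auto simp: set_integrable_def)
          show "integrable M (\<lambda>y. indicator ?S y *\<^sub>R \<bar>K x y * b y\<bar>)"
            using set_integrable_abs[OF i3] by (simp add: set_integrable_def)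
          fix y
          show "\<bar>indicator V' y *\<^sub>R (K x y * b y) - indicator (V n) y *\<^sub>R (K x y * b y)\<bar> \<le>
            indicator ?S y *\<^sub>R \<bar>K x y * b y\<bar>"
          proof (cases "y \<in> stop P \<and> (y \<in> V' \<longleftrightarrow> y \<notin> V n)")
            case False
            then consider "b y = 0" | "y \<in> V' \<longleftrightarrow> y \<in> V n" using b0 by blast
            then show ?thesis by cases (simp_all add: indicator_def)
          next
            case True
            have "E (n - 1) x y"
            proof (cases "y \<in> V'")
              case True
              then show ?thesis using close \<open>y \<in> stop P \<and> _\<close> by (auto simp: V_def)
            next
              case False
              then have "E n x y" using V'1 by blast
              then show ?thesis by (rule E_mono[rotated]) simp
            qed
            moreover have "\<not> E (n + 2) x y"
            proof (cases "y \<in> V'")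
              case True
              then show ?thesis using V'2 E_mono[of "Suc n" "n + 2" x y] by auto
            next
              case False
              then show ?thesis using far True by blast
            qed
            ultimately show ?thesis by (auto simp: indicator_def)
          qed
        qed
        also have "\<dots> \<le> A / measure M (U (n + 2) x) * (LINT y:?S|M. \<bar>b y\<bar>)"
          by (intro K_integral_le[OF b]) auto
        also have "\<dots> \<le> A / measure M (U (n + 2) x) * (?e * (D ^ 3 * measure M (U (n + 2) x)))"
        proof (rule mult_left_mono)
          have "(LINT y:?S|M. \<bar>b y\<bar>) \<le> (LINT y:U (n - 1) x|M. \<bar>b y\<bar>)"
            using b by (intro set_integral_le_subset set_integrable_of_integrable) auto
          also have "\<dots> \<le> ?e * measure M (U (n - 1) x)" using n by (intro N1) auto
          also have "\<dots> \<le> ?e * (D ^ 3 * measure M (U (n + 2) x))"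
            using \<open>0 < ?e\<close> by (intro mult_left_mono U_doubling) auto
          finally show "(LINT y:?S|M. \<bar>b y\<bar>) \<le> ?e * (D ^ 3 * measure M (U (n + 2) x))" .
        qed (use A_pos in auto)
        also have "\<dots> = e / 2" using E_pos[of "n + 2" x] A_pos D_ge_1 by simp
        finally have "\<bar>(LINT y:V'|M. K x y * b y) - (LINT y:V n|M. (K x y - K x (ctr P y)) * b y)\<bar> \<le> e / 2" .
        moreover have "\<bar>(LINT y:V n|M. (K x y - K x (ctr P y)) * b y) - bad_part P b x\<bar> < e / 2"
          using n by (intro N2) auto
        ultimately show "\<bar>(LINT y:V'|M. K x y * b y) - bad_part P b x\<bar> < e" by linarith
      qed
    qed
  qed
qed

end

section \<open>Weak type (1,1)\<close>

text \<open>Preimages under \<open>u\<close> and \<open>v\<close> differ by a subset of a null set,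
  which completeness makes measurable.\<close>

lemma (in complete_measure) measurable_AE_eq:
  assumes v: "v \<in> borel_measurable M" and eq: "AE x in M. u x = v x"
  shows "u \<in> borel_measurable M"
proof (rule measurableI)
  fix S :: "'b set" assume S: "S \<in> sets borel"
  show "u -` S \<inter> space M \<in> sets M"
  proof (rule in_sets_AE)
    show "v -` S \<inter> space M \<in> sets M" using v S by (rule measurable_sets)
    show "AE x in M. (x \<in> v -` S \<inter> space M) = (x \<in> u -` S \<inter> space M)"
      using eq by (rule eventually_mono) auto
  qed auto
qed simp

context kernel_space
begin

abbreviation T :: "('a \<Rightarrow> real) \<Rightarrow> 'a \<Rightarrow> real" where
  "T f \<equiv> cz_op M \<rho> K f"

lemma T_pv: "cz_op_defined M \<rho> K f \<Longrightarrow> AE x in M. has_pv_integral M \<rho> K f x (T f x)"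
  unfolding cz_op_defined_def by (rule eventually_mono) (auto simp: cz_op_eq)

lemma T_L2_integral:
  assumes g: "g \<in> L2_space M"
  shows "(LINT x|M. (T g x)\<^sup>2) \<le> B\<^sup>2 * (LINT x|M. (g x)\<^sup>2)"
proof -
  have "sqrt (LINT x|M. (T g x)\<^sup>2) \<le> B * sqrt (LINT x|M. (g x)\<^sup>2)"
    using T_L2[OF g] by (simp add: L2_norm_def)
  then have "(sqrt (LINT x|M. (T g x)\<^sup>2))\<^sup>2 \<le> (B * sqrt (LINT x|M. (g x)\<^sup>2))\<^sup>2"
    by (intro power_mono) auto
  then show ?thesis by (simp add: power_mult_distrib)
qed

text \<open>The terms belong to the thickened stopping cubes, to Chebyshev in L^2 for
  \<open>T g\<close>, and to Chebyshev in L^1 for the bad part, the last two at height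
  \<open>t / 2\<close>.\<close>

definition C_weak :: real where
  "C_weak = D ^ (q + 3) + 4 * B\<^sup>2 * (D ^ 8 + 1) + 2 * D * W * (D ^ 4 + 1)"

lemma C_weak_ge_1: "1 \<le> C_weak"
  unfolding C_weak_def using one_le_power[OF D_ge_1, of "q + 3"] D_ge_1 W_nonneg
  by (simp add: add_increasing2)

text \<open>At this point \<open>T f\<close> is not known to be defined or measurable, so a
  measurable \<open>u\<close> takes its place, and existence of the principal value is asserted off
  the same set \<open>S\<close> as its bound.\<close>

lemma weak_type_decomposition:
  assumes f: "integrable M f" and t: "0 < t"
  shows "\<exists>S\<in>sets M. \<exists>u\<in>borel_measurable M. measure M S \<le> C_weak / t * (LINT y|M. \<bar>f y\<bar>) \<and>
    (AE x in M. x \<notin> S \<longrightarrow> has_pv_integral M \<rho> K f x (u x) \<and> \<bar>u x\<bar> < t)"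
proof (cases "(LINT y|M. \<bar>f y\<bar>) \<le> t * measure M UNIV")
  case False
  \<comment> \<open>If the whole space would be a stopping cube, the claimed bound exceeds the total
    mass and the whole space may serve as exceptional set.\<close>
  have "measure M UNIV \<le> 1 / t * (LINT y|M. \<bar>f y\<bar>)" using False t by (simp add: field_simps)
  also have "\<dots> \<le> C_weak / t * (LINT y|M. \<bar>f y\<bar>)"
    using C_weak_ge_1 t by (intro mult_right_mono divide_right_mono) auto
  finally show ?thesis by (intro bexI[of _ UNIV] bexI[of _ "\<lambda>_. 0"]) auto
next
  case True
  let ?I = "LINT y|M. \<bar>f y\<bar>" and ?P = "big_mean (\<lambda>y. \<bar>f y\<bar>) t"
  obtain g where g: "g \<in> L2_space M" "integrable M g" "(LINT y|M. (g y)\<^sup>2) \<le> (D ^ 8 + 1) * t * ?I"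
    and g_eq: "\<And>y. y \<notin> stop ?P \<Longrightarrow> g y = f y"
    and b_le: "(LINT y|M. \<bar>f y - g y\<bar>) \<le> (D ^ 4 + 1) * ?I"
    and mean: "\<And>k z. (k, z) \<in> cubes ?P \<Longrightarrow> (LINT y:Q k z|M. (f y - g y)) = 0"
    using cz_decomposition[OF f t True] by blast
  let ?b = "\<lambda>y. f y - g y"
  have b: "integrable M ?b" using f g by auto
  let ?h = "bad_part ?P ?b"
  have pv_b: "AE x in M. x \<notin> thick (q + 2) ?P \<longrightarrow> has_pv_integral M \<rho> K ?b x (?h x)"
    using g_eq mean by (intro bad_part_pv b) auto
  have pv_g: "AE x in M. has_pv_integral M \<rho> K g x (T g x)" using T_defined[OF g(1)] by (rule T_pv)
  have Tg [measurable]: "T g \<in> borel_measurable M" "integrable M (\<lambda>x. (T g x)\<^sup>2)"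
    using T_L2[OF g(1)] by (auto simp: L2_space_def)
  have h [measurable]: "?h \<in> borel_measurable M" using bad_part(1)[OF b] by auto
  let ?S1 = "{x \<in> space M. (t / 2)\<^sup>2 \<le> (T g x)\<^sup>2}" and ?S2 = "{x \<in> space M. t / 2 \<le> \<bar>?h x\<bar>}"
  let ?S = "thick (q + 2) ?P \<union> (?S1 \<union> ?S2)"
  have sets [measurable]: "?S1 \<in> sets M" "?S2 \<in> sets M" by measurable
  have S1: "measure M ?S1 \<le> (LINT x|M. (T g x)\<^sup>2) / (t / 2)\<^sup>2"
    using Tg t by (intro integral_Markov_inequality_measure[where A = "{}"]) auto
  have "(LINT x|M. (T g x)\<^sup>2) \<le> B\<^sup>2 * ((D ^ 8 + 1) * t * ?I)"
    using g(3) by (intro order_trans[OF T_L2_integral[OF g(1)]] mult_left_mono) auto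
  then have "(LINT x|M. (T g x)\<^sup>2) / (t / 2)\<^sup>2 \<le> B\<^sup>2 * ((D ^ 8 + 1) * t * ?I) / (t / 2)\<^sup>2"
    by (rule divide_right_mono) simp
  also have "\<dots> = 4 * B\<^sup>2 * (D ^ 8 + 1) / t * ?I"
    using t by (simp add: power2_eq_square field_simps)
  finally have S1': "measure M ?S1 \<le> 4 * B\<^sup>2 * (D ^ 8 + 1) / t * ?I" using S1 by linarith
  have S2: "measure M ?S2 \<le> (LINT x|M. \<bar>?h x\<bar>) / (t / 2)"
    using bad_part(1)[OF b] t by (intro integral_Markov_inequality_measure[where A = "{}"]) auto
  have "(LINT x|M. \<bar>?h x\<bar>) \<le> D * W * ((D ^ 4 + 1) * ?I)"
    using b_le W_nonneg D_ge_1 by (intro order_trans[OF bad_part(2)[OF b]] mult_left_mono) auto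
  then have "(LINT x|M. \<bar>?h x\<bar>) / (t / 2) \<le> D * W * ((D ^ 4 + 1) * ?I) / (t / 2)"
    using t by (intro divide_right_mono) auto
  also have "\<dots> = 2 * D * W * (D ^ 4 + 1) / t * ?I" using t by (simp add: field_simps)
  finally have S2': "measure M ?S2 \<le> 2 * D * W * (D ^ 4 + 1) / t * ?I" using S2 by linarith
  have q3: "q + 2 + 1 = q + 3" by simp
  have "measure M (thick (q + 2) ?P) \<le> D ^ (q + 3) * (?I / t)"
    using measure_stop_big_mean_le[OF f t] D_ge_1
    by (intro order_trans[OF measure_thick_le[of "q + 2", unfolded q3]] mult_left_mono) auto
  moreover have "measure M ?S \<le> measure M (thick (q + 2) ?P) + (measure M ?S1 + measure M ?S2)"
    by (intro order_trans[OF measure_Un_le] add_left_mono measure_Un_le sets.Un sets thick_sets)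
  moreover have "C_weak / t * ?I = D ^ (q + 3) * (?I / t) + 4 * B\<^sup>2 * (D ^ 8 + 1) / t * ?I +
      2 * D * W * (D ^ 4 + 1) / t * ?I"
    unfolding C_weak_def by (simp add: add_divide_distrib distrib_right)
  ultimately have S: "measure M ?S \<le> C_weak / t * ?I" using S1' S2' by linarith
  have ae: "AE x in M. x \<notin> ?S \<longrightarrow> has_pv_integral M \<rho> K f x (T g x + ?h x) \<and> \<bar>T g x + ?h x\<bar> < t"
    using pv_g pv_b
  proof eventually_elim
    case (elim x)
    show ?case
    proof
      assume x: "x \<notin> ?S"
      have "has_pv_integral M \<rho> K (\<lambda>y. g y + ?b y) x (T g x + ?h x)"
        using elim x by (intro has_pv_integral_add) auto
      moreover have "\<bar>T g x\<bar> < t / 2"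
        using x t abs_le_square_iff[of "t / 2" "T g x"] by (auto simp: space_M not_le)
      moreover have "\<bar>?h x\<bar> < t / 2" using x by (auto simp: space_M)
      ultimately show "has_pv_integral M \<rho> K f x (T g x + ?h x) \<and> \<bar>T g x + ?h x\<bar> < t" by auto
    qed
  qed
  show ?thesis
  proof (rule bexI[of _ ?S], rule bexI[of _ "\<lambda>x. T g x + ?h x"], intro conjI)
    show "?S \<in> sets M" by (intro sets.Un sets thick_sets)
    show "(\<lambda>x. T g x + ?h x) \<in> borel_measurable M" by measurable
  qed (fact S ae)+
qed

lemma weak_type_small:
  assumes f: "integrable M f" and e: "0 < e"
  obtains t where "0 < t" "C_weak / t * (LINT y|M. \<bar>f y\<bar>) \<le> e"
proof
  let ?I = "LINT y|M. \<bar>f y\<bar>"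
  have I: "0 \<le> ?I" by simp
  \<comment> \<open>The summand 1 keeps the height positive when \<open>?I\<close> is 0.\<close>
  have pos: "0 < C_weak * (?I + 1)" using C_weak_ge_1 I by (intro mult_pos_pos) linarith+
  then show "0 < C_weak * (?I + 1) / e" using e by simp
  have "C_weak / (C_weak * (?I + 1) / e) * ?I = e * (?I / (?I + 1))"
    using C_weak_ge_1 by simp
  also have "?I / (?I + 1) \<le> 1" using I by (subst divide_le_eq_1_pos) linarith+
  then have "e * (?I / (?I + 1)) \<le> e * 1" using e by (intro mult_left_mono) auto
  finally show "C_weak / (C_weak * (?I + 1) / e) * ?I \<le> e" by simp
qed

lemma T_defined_integrable:
  assumes f: "integrable M f"
  shows "cz_op_defined M \<rho> K f"
  unfolding cz_op_defined_def
proof (rule AE_of_small_exceptions)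
  fix e :: real assume "0 < e"
  then obtain t where t: "0 < t" "C_weak / t * (LINT y|M. \<bar>f y\<bar>) \<le> e" using weak_type_small[OF f] by blast
  obtain S u where S: "S \<in> sets M" "measure M S \<le> C_weak / t * (LINT y|M. \<bar>f y\<bar>)"
    and ae: "AE x in M. x \<notin> S \<longrightarrow> has_pv_integral M \<rho> K f x (u x) \<and> \<bar>u x\<bar> < t"
    using weak_type_decomposition[OF f t(1)] by blast
  have "AE x in M. x \<notin> S \<longrightarrow> (\<exists>l. has_pv_integral M \<rho> K f x l)"
    using ae by (rule eventually_mono) blast
  with S t show "\<exists>S\<in>sets M. measure M S \<le> e \<and> (AE x in M. x \<notin> S \<longrightarrow> (\<exists>l. has_pv_integral M \<rho> K f x l))"
    by (intro bexI[of _ S]) auto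
qed

text \<open>Off \<open>S n\<close> the value is \<open>u n x\<close> up to a null set, and almost
  every point is outside some \<open>S n\<close>. Gluing the functions \<open>u n\<close> along the
  first such \<open>n\<close> gives a measurable version of \<open>T f\<close>.\<close>

lemma T_measurable:
  assumes f: "integrable M f"
  shows "T f \<in> borel_measurable M"
proof -
  have "\<exists>S u. S \<in> sets M \<and> u \<in> borel_measurable M \<and> measure M S \<le> C_weak / real (Suc n) * (LINT y|M. \<bar>f y\<bar>) \<and>
    (AE x in M. x \<notin> S \<longrightarrow> has_pv_integral M \<rho> K f x (u x) \<and> \<bar>u x\<bar> < real (Suc n))" for n
    using weak_type_decomposition[OF f, of "real (Suc n)"] by auto
  then have "\<forall>n. \<exists>S u. S \<in> sets M \<and> u \<in> borel_measurable M \<and> measure M S \<le> C_weak / real (Suc n) * (LINT y|M. \<bar>f y\<bar>) \<and>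
    (AE x in M. x \<notin> S \<longrightarrow> has_pv_integral M \<rho> K f x (u x) \<and> \<bar>u x\<bar> < real (Suc n))" by blast
  from this[unfolded choice_iff] obtain S u where S: "\<And>n::nat. S n \<in> sets M" "\<And>n. u n \<in> borel_measurable M"
      "\<And>n. measure M (S n) \<le> C_weak / real (Suc n) * (LINT y|M. \<bar>f y\<bar>)"
    and ae: "\<And>n. AE x in M. x \<notin> S n \<longrightarrow> has_pv_integral M \<rho> K f x (u n x) \<and> \<bar>u n x\<bar> < real (Suc n)"
    by blast
  define N where "N x = (LEAST n. x \<notin> S n)" for x
  have "(\<lambda>x. x \<notin> S n) \<in> measurable M (count_space UNIV)" for n
    using S(1)[of n] by measurable
  then have N: "N \<in> measurable M (count_space UNIV)" unfolding N_def by (rule measurable_Least)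
  have v: "(\<lambda>x. u (N x) x) \<in> borel_measurable M"
    by (rule measurable_compose_countable[OF S(2) N])
  have "AE x in M. \<exists>n. x \<notin> S n"
  proof (rule AE_of_small_exceptions)
    fix e :: real assume "0 < e"
    moreover have "(\<lambda>n. C_weak * (LINT y|M. \<bar>f y\<bar>) * inverse (real (Suc n))) \<longlonglongrightarrow> 0"
      by (intro tendsto_mult_right_zero LIMSEQ_inverse_real_of_nat)
    ultimately obtain n where "\<bar>C_weak * (LINT y|M. \<bar>f y\<bar>) * inverse (real (Suc n))\<bar> < e"
      by (metis LIMSEQ_D diff_zero order_refl real_norm_def)
    moreover have "C_weak / real (Suc n) * (LINT y|M. \<bar>f y\<bar>) = C_weak * (LINT y|M. \<bar>f y\<bar>) * inverse (real (Suc n))"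
      by (simp only: divide_inverse mult_ac)
    ultimately have "measure M (S n) \<le> e" using S(3)[of n] by linarith
    then show "\<exists>S'\<in>sets M. measure M S' \<le> e \<and> (AE x in M. x \<notin> S' \<longrightarrow> (\<exists>n. x \<notin> S n))"
      using S(1) by (intro bexI[of _ "S n"]) auto
  qed
  moreover have "AE x in M. \<forall>n. x \<notin> S n \<longrightarrow> has_pv_integral M \<rho> K f x (u n x) \<and> \<bar>u n x\<bar> < real (Suc n)"
    using ae unfolding AE_all_countable by blast
  ultimately have "AE x in M. T f x = u (N x) x"
  proof eventually_elim
    case (elim x)
    then have "x \<notin> S (N x)" unfolding N_def by (metis (mono_tags) LeastI_ex)
    with elim(2) show ?case by (auto intro: cz_op_eq)
  qed
  with v show ?thesis by (rule measurable_AE_eq)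
qed

lemma T_weak_type:
  assumes f: "integrable M f" and t: "0 < t"
  shows "measure M {x. t \<le> \<bar>T f x\<bar>} \<le> C_weak / t * (LINT y|M. \<bar>f y\<bar>)"
proof -
  obtain S u where S: "S \<in> sets M" "measure M S \<le> C_weak / t * (LINT y|M. \<bar>f y\<bar>)"
    and ae: "AE x in M. x \<notin> S \<longrightarrow> has_pv_integral M \<rho> K f x (u x) \<and> \<bar>u x\<bar> < t"
    using weak_type_decomposition[OF f t] by blast
  have [measurable]: "T f \<in> borel_measurable M" by (rule T_measurable[OF f])
  have "{x \<in> space M. t \<le> \<bar>T f x\<bar>} \<in> sets M" by measurable
  moreover have "AE x in M. x \<in> {x. t \<le> \<bar>T f x\<bar>} \<longrightarrow> x \<in> S"
    using ae by (rule eventually_mono) (auto dest: cz_op_eq)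
  ultimately have "measure M {x. t \<le> \<bar>T f x\<bar>} \<le> measure M S"
    using S(1) by (intro finite_measure_mono_AE) auto
  with S(2) show ?thesis by simp
qed

lemma T_add:
  assumes "integrable M f" "integrable M g"
  shows "AE x in M. T (\<lambda>y. f y + g y) x = T f x + T g x"
  using T_pv[OF T_defined_integrable[OF assms(1)]] T_pv[OF T_defined_integrable[OF assms(2)]]
  by eventually_elim (auto intro!: cz_op_eq has_pv_integral_add)

end

section \<open>The good-lambda inequality\<close>

context kernel_space
begin

text \<open>For a function supported away from \<open>x\<close> the truncated integrals no longer
  change from scale \<open>N\<close> on.\<close>

lemma far_pv:
  assumes f: "integrable M f" and S: "S \<in> sets M" "\<And>y. y \<in> S \<Longrightarrow> \<not> E N x y"
  shows "has_pv_integral M \<rho> K (\<lambda>y. indicator S y * f y) x (LINT y:S|M. K x y * f y)"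
proof (rule has_pv_integralI)
  show "integrable M (\<lambda>y. indicator S y * f y)"
    using integrable_mult_indicator[OF S(1) f] by simp
  fix e :: real assume e: "0 < e"
  show "\<exists>N. \<forall>n\<ge>N. \<forall>V\<in>sets M. (\<forall>y. \<not> E n x y \<longrightarrow> y \<in> V) \<longrightarrow> (\<forall>y\<in>V. \<not> E (Suc n) x y) \<longrightarrow>
    \<bar>(LINT y:V|M. K x y * (indicator S y * f y)) - (LINT y:S|M. K x y * f y)\<bar> < e"
  proof (intro exI[of _ N] allI ballI impI)
    fix n V assume n: "N \<le> n" and V: "\<forall>y. \<not> E n x y \<longrightarrow> y \<in> V"
    have "S \<subseteq> V" using S(2) V E_mono[OF n] by blast
    then have "(LINT y:V|M. K x y * (indicator S y * f y)) = (LINT y:S|M. K x y * f y)"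
      unfolding set_lebesgue_integral_def
      by (intro Bochner_Integration.integral_cong) (auto simp: indicator_def)
    then show "\<bar>(LINT y:V|M. K x y * (indicator S y * f y)) - (LINT y:S|M. K x y * f y)\<bar> < e" using e by simp
  qed
qed

definition dil :: nat where "dil = q + 2"

definition C_osc :: real where "C_osc = D ^ (dil + 1) * W"

lemma C_osc_nonneg: "0 \<le> C_osc"
  unfolding C_osc_def using W_nonneg D_ge_1 by simp

lemma far_from_cube:
  assumes "E (k - 1) z x" "\<not> E (k - dil) z y"
  shows "\<not> E (Suc (k - dil)) x y"
proof
  assume "E (Suc (k - dil)) x y"
  moreover have "k - dil \<noteq> 0" using assms(2) E_0 by metis
  ultimately have "E (k - dil) z y"
    using assms(1) by (intro chain2[OF E_near[OF assms(1)] E_near]) (auto simp: dil_def)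
  with assms(2) show False by simp
qed

text \<open>Smoothness summed over the shells around \<open>z\<close>. Averages of \<open>f\<close>
  are controlled only along the cubes of one point \<open>x1\<close>, where the maximal function is
  small; the ball \<open>U (n - 1) z\<close> fits into \<open>U (n - dil) (\<pi> n x1)\<close> with
  comparable measure.\<close>

lemma oscillation:
  assumes f: "integrable M f" and s: "0 \<le> s" and x1: "\<pi> k x1 = z" and x: "\<pi> k x = z"
    and avg: "\<And>j. (LINT y:U (j - dil) (\<pi> j x1)|M. \<bar>f y\<bar>) \<le> s * measure M (U (j - dil) (\<pi> j x1))"
  shows "\<bar>(LINT y:- U (k - dil) z|M. K x y * f y) - (LINT y:- U (k - dil) z|M. K z y * f y)\<bar> \<le> C_osc * s"
proof (cases "k - dil = 0")
  case True
  then show ?thesis using C_osc_nonneg s by (simp add: E_0 set_lebesgue_integral_def)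
next
  case False
  let ?N = "k - dil"
  let ?S = "- U ?N z"
  have S [measurable]: "?S \<in> sets M"
    using sets.compl_sets[OF U_sets[of ?N z]] by (simp add: space_M Compl_eq_Diff_UNIV)
  have zx: "E (k - 1) z x" "E (k - 1) z x1" using \<pi>_near[of k x] \<pi>_near[of k x1] x x1 by simp_all
  have i1: "set_integrable M ?S (\<lambda>y. K x y * f y)"
    using far_from_cube[OF zx(1)] by (intro K_integrable[OF f S, of "Suc ?N"]) auto
  have i2: "set_integrable M ?S (\<lambda>y. K z y * f y)"
    by (intro K_integrable[OF f S, of ?N]) auto
  let ?c = "\<lambda>n. w (k - 1 - n) / measure M (U n z)"
  have fi: "integrable M (\<lambda>y. indicator (U j z) y * \<bar>f y\<bar>)" for j
    using integrable_mult_indicator[OF U_sets integrable_abs[OF f], of j z] by simp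
  have "\<bar>(LINT y:?S|M. K x y * f y) - (LINT y:?S|M. K z y * f y)\<bar> = \<bar>LINT y:?S|M. K x y * f y - K z y * f y\<bar>"
    using i1 i2 by (simp add: set_integral_diff)
  also have "\<dots> \<le> (LINT y:?S|M. \<bar>K x y * f y - K z y * f y\<bar>)" by (rule set_integral_abs_le)
  also have "\<dots> \<le> (LINT y|M. (\<Sum>n=1..?N. ?c n * (indicator (U (n - 1) z) y * \<bar>f y\<bar>)))"
    unfolding set_lebesgue_integral_def
  proof (rule integral_mono)
    show "integrable M (\<lambda>y. indicator ?S y *\<^sub>R \<bar>K x y * f y - K z y * f y\<bar>)"
      using set_integrable_abs[OF set_integral_diff(1)[OF i1 i2]] by (simp add: set_integrable_def)
    show "integrable M (\<lambda>y. \<Sum>n=1..?N. ?c n * (indicator (U (n - 1) z) y * \<bar>f y\<bar>))"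
      by (intro Bochner_Integration.integrable_sum integrable_mult_right fi)
    fix y
    have nonneg: "0 \<le> (\<Sum>n=1..?N. ?c n * (indicator (U (n - 1) z) y * \<bar>f y\<bar>))"
      using w_nonneg by (intro sum_nonneg mult_nonneg_nonneg divide_nonneg_nonneg) auto
    show "indicator ?S y *\<^sub>R \<bar>K x y * f y - K z y * f y\<bar> \<le>
      (\<Sum>n=1..?N. ?c n * (indicator (U (n - 1) z) y * \<bar>f y\<bar>))"
    proof (cases "y \<in> ?S")
      case True
      have "\<bar>K x y * f y - K z y * f y\<bar> = \<bar>K x y - K z y\<bar> * \<bar>f y\<bar>"
        by (simp add: abs_mult[symmetric] left_diff_distrib)
      also have "\<dots> \<le> (\<Sum>n=1..?N. ?c n * indicator (U (n - 1) z) y) * \<bar>f y\<bar>"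
        using True False by (intro mult_right_mono K_smooth_sum(1)[OF zx(1)]) (auto simp: dil_def)
      also have "\<dots> = (\<Sum>n=1..?N. ?c n * (indicator (U (n - 1) z) y * \<bar>f y\<bar>))"
        by (simp only: sum_distrib_right mult.assoc)
      finally show ?thesis using True by simp
    qed (use nonneg in simp)
  qed
  also have "\<dots> = (\<Sum>n=1..?N. ?c n * (LINT y:U (n - 1) z|M. \<bar>f y\<bar>))"
    by (subst Bochner_Integration.integral_sum, intro integrable_mult_right fi)
      (simp add: set_lebesgue_integral_def)
  also have "\<dots> \<le> (\<Sum>n=1..?N. ?c n * (D ^ (dil + 1) * s * measure M (U n z)))"
  proof (intro sum_mono mult_left_mono)
    fix n assume n: "n \<in> {1..?N}"
    have near: "near (n - 2) (\<pi> n x1) z"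
      using n by (intro E_near chain2[OF E_near[OF \<pi>_near] E_near'[OF zx(2)]]) auto
    have "U (n - 1) z \<subseteq> U (n - dil) (\<pi> n x1)"
    proof
      fix y assume "y \<in> U (n - 1) z"
      then have "E (n - 1) z y" by simp
      then show "y \<in> U (n - dil) (\<pi> n x1)"
        using n chain3[OF E_near[OF \<pi>_near[of n x1]] E_near'[OF zx(2)] E_near, of "n - 1" y "n - dil"]
        by (auto simp: dil_def)
    qed
    then have "(LINT y:U (n - 1) z|M. \<bar>f y\<bar>) \<le> (LINT y:U (n - dil) (\<pi> n x1)|M. \<bar>f y\<bar>)"
      using f by (intro set_integral_le_subset set_integrable_of_integrable) auto
    also have "\<dots> \<le> s * measure M (U (n - dil) (\<pi> n x1))" by (rule avg)
    also have "\<dots> \<le> s * (D ^ (dil + 1) * measure M (U n z))"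
      using s by (intro mult_left_mono U_near_doubling[OF near]) (auto simp: dil_def)
    finally show "(LINT y:U (n - 1) z|M. \<bar>f y\<bar>) \<le> D ^ (dil + 1) * s * measure M (U n z)"
      by (simp add: mult_ac)
  qed (use w_nonneg in auto)
  also have "\<dots> = D ^ (dil + 1) * s * (\<Sum>n=1..?N. w (k - 1 - n))"
    unfolding sum_distrib_left
  proof (intro sum.cong refl)
    fix n show "?c n * (D ^ (dil + 1) * s * measure M (U n z)) = D ^ (dil + 1) * s * w (k - 1 - n)"
      using E_pos[of n z] by simp
  qed
  also have "\<dots> \<le> D ^ (dil + 1) * s * W"
    using D_ge_1 s by (intro mult_left_mono w_sum_le) (auto simp: dil_def)
  finally show ?thesis by (simp add: C_osc_def mult_ac)
qed

text \<open>Summing the three constants makes one condition \<open>\<gamma> * C_good \<le> 1\<close>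
  imply the three separate requirements: on the local part of \<open>f\<close>, on the oscillation
  of the far part, and on the root cube.\<close>

definition C_good :: real where
  "C_good = 8 * C_weak * D ^ (dil + 1) + 4 * C_osc + 8 * C_weak * D ^ 4"

lemma C_good_pos: "0 < C_good"
  unfolding C_good_def using C_weak_ge_1 D_ge_1 C_osc_nonneg
  by (intro add_pos_pos add_pos_nonneg mult_pos_pos) auto

lemma good_small:
  assumes "0 < \<gamma>" "\<gamma> * C_good \<le> 1"
  shows "8 * C_weak * D ^ (dil + 1) * \<gamma> \<le> 1" "4 * C_osc * \<gamma> \<le> 1" "8 * C_weak * D ^ 4 * \<gamma> \<le> 1"
proof -
  have nn: "0 \<le> 8 * C_weak * D ^ (dil + 1) * \<gamma>" "0 \<le> 4 * C_osc * \<gamma>" "0 \<le> 8 * C_weak * D ^ 4 * \<gamma>"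
    using C_weak_ge_1 D_ge_1 C_osc_nonneg assms(1) by auto
  have "8 * C_weak * D ^ (dil + 1) * \<gamma> + 4 * C_osc * \<gamma> + 8 * C_weak * D ^ 4 * \<gamma> \<le> 1"
    using assms(2) by (simp add: C_good_def algebra_simps)
  with nn show "8 * C_weak * D ^ (dil + 1) * \<gamma> \<le> 1" "4 * C_osc * \<gamma> \<le> 1" "8 * C_weak * D ^ 4 * \<gamma> \<le> 1"
    by linarith+
qed

lemma level_sets:
  assumes "integrable M f"
  shows "{x. t < \<bar>T f x\<bar>} \<in> sets M" "{x. t \<le> \<bar>T f x\<bar>} \<in> sets M"
proof -
  have [measurable]: "T f \<in> borel_measurable M" by (rule T_measurable[OF assms])
  have "{x \<in> space M. t < \<bar>T f x\<bar>} \<in> sets M" "{x \<in> space M. t \<le> \<bar>T f x\<bar>} \<in> sets M" by measurable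
  then show "{x. t < \<bar>T f x\<bar>} \<in> sets M" "{x. t \<le> \<bar>T f x\<bar>} \<in> sets M" by (simp_all add: space_M)
qed

lemma set_integral_indicator: "H \<in> sets M \<Longrightarrow> S \<in> sets M \<Longrightarrow> (LINT x:S|M. indicator H x :: real) = measure M (S \<inter> H)"
  by (simp add: set_lebesgue_integral_def indicator_inter_arith[symmetric] space_M)

lemma set_integral_const_minus_indicator:
  fixes c :: real
  assumes G: "G \<in> sets M" and S: "S \<in> sets M"
  shows "(LINT x:S|M. (c - indicator G x)) = c * measure M S - measure M (S \<inter> G)"
proof -
  have "set_integrable M S (indicator G :: 'a \<Rightarrow> real)"
    using assms by (intro set_integrable_of_integrable integrable_real_indicator) (auto simp: less_top[symmetric])
  then show ?thesis
    using assms by (subst set_integral_diff) (auto simp: set_integral_const' set_integral_indicator)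
qed

text \<open>Let the cube contain a point with small maximal function. The far part is at most
  \<open>3 / 2 * t\<close> at some point of the cube and varies by at most \<open>t / 2\<close>,
  hence is at most \<open>2 * t\<close> on all of it; so \<open>3 * t < \<bar>T f x\<bar>\<close>
  forces the local part to be large, up to a null set, and the weak type bound applies to the
  latter.\<close>

lemma good_lambda_cube:
  assumes f: "integrable M f" and t: "0 < t" and \<gamma>: "0 < \<gamma>" "\<gamma> * C_good \<le> 1"
  defines "H \<equiv> {x. t < \<bar>T f x\<bar>}"
  defines "P \<equiv> big_mean (indicator H) (1 / (4 * D ^ 4))"
  defines "G \<equiv> {x. 3 * t < \<bar>T f x\<bar>} - stop (big_avg dil f (\<gamma> * t))"
  assumes kz: "(k, z) \<in> cubes P"
  shows "measure M (Q k z \<inter> G) \<le> 2 * C_weak * D ^ (dil + 1) * \<gamma> * measure M (Q k z)"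
proof (cases "Q k z \<inter> G = {}")
  case True
  then show ?thesis using C_weak_ge_1 D_ge_1 \<gamma>(1) by simp
next
  case False
  note small = good_small[OF \<gamma>]
  have H [measurable]: "H \<in> sets M" unfolding H_def by (rule level_sets[OF f])
  obtain x1 where x1: "\<pi> k x1 = z" "x1 \<in> G" using False by auto
  have top: "top P k x1" using cubes_top[OF kz x1(1)] .
  have avg: "(LINT y:U (j - dil) (\<pi> j x1)|M. \<bar>f y\<bar>) \<le> \<gamma> * t * measure M (U (j - dil) (\<pi> j x1))" for j
    using x1(2) by (auto simp: G_def stop_def big_avg_def not_less)
  have Qpos: "0 < measure M (Q k z)" using Q_pos[of k x1] x1 by simp
  have P_iff: "P j (\<pi> j x) \<longleftrightarrow> measure M (Q j (\<pi> j x)) < 4 * D ^ 4 * measure M (Q j (\<pi> j x) \<inter> H)" for j x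
    using D_ge_1 by (simp add: P_def big_mean_def set_integral_indicator field_simps)
  \<comment> \<open>The root is not a stopping cube: \<open>avg\<close> at level 0 bounds the mean
    of |f| over the whole space by \<open>\<gamma> * t\<close>, and the weak type bound then makes
    the proportion of \<open>H\<close> too small.\<close>
  have "k \<noteq> 0"
  proof
    assume k: "k = 0"
    have Q0: "Q 0 (\<pi> 0 x1) = UNIV" using \<pi>_0 by auto
    have "measure M H \<le> measure M {x. t \<le> \<bar>T f x\<bar>}"
      unfolding H_def by (intro m_mono level_sets f) auto
    also have "\<dots> \<le> C_weak / t * (LINT y|M. \<bar>f y\<bar>)" by (rule T_weak_type[OF f t])
    also have "\<dots> \<le> C_weak / t * (\<gamma> * t * measure M UNIV)"
      using avg[of 0] C_weak_ge_1 t by (intro mult_left_mono) (auto simp: U_0 integral_UNIV)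
    also have "\<dots> = C_weak * \<gamma> * measure M UNIV" using t by simp
    finally have mH: "measure M H \<le> C_weak * \<gamma> * measure M UNIV" .
    have "measure M UNIV < 4 * D ^ 4 * measure M H"
      using top P_iff[of 0 x1] by (simp add: top_def k Q0)
    also have "\<dots> \<le> 4 * D ^ 4 * (C_weak * \<gamma> * measure M UNIV)"
      using mH D_ge_1 by (intro mult_left_mono) auto
    also have "\<dots> = (8 * C_weak * D ^ 4 * \<gamma>) * (measure M UNIV / 2)" by simp
    also have "\<dots> \<le> 1 * (measure M UNIV / 2)" using small(3) by (intro mult_right_mono) auto
    finally show False using m_UNIV_pos by simp
  qed
  then obtain j where j: "k = Suc j" by (cases k) auto
  have QH: "measure M (Q k z \<inter> H) \<le> measure M (Q k z) / 4"
  proof -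
    have "\<not> P j (\<pi> j x1)" using top j by (simp add: top_def)
    then have "4 * D ^ 4 * measure M (Q j (\<pi> j x1) \<inter> H) \<le> measure M (Q j (\<pi> j x1))"
      using P_iff by (simp add: not_less)
    also have "\<dots> \<le> D ^ 4 * measure M (Q k z)" using Q_parent[of j x1] x1(1) j by simp
    finally have "4 * measure M (Q j (\<pi> j x1) \<inter> H) \<le> measure M (Q k z)"
      using D_ge_1 by (simp add: mult_le_cancel_left_pos)
    moreover have "measure M (Q k z \<inter> H) \<le> measure M (Q j (\<pi> j x1) \<inter> H)"
      using x1(1) j by (intro m_mono) (auto dest: \<pi>_refine)
    ultimately show ?thesis by simp
  qed
  let ?U = "U (k - dil) z"
  let ?f1 = "\<lambda>y. indicator ?U y * f y" and ?f2 = "\<lambda>y. indicator (- ?U) y * f y"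
  let ?F = "\<lambda>x. LINT y:- ?U|M. K x y * f y"
  have U' [measurable]: "- ?U \<in> sets M"
    using sets.compl_sets[OF U_sets[of "k - dil" z]] by (simp add: space_M Compl_eq_Diff_UNIV)
  have f1: "integrable M ?f1" using integrable_mult_indicator[OF U_sets f] by simp
  have f2: "integrable M ?f2" using integrable_mult_indicator[OF U' f] by simp
  let ?B1 = "{x. t / 2 \<le> \<bar>T ?f1 x\<bar>}"
  have B1_sets: "?B1 \<in> sets M" by (rule level_sets[OF f1])
  have B1: "measure M ?B1 \<le> 2 * C_weak * D ^ (dil + 1) * \<gamma> * measure M (Q k z)"
  proof -
    have "measure M ?B1 \<le> C_weak / (t / 2) * (LINT y|M. \<bar>?f1 y\<bar>)"
      using t by (intro T_weak_type f1) auto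
    also have "(LINT y|M. \<bar>?f1 y\<bar>) = (LINT y:?U|M. \<bar>f y\<bar>)"
      by (simp add: set_lebesgue_integral_def abs_mult)
    also have "C_weak / (t / 2) * \<dots> \<le> C_weak / (t / 2) * (\<gamma> * t * measure M ?U)"
      using avg[of k] x1(1) C_weak_ge_1 t by (intro mult_left_mono) auto
    also have "\<dots> \<le> C_weak / (t / 2) * (\<gamma> * t * (D ^ (dil + 1) * measure M (Q k z)))"
      using U_le_Q[of k dil x1] x1(1) C_weak_ge_1 t \<gamma>(1) by (intro mult_left_mono) auto
    also have "\<dots> = 2 * C_weak * D ^ (dil + 1) * \<gamma> * measure M (Q k z)" using t by simp
    finally show ?thesis .
  qed
  have B1': "measure M ?B1 \<le> measure M (Q k z) / 4"
  proof -
    have "2 * C_weak * D ^ (dil + 1) * \<gamma> * measure M (Q k z) = (8 * C_weak * D ^ (dil + 1) * \<gamma>) * (measure M (Q k z) / 4)"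
      by simp
    also have "\<dots> \<le> 1 * (measure M (Q k z) / 4)" using small(1) by (intro mult_right_mono) auto
    finally show ?thesis using B1 by simp
  qed
  have "AE x in M. T (\<lambda>y. ?f1 y + ?f2 y) x = T ?f1 x + T ?f2 x" by (rule T_add[OF f1 f2])
  moreover have "(\<lambda>y. ?f1 y + ?f2 y) = f" by (rule ext) (simp add: indicator_def)
  ultimately have "AE x in M. T f x = T ?f1 x + T ?f2 x" by simp
  then obtain N where N: "N \<in> null_sets M" "\<And>x. x \<notin> N \<Longrightarrow> T f x = T ?f1 x + T ?f2 x"
    by (auto elim!: AE_E3 simp: space_M)
  \<comment> \<open>This holds at every point of the cube and not just almost everywhere, so values
    of the far part may be compared at single points.\<close>
  have Tf2: "T ?f2 x = ?F x" if "\<pi> k x = z" for x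
  proof (rule cz_op_eq, rule far_pv[OF f U'])
    have "E (k - 1) z x" using \<pi>_near[of k x] that by simp
    then show "\<not> E (Suc (k - dil)) x y" if "y \<in> - ?U" for y
      using far_from_cube that by auto
  qed
  have osc: "\<bar>?F x - ?F x'\<bar> \<le> t / 2" if "\<pi> k x = z" "\<pi> k x' = z" for x x'
  proof -
    have "\<bar>?F x - ?F z\<bar> \<le> C_osc * (\<gamma> * t)" "\<bar>?F x' - ?F z\<bar> \<le> C_osc * (\<gamma> * t)"
      using t \<gamma>(1) by (intro oscillation[OF f _ x1(1) _ avg] that; simp)+
    moreover have "4 * C_osc * \<gamma> * t \<le> 1 * t" using small(2) t by (intro mult_right_mono) auto
    then have "C_osc * (\<gamma> * t) \<le> t / 4" by (simp add: mult_ac)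
    ultimately show ?thesis by linarith
  qed
  \<comment> \<open>\<open>H\<close> and \<open>?B1\<close> each occupy at most a quarter of the
    cube, so some point avoids both as well as the null set \<open>N\<close>.\<close>
  have "\<exists>x'. \<pi> k x' = z \<and> x' \<notin> H \<and> x' \<notin> ?B1 \<and> x' \<notin> N"
  proof (rule ccontr)
    assume "\<not> ?thesis"
    then have "Q k z \<subseteq> (Q k z \<inter> H) \<union> (?B1 \<union> N)" by auto
    then have "measure M (Q k z) \<le> measure M ((Q k z \<inter> H) \<union> (?B1 \<union> N))"
      using N(1) B1_sets by (intro m_mono) auto
    also have "\<dots> \<le> measure M (Q k z \<inter> H) + (measure M ?B1 + measure M N)"
      using N(1) B1_sets by (intro order_trans[OF measure_Un_le] add_left_mono measure_Un_le) auto
    also have "measure M N = 0" using N(1) by (simp add: measure_eq_0_null_sets)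
    finally show False using QH B1' Qpos by simp
  qed
  then obtain x' where x': "\<pi> k x' = z" "\<bar>T f x'\<bar> \<le> t" "\<bar>T ?f1 x'\<bar> < t / 2" "x' \<notin> N"
    by (auto simp: H_def not_less not_le)
  have "\<bar>?F x'\<bar> \<le> t + t / 2" using N(2)[OF x'(4)] Tf2[OF x'(1)] x'(2,3) by linarith
  then have "Q k z \<inter> G \<subseteq> ?B1 \<union> N"
  proof (intro subsetI)
    fix x assume F': "\<bar>?F x'\<bar> \<le> t + t / 2" and x: "x \<in> Q k z \<inter> G"
    then have xz: "\<pi> k x = z" "3 * t < \<bar>T f x\<bar>" by (auto simp: G_def)
    show "x \<in> ?B1 \<union> N"
    proof (cases "x \<in> N")
      case False
      have "t / 2 \<le> \<bar>T ?f1 x\<bar>"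
        using N(2)[OF False] Tf2[OF xz(1)] osc[OF xz(1) x'(1)] F' xz(2) t by linarith
      then show ?thesis by simp
    qed simp
  qed
  then have "measure M (Q k z \<inter> G) \<le> measure M (?B1 \<union> N)" using N(1) B1_sets by (intro m_mono) auto
  also have "\<dots> \<le> measure M ?B1 + measure M N" using N(1) B1_sets by (intro measure_Un_le) auto
  also have "measure M N = 0" using N(1) by (simp add: measure_eq_0_null_sets)
  finally show ?thesis using B1 by simp
qed

definition C_lambda :: real where "C_lambda = 8 * C_weak * D ^ (dil + 5)"

lemma C_lambda_pos: "0 < C_lambda"
  unfolding C_lambda_def using C_weak_ge_1 D_ge_1 by (intro mult_pos_pos) auto

text \<open>Differentiation of the indicator puts almost every point of \<open>?H\<close> into a
  stopping cube, the threshold being below 1. The estimate per cube is then summed, and the cubes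
  together have at most \<open>4 * D ^ 4\<close> times the measure of \<open>?H\<close>.\<close>

lemma good_lambda:
  assumes f: "integrable M f" and t: "0 < t" and \<gamma>: "0 < \<gamma>" "\<gamma> * C_good \<le> 1"
  shows "measure M {x. 3 * t < \<bar>T f x\<bar>} \<le>
    C_lambda * \<gamma> * measure M {x. t < \<bar>T f x\<bar>} + measure M (stop (big_avg dil f (\<gamma> * t)))"
proof -
  let ?H = "{x. t < \<bar>T f x\<bar>}" and ?A = "stop (big_avg dil f (\<gamma> * t))"
  let ?P = "big_mean (indicator ?H) (1 / (4 * D ^ 4))"
  let ?G = "{x. 3 * t < \<bar>T f x\<bar>} - ?A"
  let ?c = "2 * C_weak * D ^ (dil + 1) * \<gamma>"
  have H: "?H \<in> sets M" by (rule level_sets[OF f])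
  have G: "?G \<in> sets M" using level_sets(1)[OF f, of "3 * t"] by auto
  have Hi: "integrable M (indicator ?H :: 'a \<Rightarrow> real)"
    using H by (intro integrable_real_indicator) (auto simp: less_top[symmetric])
  have Gi: "integrable M (indicator ?G :: 'a \<Rightarrow> real)"
    using G by (intro integrable_real_indicator) (auto simp: less_top[symmetric])
  have "AE x in M. x \<notin> stop ?P \<longrightarrow> indicator ?H x \<le> 1 / (4 * D ^ 4)" by (rule not_stop_le[OF Hi])
  then have "AE x in M. x \<in> ?G \<longrightarrow> x \<in> stop ?P \<inter> ?G"
  proof (rule eventually_mono, intro impI)
    fix x assume x: "x \<notin> stop ?P \<longrightarrow> indicator ?H x \<le> 1 / (4 * D ^ 4)" and "x \<in> ?G"
    then have "indicator ?H x = (1 :: real)" using t by auto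
    moreover have "1 < 4 * D ^ 4" using one_le_power[OF D_ge_1, of 4] by linarith
    then have "1 / (4 * D ^ 4) < 1" by (simp add: divide_less_eq)
    ultimately show "x \<in> stop ?P \<inter> ?G" using x \<open>x \<in> ?G\<close> by auto
  qed
  then have "measure M ?G \<le> measure M (stop ?P \<inter> ?G)"
    using G by (intro finite_measure_mono_AE) auto
  also have "\<dots> \<le> ?c * measure M (stop ?P)"
  proof -
    have "0 \<le> (LINT x:stop ?P|M. (?c - indicator ?G x))"
    proof (rule stop_integral_nonneg)
      show "integrable M (\<lambda>x. ?c - indicator ?G x)" using Gi by simp
      fix k z assume "(k, z) \<in> cubes ?P"
      from good_lambda_cube[OF f t \<gamma> this]
      show "0 \<le> (LINT x:Q k z|M. (?c - indicator ?G x))"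
        unfolding set_integral_const_minus_indicator[OF G Q_sets] by linarith
    qed
    then show ?thesis unfolding set_integral_const_minus_indicator[OF G stop_sets] by linarith
  qed
  also have "\<dots> \<le> ?c * (measure M ?H / (1 / (4 * D ^ 4)))"
  proof (rule mult_left_mono)
    have "measure M (stop ?P) \<le> (LINT y|M. \<bar>indicator ?H y\<bar>) / (1 / (4 * D ^ 4))"
      using measure_stop_big_mean_le[OF Hi, of "1 / (4 * D ^ 4)"] D_ge_1 by simp
    then show "measure M (stop ?P) \<le> measure M ?H / (1 / (4 * D ^ 4))" by (simp add: space_M)
  qed (use C_weak_ge_1 D_ge_1 \<gamma> in auto)
  also have "\<dots> = C_lambda * \<gamma> * measure M ?H" by (simp add: C_lambda_def power_add eval_nat_numeral)
  finally have "measure M ?G \<le> C_lambda * \<gamma> * measure M ?H" .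
  moreover have "measure M {x. 3 * t < \<bar>T f x\<bar>} \<le> measure M (?G \<union> ?A)"
    by (rule m_mono[OF _ sets.Un[OF G stop_sets]]) auto
  moreover have "\<dots> \<le> measure M ?G + measure M ?A" by (rule measure_Un_le[OF G stop_sets])
  ultimately show ?thesis by linarith
qed

end

section \<open>Strong type bounds\<close>

lemma nn_integral_powr:
  assumes s: "0 < s" and a: "0 \<le> a"
  shows "(\<integral>\<^sup>+t. (if 0 < t \<and> t < a then ennreal (s * t powr (s - 1)) else 0) \<partial>lborel) = ennreal (a powr s)"
proof -
  have "((\<lambda>t. t powr (s - 1)) has_integral a powr (s - 1 + 1) / (s - 1 + 1)) {0..a}"
    using s a by (intro has_integral_powr_from_0) auto
  then have "((\<lambda>t. s * t powr (s - 1)) has_integral s * (a powr s / s)) {0..a}"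
    by (intro has_integral_mult_right) simp
  then have "(\<integral>\<^sup>+t. indicator {0..a} t * ennreal (s * t powr (s - 1)) \<partial>lborel) = ennreal (a powr s)"
    using s nn_integral_has_integral_lebesgue'[of "{0..a}" "\<lambda>t. s * t powr (s - 1)"]
    by (simp add: mult.commute)
  moreover have "(\<integral>\<^sup>+t. (if 0 < t \<and> t < a then ennreal (s * t powr (s - 1)) else 0) \<partial>lborel) =
      (\<integral>\<^sup>+t. indicator {0..a} t * ennreal (s * t powr (s - 1)) \<partial>lborel)"
  proof (rule nn_integral_cong_AE)
    show "AE t in lborel. (if 0 < t \<and> t < a then ennreal (s * t powr (s - 1)) else 0) =
        indicator {0..a} t * ennreal (s * t powr (s - 1))"
      using AE_lborel_singleton[of 0] AE_lborel_singleton[of a]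
      by eventually_elim (auto simp: indicator_def)
  qed
  ultimately show ?thesis by simp
qed

lemma ennreal_linear:
  "0 \<le> a \<Longrightarrow> 0 \<le> b \<Longrightarrow> 0 \<le> x \<Longrightarrow> 0 \<le> y \<Longrightarrow>
    ennreal (a * x + b * y) = ennreal a * ennreal x + ennreal b * ennreal y"
  by (simp add: ennreal_mult ennreal_plus)

lemma (in finite_measure) integrable_of_powr:
  fixes f :: "'a \<Rightarrow> real"
  assumes f: "f \<in> borel_measurable M" and s: "1 \<le> s" and fs: "integrable M (\<lambda>x. \<bar>f x\<bar> powr s)"
  shows "integrable M f"
proof (rule Bochner_Integration.integrable_bound)
  show "integrable M (\<lambda>x. 1 + \<bar>f x\<bar> powr s)" using fs by simp
  show "AE x in M. norm (f x) \<le> norm (1 + \<bar>f x\<bar> powr s)"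
  proof (rule AE_I2)
    fix x show "norm (f x) \<le> norm (1 + \<bar>f x\<bar> powr s)"
    proof (cases "\<bar>f x\<bar> \<le> 1")
      case False
      then have "\<bar>f x\<bar> powr 1 \<le> \<bar>f x\<bar> powr s" using s by (intro powr_mono) auto
      then show ?thesis using False by simp
    qed (simp add: add_increasing2)
  qed
qed (rule f)

lemma (in finite_measure) level_measurable:
  assumes u: "u \<in> borel_measurable M"
  shows "(\<lambda>t::real. emeasure M {x \<in> space M. t < u x}) \<in> borel_measurable borel"
proof -
  let ?S = "{p \<in> space (borel \<Otimes>\<^sub>M M). fst p < u (snd p)}"
  have "?S \<in> sets (borel \<Otimes>\<^sub>M M)" using u by measurable
  from measurable_emeasure_Pair[OF this]
  show ?thesis by (simp add: vimage_def space_pair_measure)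
qed

lemma (in finite_measure) layer_cake:
  assumes u [measurable]: "u \<in> borel_measurable M" and u0: "\<And>x. 0 \<le> u x" and s: "0 < s"
  shows "(\<integral>\<^sup>+x. ennreal (u x powr s) \<partial>M) =
    (\<integral>\<^sup>+t. indicator {0<..} t * ennreal (s * t powr (s - 1)) * emeasure M {x \<in> space M. t < u x} \<partial>lborel)"
proof -
  interpret pair_sigma_finite lborel M ..
  let ?f = "\<lambda>t x. if 0 < t \<and> t < u x then ennreal (s * t powr (s - 1)) else 0"
  have meas: "case_prod ?f \<in> borel_measurable (lborel \<Otimes>\<^sub>M M)" by measurable
  have "(\<integral>\<^sup>+x. ennreal (u x powr s) \<partial>M) = (\<integral>\<^sup>+x. \<integral>\<^sup>+t. ?f t x \<partial>lborel \<partial>M)"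
    using nn_integral_powr[OF s u0] by simp
  also have "\<dots> = (\<integral>\<^sup>+t. \<integral>\<^sup>+x. ?f t x \<partial>M \<partial>lborel)" by (rule Fubini'[OF meas])
  also have "\<dots> = (\<integral>\<^sup>+t. indicator {0<..} t * ennreal (s * t powr (s - 1)) * emeasure M {x \<in> space M. t < u x} \<partial>lborel)"
  proof (rule nn_integral_cong)
    fix t :: real
    have "(\<integral>\<^sup>+x. ?f t x \<partial>M) = (\<integral>\<^sup>+x. (indicator {0<..} t * ennreal (s * t powr (s - 1))) * indicator {x \<in> space M. t < u x} x \<partial>M)"
      by (intro nn_integral_cong) (auto simp: indicator_def)
    also have "\<dots> = indicator {0<..} t * ennreal (s * t powr (s - 1)) * emeasure M {x \<in> space M. t < u x}"
      by (rule nn_integral_cmult_indicator) measurable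
    finally show "(\<integral>\<^sup>+x. ?f t x \<partial>M) = indicator {0<..} t * ennreal (s * t powr (s - 1)) * emeasure M {x \<in> space M. t < u x}" .
  qed
  finally show ?thesis .
qed

context kernel_space
begin

definition C_max :: real where "C_max = 2 * D ^ (dil + 4)"

lemma C_max_pos: "0 < C_max" unfolding C_max_def using D_ge_1 by simp

text \<open>The truncated integral of |f| is read as the mass of a superlevel set for the measure
  with density |f|; both terms on the right are then distribution functions, ready for the
  layer-cake formula.\<close>

lemma good_lambda_density:
  assumes f: "integrable M f" and t: "0 < t" and \<gamma>: "0 < \<gamma>" "\<gamma> * C_good \<le> 1"
  shows "emeasure M {x \<in> space M. t < \<bar>T f x\<bar> / 3} \<le>
    ennreal (C_lambda * \<gamma>) * emeasure M {x \<in> space M. t < \<bar>T f x\<bar>} +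
    ennreal (C_max / (\<gamma> * t)) * emeasure (density M (\<lambda>x. ennreal \<bar>f x\<bar>)) {x \<in> space M. t < 2 * \<bar>f x\<bar> / \<gamma>}"
proof -
  have [measurable]: "f \<in> borel_measurable M" using f by auto
  let ?S = "{x \<in> space M. t < 2 * \<bar>f x\<bar> / \<gamma>}"
  have S: "?S \<in> sets M" by measurable
  have S_eq: "?S = {y. \<gamma> * t / 2 < \<bar>f y\<bar>}" using \<gamma>(1) by (auto simp: space_M field_simps)
  have "emeasure (density M (\<lambda>x. ennreal \<bar>f x\<bar>)) ?S = (\<integral>\<^sup>+x. ennreal (indicator ?S x * \<bar>f x\<bar>) \<partial>M)"
    using S by (subst emeasure_density) (auto intro!: nn_integral_cong simp: indicator_def)
  also have "\<dots> = ennreal (LINT x:?S|M. \<bar>f x\<bar>)"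
    unfolding set_lebesgue_integral_def
    using integrable_mult_indicator[OF S integrable_abs[OF f]] by (subst nn_integral_eq_integral) auto
  finally have dens: "emeasure (density M (\<lambda>x. ennreal \<bar>f x\<bar>)) ?S = ennreal (LINT x:?S|M. \<bar>f x\<bar>)" .
  have "measure M (stop (big_avg dil f (\<gamma> * t))) \<le> C_max / (\<gamma> * t) * (LINT x:?S|M. \<bar>f x\<bar>)"
    unfolding S_eq C_max_def using weak_type_truncated[OF f, of "\<gamma> * t" dil] t \<gamma>(1) by (simp add: dil_def)
  then have "measure M {x. 3 * t < \<bar>T f x\<bar>} \<le>
      C_lambda * \<gamma> * measure M {x. t < \<bar>T f x\<bar>} + C_max / (\<gamma> * t) * (LINT x:?S|M. \<bar>f x\<bar>)"
    using good_lambda[OF f t \<gamma>] by linarith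
  then have "ennreal (measure M {x. 3 * t < \<bar>T f x\<bar>}) \<le>
      ennreal (C_lambda * \<gamma> * measure M {x. t < \<bar>T f x\<bar>} + C_max / (\<gamma> * t) * (LINT x:?S|M. \<bar>f x\<bar>))"
    by (rule ennreal_leI)
  also have "\<dots> = ennreal (C_lambda * \<gamma>) * ennreal (measure M {x. t < \<bar>T f x\<bar>}) +
      ennreal (C_max / (\<gamma> * t)) * ennreal (LINT x:?S|M. \<bar>f x\<bar>)"
  proof -
    have "0 \<le> (LINT x:?S|M. \<bar>f x\<bar>)" unfolding set_lebesgue_integral_def by (intro Bochner_Integration.integral_nonneg) auto
    then show ?thesis
      using C_lambda_pos C_max_pos \<gamma>(1) t by (intro ennreal_linear) auto
  qed
  finally have fin: "ennreal (measure M {x. 3 * t < \<bar>T f x\<bar>}) \<le> ennreal (C_lambda * \<gamma>) * ennreal (measure M {x. t < \<bar>T f x\<bar>}) +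
      ennreal (C_max / (\<gamma> * t)) * ennreal (LINT x:?S|M. \<bar>f x\<bar>)" .
  have eq: "{x \<in> space M. t < \<bar>T f x\<bar> / 3} = {x. 3 * t < \<bar>T f x\<bar>}" "{x \<in> space M. t < \<bar>T f x\<bar>} = {x. t < \<bar>T f x\<bar>}"
    by (auto simp: space_M)
  show ?thesis unfolding eq dens emeasure_eq_measure by (rule fin)
qed

text \<open>Comes from the layer-cake formula with exponent \<open>s - 1\<close> for the function
  \<open>2 * \<bar>f x\<bar> / \<gamma>\<close> and the measure with density |f|. For fixed
  \<open>\<gamma>\<close> the factor \<open>1 / (s - 1)\<close> is the only one unbounded as
  \<open>s\<close> tends to 1.\<close>

definition C_strong :: "real \<Rightarrow> real \<Rightarrow> real" where
  "C_strong \<gamma> s = s * C_max / (\<gamma> * (s - 1)) * (2 / \<gamma>) powr (s - 1)"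

text \<open>The integral to be bounded occurs on both sides and could be infinite. Cutting |T f| off
  at \<open>n\<close> makes it finite, since the space has finite measure, so that half of it can be
  absorbed; the resulting bound is independent of \<open>n\<close>.\<close>

lemma truncated_strong_type:
  assumes f: "integrable M f" and s: "1 < s" and fs: "integrable M (\<lambda>x. \<bar>f x\<bar> powr s)"
    and \<gamma>: "0 < \<gamma>" "\<gamma> * C_good \<le> 1" "C_lambda * \<gamma> * 3 powr s \<le> 1 / 2"
  shows "(\<integral>\<^sup>+x. ennreal (min \<bar>T f x\<bar> (real n) powr s) \<partial>M) \<le>
    ennreal (2 * 3 powr s * (C_strong \<gamma> s * (LINT x|M. \<bar>f x\<bar> powr s)))"
proof -
  have [measurable]: "f \<in> borel_measurable M" "T f \<in> borel_measurable M"
    using f T_measurable[OF f] by auto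
  let ?F = "\<lambda>x. \<bar>T f x\<bar>" and ?N = "density M (\<lambda>x. ennreal \<bar>f x\<bar>)"
  let ?J = "\<integral>\<^sup>+x. ennreal (min (?F x) (real n) powr s) \<partial>M"
  let ?c = "C_strong \<gamma> s * (LINT x|M. \<bar>f x\<bar> powr s)"
  let ?u = "\<lambda>x. 2 * \<bar>f x\<bar> / \<gamma>"
  let ?k = "s * C_max / (\<gamma> * (s - 1))"
  interpret N: finite_measure ?N
  proof (rule finite_measureI)
    have "emeasure ?N (space ?N) = (\<integral>\<^sup>+x. ennreal \<bar>f x\<bar> \<partial>M)"
      by (subst emeasure_density) (auto intro!: nn_integral_cong)
    also have "\<dots> = ennreal (LINT x|M. \<bar>f x\<bar>)" using f by (intro nn_integral_eq_integral) auto
    finally show "emeasure ?N (space ?N) \<noteq> \<infinity>" by simp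
  qed
  have k: "0 \<le> ?k" using s C_max_pos \<gamma>(1) by simp
  have c0: "0 \<le> ?c"
    unfolding C_strong_def using k by (intro mult_nonneg_nonneg) auto
  define wt where "wt t = indicator {0<..} t * ennreal (s * t powr (s - 1))" for t :: real
  have wt [measurable]: "wt \<in> borel_measurable borel" unfolding wt_def by measurable
  define a where "a t = emeasure M {x \<in> space M. t < min (?F x) (real n)}" for t
  have a [measurable]: "a \<in> borel_measurable borel" unfolding a_def by (rule level_measurable) measurable
  define b where "b t = emeasure ?N {x \<in> space ?N. t < ?u x}" for t
  have b [measurable]: "b \<in> borel_measurable borel" unfolding b_def by (rule N.level_measurable) measurable
  have J: "?J = (\<integral>\<^sup>+t. wt t * a t \<partial>lborel)"
    unfolding wt_def a_def using s by (intro layer_cake) auto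
  have tail: "(\<integral>\<^sup>+t. ennreal ?k * (indicator {0<..} t * ennreal ((s - 1) * t powr (s - 1 - 1)) * b t) \<partial>lborel) = ennreal ?c"
  proof -
    have "(\<integral>\<^sup>+t. ennreal ?k * (indicator {0<..} t * ennreal ((s - 1) * t powr (s - 1 - 1)) * b t) \<partial>lborel) =
      ennreal ?k * (\<integral>\<^sup>+t. indicator {0<..} t * ennreal ((s - 1) * t powr (s - 1 - 1)) * b t \<partial>lborel)"
      by (rule nn_integral_cmult) measurable
    also have "(\<integral>\<^sup>+t. indicator {0<..} t * ennreal ((s - 1) * t powr (s - 1 - 1)) * b t \<partial>lborel) =
      (\<integral>\<^sup>+x. ennreal (?u x powr (s - 1)) \<partial>?N)"
      unfolding b_def using s \<gamma>(1) by (intro N.layer_cake[symmetric]) auto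
    also have "\<dots> = (\<integral>\<^sup>+x. ennreal \<bar>f x\<bar> * ennreal (?u x powr (s - 1)) \<partial>M)"
      by (rule nn_integral_density) measurable
    also have "\<dots> = (\<integral>\<^sup>+x. ennreal ((2 / \<gamma>) powr (s - 1) * \<bar>f x\<bar> powr s) \<partial>M)"
    proof (rule nn_integral_cong)
      fix x
      have "\<bar>f x\<bar> * ?u x powr (s - 1) = (2 / \<gamma>) powr (s - 1) * \<bar>f x\<bar> powr s"
      proof (cases "f x = 0")
        case False
        have "?u x = (2 / \<gamma>) * \<bar>f x\<bar>" by simp
        then have "?u x powr (s - 1) = (2 / \<gamma>) powr (s - 1) * \<bar>f x\<bar> powr (s - 1)"
          using \<gamma>(1) by (simp only: powr_mult)
        moreover have "\<bar>f x\<bar> powr s = \<bar>f x\<bar> * \<bar>f x\<bar> powr (s - 1)"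
          using False powr_add[of "\<bar>f x\<bar>" 1 "s - 1"] by simp
        ultimately show ?thesis by (simp only: mult_ac)
      qed simp
      then show "ennreal \<bar>f x\<bar> * ennreal (?u x powr (s - 1)) = ennreal ((2 / \<gamma>) powr (s - 1) * \<bar>f x\<bar> powr s)"
        by (subst ennreal_mult[symmetric]) auto
    qed
    also have "\<dots> = ennreal (LINT x|M. (2 / \<gamma>) powr (s - 1) * \<bar>f x\<bar> powr s)"
      using fs by (intro nn_integral_eq_integral) auto
    also have "ennreal ?k * \<dots> = ennreal ?c"
      unfolding C_strong_def using k by (subst ennreal_mult[symmetric]) (auto simp: mult_ac)
    finally show ?thesis .
  qed
  have "ennreal (1 / 3 powr s) * ?J = (\<integral>\<^sup>+x. ennreal (1 / 3 powr s) * ennreal (min (?F x) (real n) powr s) \<partial>M)"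
    by (rule nn_integral_cmult[symmetric]) measurable
  also have "\<dots> \<le> (\<integral>\<^sup>+x. ennreal (min (?F x / 3) (real n) powr s) \<partial>M)"
  proof (rule nn_integral_mono)
    fix x
    have "1 / 3 powr s * min (?F x) (real n) powr s = (min (?F x) (real n) / 3) powr s"
      by (simp add: powr_divide)
    also have "\<dots> \<le> min (?F x / 3) (real n) powr s" using s by (intro powr_mono2) auto
    finally show "ennreal (1 / 3 powr s) * ennreal (min (?F x) (real n) powr s) \<le> ennreal (min (?F x / 3) (real n) powr s)"
      by (subst ennreal_mult[symmetric]) (auto intro: ennreal_leI)
  qed
  also have "\<dots> = (\<integral>\<^sup>+t. wt t * emeasure M {x \<in> space M. t < min (?F x / 3) (real n)} \<partial>lborel)"
    unfolding wt_def using s by (intro layer_cake) auto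
  also have "\<dots> \<le> (\<integral>\<^sup>+t. ennreal (C_lambda * \<gamma>) * (wt t * a t) +
      ennreal ?k * (indicator {0<..} t * ennreal ((s - 1) * t powr (s - 1 - 1)) * b t) \<partial>lborel)"
  proof (rule nn_integral_mono)
    fix t :: real
    show "wt t * emeasure M {x \<in> space M. t < min (?F x / 3) (real n)} \<le> ennreal (C_lambda * \<gamma>) * (wt t * a t) +
      ennreal ?k * (indicator {0<..} t * ennreal ((s - 1) * t powr (s - 1 - 1)) * b t)"
    proof (cases "0 < t \<and> t < real n")
      case True
      have "emeasure M {x \<in> space M. t < min (?F x / 3) (real n)} = emeasure M {x \<in> space M. t < ?F x / 3}"
        using True by (intro arg_cong[where f = "emeasure M"]) auto
      also have "\<dots> \<le> ennreal (C_lambda * \<gamma>) * emeasure M {x \<in> space M. t < ?F x} +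
        ennreal (C_max / (\<gamma> * t)) * emeasure ?N {x \<in> space M. t < ?u x}"
        using True by (intro good_lambda_density f \<gamma>) auto
      also have "\<dots> = ennreal (C_lambda * \<gamma>) * a t + ennreal (C_max / (\<gamma> * t)) * b t"
        using True by (simp add: a_def b_def)
      finally have "emeasure M {x \<in> space M. t < min (?F x / 3) (real n)} \<le>
        ennreal (C_lambda * \<gamma>) * a t + ennreal (C_max / (\<gamma> * t)) * b t" .
      then have le: "wt t * emeasure M {x \<in> space M. t < min (?F x / 3) (real n)} \<le>
        wt t * (ennreal (C_lambda * \<gamma>) * a t + ennreal (C_max / (\<gamma> * t)) * b t)"
        by (rule mult_left_mono) simp
      have "t powr (s - 1) = t powr (s - 1 - 1) * t" using True powr_add[of t "s - 1 - 1" 1] by simp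
      then have "s * t powr (s - 1) * (C_max / (\<gamma> * t)) = ?k * ((s - 1) * t powr (s - 1 - 1))"
        using True s \<gamma>(1) by (simp add: field_simps)
      then have "wt t * ennreal (C_max / (\<gamma> * t)) = ennreal ?k * ennreal ((s - 1) * t powr (s - 1 - 1))"
        unfolding wt_def using True s \<gamma>(1) C_max_pos by (simp add: ennreal_mult[symmetric])
      then have "wt t * (ennreal (C_max / (\<gamma> * t)) * b t) =
        ennreal ?k * (indicator {0<..} t * ennreal ((s - 1) * t powr (s - 1 - 1)) * b t)"
        using True by (simp add: mult.assoc[symmetric])
      then show ?thesis using le by (simp add: distrib_left mult_ac)
    next
      case False
      then have "\<not> 0 < t \<or> \<not> t < real n" by blast
      then have "wt t * emeasure M {x \<in> space M. t < min (?F x / 3) (real n)} = 0"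
      proof
        assume "\<not> 0 < t" then show ?thesis by (simp add: wt_def)
      next
        assume "\<not> t < real n"
        then have "{x \<in> space M. t < min (?F x / 3) (real n)} = {}" by auto
        then show ?thesis by (simp only: emeasure_empty mult_zero_right)
      qed
      then show ?thesis by (simp only: zero_le)
    qed
  qed
  also have "\<dots> = (\<integral>\<^sup>+t. ennreal (C_lambda * \<gamma>) * (wt t * a t) \<partial>lborel) +
      (\<integral>\<^sup>+t. ennreal ?k * (indicator {0<..} t * ennreal ((s - 1) * t powr (s - 1 - 1)) * b t) \<partial>lborel)"
    by (rule nn_integral_add) measurable
  also have "(\<integral>\<^sup>+t. ennreal (C_lambda * \<gamma>) * (wt t * a t) \<partial>lborel) = ennreal (C_lambda * \<gamma>) * ?J"
    unfolding J by (rule nn_integral_cmult) measurable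
  also note tail
  finally have main: "ennreal (1 / 3 powr s) * ?J \<le> ennreal (C_lambda * \<gamma>) * ?J + ennreal ?c" .
  have "?J \<le> (\<integral>\<^sup>+x. ennreal (real n powr s) \<partial>M)"
    using s by (intro nn_integral_mono ennreal_leI powr_mono2) auto
  also have "\<dots> < \<infinity>" by (simp add: emeasure_eq_measure ennreal_mult[symmetric] measure_nonneg)
  finally obtain j where j: "?J = ennreal j" "0 \<le> j"
    by (cases "?J") auto
  have "1 / 3 powr s * j \<le> C_lambda * \<gamma> * j + ?c"
  proof -
    have "ennreal (1 / 3 powr s * j) = ennreal (1 / 3 powr s) * ?J"
      unfolding j(1) using j(2) by (intro ennreal_mult) auto
    moreover have "ennreal (C_lambda * \<gamma> * j + 1 * ?c) = ennreal (C_lambda * \<gamma>) * ?J + ennreal 1 * ennreal ?c"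
      unfolding j(1) using C_lambda_pos \<gamma>(1) c0 j(2) by (intro ennreal_linear) auto
    ultimately have "ennreal (1 / 3 powr s * j) \<le> ennreal (C_lambda * \<gamma> * j + ?c)"
      using main by (simp only: ennreal_1 mult_1)
    then show ?thesis using C_lambda_pos \<gamma>(1) c0 j(2) by (subst (asm) ennreal_le_iff) auto
  qed
  then have "3 powr s * (1 / 3 powr s * j) \<le> 3 powr s * (C_lambda * \<gamma> * j + ?c)"
    by (rule mult_left_mono) simp
  then have "j \<le> (C_lambda * \<gamma> * 3 powr s) * j + 3 powr s * ?c" by (simp add: algebra_simps)
  also have "\<dots> \<le> 1 / 2 * j + 3 powr s * ?c" using \<gamma>(3) j(2) by (intro add_right_mono mult_right_mono) auto
  finally have "j \<le> 2 * 3 powr s * ?c" by simp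
  then show ?thesis unfolding j(1) by (rule ennreal_leI)
qed

lemma strong_type_nn:
  assumes f: "integrable M f" and s: "1 < s" and fs: "integrable M (\<lambda>x. \<bar>f x\<bar> powr s)"
    and \<gamma>: "0 < \<gamma>" "\<gamma> * C_good \<le> 1" "C_lambda * \<gamma> * 3 powr s \<le> 1 / 2"
  shows "(\<integral>\<^sup>+x. ennreal (\<bar>T f x\<bar> powr s) \<partial>M) \<le>
    ennreal (2 * 3 powr s * (C_strong \<gamma> s * (LINT x|M. \<bar>f x\<bar> powr s)))"
proof -
  have [measurable]: "T f \<in> borel_measurable M" using T_measurable[OF f] .
  let ?g = "\<lambda>n x. ennreal (min \<bar>T f x\<bar> (real n) powr s)"
  have "(\<integral>\<^sup>+x. ennreal (\<bar>T f x\<bar> powr s) \<partial>M) \<le> (\<integral>\<^sup>+x. (SUP n. ?g n x) \<partial>M)"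
  proof (rule nn_integral_mono)
    fix x
    obtain n where "\<bar>T f x\<bar> \<le> real n" using real_arch_simple by blast
    then have "ennreal (\<bar>T f x\<bar> powr s) = ?g n x" by (simp add: min_absorb1)
    then show "ennreal (\<bar>T f x\<bar> powr s) \<le> (SUP n. ?g n x)" by (metis SUP_upper UNIV_I)
  qed
  also have "\<dots> = (SUP n. \<integral>\<^sup>+x. ?g n x \<partial>M)"
  proof (rule nn_integral_monotone_convergence_SUP)
    show "incseq ?g" using s by (auto simp: incseq_def le_fun_def intro!: ennreal_leI powr_mono2)
  qed measurable
  also have "\<dots> \<le> ennreal (2 * 3 powr s * (C_strong \<gamma> s * (LINT x|M. \<bar>f x\<bar> powr s)))"
    by (intro SUP_least truncated_strong_type assms)
  finally show ?thesis .
qed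

lemma strong_type:
  assumes s0: "1 < s0"
  shows "\<exists>C>0. \<forall>s f. s0 \<le> s \<longrightarrow> s \<le> p \<longrightarrow> f \<in> borel_measurable M \<longrightarrow> integrable M (\<lambda>x. \<bar>f x\<bar> powr s) \<longrightarrow>
    integrable M (\<lambda>x. \<bar>T f x\<bar> powr s) \<and> (LINT x|M. \<bar>T f x\<bar> powr s) \<le> C * (LINT x|M. \<bar>f x\<bar> powr s)"
proof -
  \<comment> \<open>One \<open>\<gamma>\<close> serves every exponent up to \<open>p\<close>,
    because \<open>3 powr s\<close> increases with \<open>s\<close>; this is the source of
    uniformity.\<close>
  define \<gamma> where "\<gamma> = min 1 (min (1 / C_good) (1 / (2 * C_lambda * 3 powr p)))"
  have \<gamma>: "0 < \<gamma>" "\<gamma> \<le> 1" "\<gamma> * C_good \<le> 1" "C_lambda * \<gamma> * 3 powr p \<le> 1 / 2"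
  proof -
    show "0 < \<gamma>" "\<gamma> \<le> 1" using C_good_pos C_lambda_pos by (auto simp: \<gamma>_def)
    have "\<gamma> \<le> 1 / C_good" "\<gamma> \<le> 1 / (2 * C_lambda * 3 powr p)" by (auto simp: \<gamma>_def)
    then show "\<gamma> * C_good \<le> 1" "C_lambda * \<gamma> * 3 powr p \<le> 1 / 2"
      using C_good_pos C_lambda_pos by (auto simp: field_simps)
  qed
  \<comment> \<open>With \<open>\<bar>p\<bar>\<close> instead of \<open>p\<close> the constant is
    positive whatever \<open>p\<close> is.\<close>
  define C where "C = 2 * 3 powr \<bar>p\<bar> * ((\<bar>p\<bar> + 1) * C_max / (\<gamma> * (s0 - 1)) * (2 / \<gamma>) powr \<bar>p\<bar>)"
  have "0 < C" unfolding C_def using C_max_pos \<gamma>(1) s0 by (intro mult_pos_pos divide_pos_pos add_nonneg_pos) auto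
  moreover have "integrable M (\<lambda>x. \<bar>T f x\<bar> powr s) \<and> (LINT x|M. \<bar>T f x\<bar> powr s) \<le> C * (LINT x|M. \<bar>f x\<bar> powr s)"
    if s: "s0 \<le> s" "s \<le> p" and f: "f \<in> borel_measurable M" "integrable M (\<lambda>x. \<bar>f x\<bar> powr s)" for s f
  proof -
    have s1: "1 < s" using s s0 by simp
    have fi: "integrable M f" using s1 by (intro integrable_of_powr[OF f(1) _ f(2)]) auto
    have "C_lambda * \<gamma> * 3 powr s \<le> C_lambda * \<gamma> * 3 powr p"
      using C_lambda_pos \<gamma>(1) s by (intro mult_left_mono powr_mono) auto
    then have \<gamma>s: "C_lambda * \<gamma> * 3 powr s \<le> 1 / 2" using \<gamma>(4) by linarith
    let ?c = "2 * 3 powr s * (C_strong \<gamma> s * (LINT x|M. \<bar>f x\<bar> powr s))"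
    have nn: "(\<integral>\<^sup>+x. ennreal (\<bar>T f x\<bar> powr s) \<partial>M) \<le> ennreal ?c"
      by (rule strong_type_nn[OF fi s1 f(2) \<gamma>(1,3) \<gamma>s])
    have [measurable]: "T f \<in> borel_measurable M" using T_measurable[OF fi] .
    have int: "integrable M (\<lambda>x. \<bar>T f x\<bar> powr s)"
    proof (rule integrableI_bounded)
      have "(\<integral>\<^sup>+x. ennreal (norm (\<bar>T f x\<bar> powr s)) \<partial>M) \<le> ennreal ?c" using nn by simp
      also have "\<dots> < \<infinity>" by simp
      finally show "(\<integral>\<^sup>+x. ennreal (norm (\<bar>T f x\<bar> powr s)) \<partial>M) < \<infinity>" .
    qed measurable
    have I0: "0 \<le> (LINT x|M. \<bar>f x\<bar> powr s)" by (intro Bochner_Integration.integral_nonneg) auto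
    have cs0: "0 \<le> C_strong \<gamma> s"
      unfolding C_strong_def using s1 \<gamma>(1) C_max_pos by (intro mult_nonneg_nonneg divide_nonneg_nonneg) auto
    have cs: "C_strong \<gamma> s \<le> (\<bar>p\<bar> + 1) * C_max / (\<gamma> * (s0 - 1)) * (2 / \<gamma>) powr \<bar>p\<bar>"
      unfolding C_strong_def
    proof (rule mult_mono)
      show "s * C_max / (\<gamma> * (s - 1)) \<le> (\<bar>p\<bar> + 1) * C_max / (\<gamma> * (s0 - 1))"
        using s s0 \<gamma>(1) C_max_pos by (intro frac_le mult_mono mult_pos_pos) auto
      show "(2 / \<gamma>) powr (s - 1) \<le> (2 / \<gamma>) powr \<bar>p\<bar>"
        using s \<gamma>(1,2) by (intro powr_mono) (auto simp: le_divide_eq)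
    qed (use s0 \<gamma>(1) C_max_pos in auto)
    have "2 * 3 powr s * C_strong \<gamma> s \<le> C"
      unfolding C_def using s cs cs0 by (intro mult_mono cs powr_mono) auto
    then have "?c \<le> C * (LINT x|M. \<bar>f x\<bar> powr s)"
      using I0 mult_right_mono by (fastforce simp: mult.assoc)
    moreover have "(LINT x|M. \<bar>T f x\<bar> powr s) \<le> ?c"
    proof -
      have "ennreal (LINT x|M. \<bar>T f x\<bar> powr s) \<le> ennreal ?c"
        using nn nn_integral_eq_integral[OF int] by simp
      moreover have "0 \<le> ?c" using cs0 I0 by simp
      ultimately show ?thesis by (simp only: ennreal_le_iff)
    qed
    ultimately show ?thesis using int by simp
  qed
  ultimately show ?thesis by blast
qed

end

section \<open>Morrey bounds\<close>

text \<open>Split at height \<open>c\<close>: below it the first term suffices, above it the second.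
  Integrated, with a suitable \<open>c\<close>, this is Hoelder's inequality up to a factor
  2.\<close>

lemma powr_le_split:
  fixes u c a s :: real
  assumes "0 < c" "0 \<le> u" "0 < a" "a \<le> s"
  shows "u powr a \<le> c powr a + c powr (a - s) * u powr s"
proof (cases "u \<le> c")
  case True
  then have "u powr a \<le> c powr a" using assms by (intro powr_mono2) auto
  then show ?thesis by (simp add: add_increasing2)
next
  case False
  then have "u powr a = u powr (a - s) * u powr s" using assms by (simp add: powr_add[symmetric])
  also have "\<dots> \<le> c powr (a - s) * u powr s"
    using False assms by (intro mult_right_mono powr_mono2') auto
  finally show ?thesis by (simp add: add_increasing)
qed

lemma powr_add_le:
  fixes u v s :: real
  assumes "0 \<le> u" "0 \<le> v" "0 \<le> s"
  shows "(u + v) powr s \<le> 2 powr s * (u powr s + v powr s)"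
proof -
  have "(u + v) powr s \<le> (2 * max u v) powr s" using assms by (intro powr_mono2) auto
  also have "\<dots> = 2 powr s * max u v powr s" using assms by (intro powr_mult)
  also have "max u v powr s \<le> u powr s + v powr s" by (auto simp: max_def)
  finally show ?thesis by simp
qed

text \<open>Growth by a factor is known only over three steps, so three interleaved geometric series
  are summed, each dominated by its last term; hence the 3.\<close>

lemma geometric_steps:
  fixes v :: "nat \<Rightarrow> real"
  assumes "\<And>n. 0 \<le> v n" "\<And>n. v n \<le> v (Suc n)" "\<And>n. v n \<le> \<theta> * v (n + 3)" "0 \<le> \<theta>" "\<theta> < 1"
  shows "(\<Sum>n\<le>k. v n) \<le> 3 / (1 - \<theta>) * v k"
proof (induction k rule: less_induct)
  case (less k)
  have mono: "v i \<le> v j" if "i \<le> j" for i j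
    using that assms(2) by (rule lift_Suc_mono_le[rotated])
  have 3: "3 * v k \<le> 3 / (1 - \<theta>) * v k"
    using assms by (intro mult_right_mono) (auto simp: le_divide_eq)
  show ?case
  proof (cases "k < 3")
    case True
    have "(\<Sum>n\<le>k. v n) \<le> (\<Sum>n\<le>k. v k)" by (intro sum_mono mono) auto
    also have "\<dots> = real (Suc k) * v k" by simp
    also have "\<dots> \<le> 3 * v k" using True assms(1) by (intro mult_right_mono) auto
    finally show ?thesis using 3 by simp
  next
    case False
    then obtain i where "k = 3 + i" using le_Suc_ex[of 3 k] by auto
    then have i: "k = Suc (Suc (Suc i))" by simp
    have "(\<Sum>n\<le>k. v n) = (\<Sum>n\<le>i. v n) + v (i + 1) + v (i + 2) + v k" by (simp add: i)
    also have "\<dots> \<le> 3 / (1 - \<theta>) * v i + v k + v k + v k"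
      using less[of i] i by (intro add_mono mono) auto
    also have "\<dots> \<le> 3 / (1 - \<theta>) * (\<theta> * v k) + 3 * v k"
    proof -
      have "3 / (1 - \<theta>) * v i \<le> 3 / (1 - \<theta>) * (\<theta> * v k)"
        using assms(3)[of i] assms(5) i by (intro mult_left_mono) (auto simp: numeral_3_eq_3)
      then show ?thesis by simp
    qed
    also have "\<dots> = 3 / (1 - \<theta>) * v k" using assms(5) by (simp add: field_simps)
    finally show ?thesis .
  qed
qed

context finite_measure
begin

lemma morrey_holder:
  fixes f :: "'a \<Rightarrow> real"
  assumes S: "S \<in> sets M" "0 < measure M S" and f: "f \<in> borel_measurable M"
    and int: "set_integrable M S (\<lambda>y. \<bar>f y\<bar> powr s)" and a: "0 < a" "a \<le> s" and N: "0 < N"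
    and le: "(LINT y:S|M. \<bar>f y\<bar> powr s) \<le> N * measure M S powr \<kappa>"
  shows "set_integrable M S (\<lambda>y. \<bar>f y\<bar> powr a)"
    and "(LINT y:S|M. \<bar>f y\<bar> powr a) \<le> 2 * (N * measure M S powr (\<kappa> - 1)) powr (a / s) * measure M S"
proof -
  let ?m = "measure M S"
  \<comment> \<open>\<open>c powr s\<close> is the bound that the hypothesis gives for the mean of
    \<open>\<bar>f y\<bar> powr s\<close> over \<open>S\<close>; at this height both terms of
    \<open>powr_le_split\<close> have the same bound.\<close>
  define c where "c = (N * ?m powr (\<kappa> - 1)) powr (1 / s)"
  have c: "0 < c" using S(2) N by (simp add: c_def)
  have const: "set_integrable M S (\<lambda>_. r :: real)" for r
    using S(1) by (simp add: set_integrable_def emeasure_eq_measure)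
  have bd: "set_integrable M S (\<lambda>y. c powr a + c powr (a - s) * \<bar>f y\<bar> powr s)"
    by (intro set_integral_add(1) const set_integrable_mult_right int)
  have pt: "\<bar>f y\<bar> powr a \<le> c powr a + c powr (a - s) * \<bar>f y\<bar> powr s" for y
    using c a by (intro powr_le_split) auto
  show 1: "set_integrable M S (\<lambda>y. \<bar>f y\<bar> powr a)"
  proof (rule set_integrable_bound[OF bd])
    show "set_borel_measurable M S (\<lambda>y. \<bar>f y\<bar> powr a)"
      using f S(1) unfolding set_borel_measurable_def by measurable
    show "AE y in M. y \<in> S \<longrightarrow> norm (\<bar>f y\<bar> powr a) \<le> norm (c powr a + c powr (a - s) * \<bar>f y\<bar> powr s)"
    proof (intro AE_I2 impI)
      fix y show "norm (\<bar>f y\<bar> powr a) \<le> norm (c powr a + c powr (a - s) * \<bar>f y\<bar> powr s)"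
        using pt[of y] by simp
    qed
  qed
  have "(LINT y:S|M. \<bar>f y\<bar> powr a) \<le> (LINT y:S|M. c powr a + c powr (a - s) * \<bar>f y\<bar> powr s)"
    using 1 bd pt by (intro set_integral_mono) auto
  also have "\<dots> = c powr a * ?m + c powr (a - s) * (LINT y:S|M. \<bar>f y\<bar> powr s)"
    using S(1) int const by (subst set_integral_add(2)) (auto simp: set_lebesgue_integral_def emeasure_eq_measure)
  also have "\<dots> \<le> c powr a * ?m + c powr (a - s) * (N * ?m powr \<kappa>)"
    using le by (intro add_left_mono mult_left_mono) auto
  also have "N * ?m powr \<kappa> = c powr s * ?m"
  proof -
    have "c powr s = N * ?m powr (\<kappa> - 1)" using N S(2) a by (simp add: c_def powr_powr)
    moreover have "?m powr \<kappa> = ?m powr (\<kappa> - 1) * ?m" using S(2) by (simp add: powr_diff)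
    ultimately show ?thesis by simp
  qed
  also have "c powr (a - s) * (c powr s * ?m) = c powr a * ?m"
    using c by (simp add: powr_diff)
  also have "c powr a * ?m + c powr a * ?m = 2 * c powr a * ?m" by simp
  also have "c powr a = (N * ?m powr (\<kappa> - 1)) powr (a / s)" by (simp add: c_def powr_powr)
  finally show "(LINT y:S|M. \<bar>f y\<bar> powr a) \<le> 2 * (N * ?m powr (\<kappa> - 1)) powr (a / s) * ?m" .
qed

end

locale annular_kernel_space = kernel_space M E D \<pi> \<rho> K R \<delta> A B q w
  for M :: "'a measure" and E D \<pi> \<rho> K R \<delta> A B q w +
  assumes annulus: "1 \<le> k \<Longrightarrow> \<exists>z. E k x z \<and> \<not> E (Suc k) x z"
begin

definition \<tau> :: real where "\<tau> = 1 - 1 / D ^ 4"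

text \<open>The annulus supplies a point \<open>z\<close> whose ball of scale \<open>k + 3\<close>
  lies in \<open>U k x\<close> and misses the ball of that scale around \<open>x\<close>; it carries
  at least the fraction \<open>1 / D ^ 4\<close> of the measure.\<close>

lemma reverse_doubling: "measure M (U (k + 3) x) \<le> \<tau> * measure M (U k x)"
proof -
  obtain z where z: "E (k + 1) x z" "\<not> E (k + 2) x z" using annulus[of "k + 1" x] by auto
  have "\<not> (E (k + 3) x v \<and> E (k + 3) z v)" for v
    using z(2) chain2[of "k + 3" x v "k + 3" z "k + 2"] by (auto simp: near_def)
  then have disj: "U (k + 3) x \<inter> U (k + 3) z = {}" by auto
  have sub: "U (k + 3) z \<subseteq> U k x" using chain2[OF E_near[OF z(1)] E_near, of "k + 3" _ k] by auto
  have "measure M (U k x) \<le> D ^ 4 * measure M (U (k + 3) z)"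
    by (rule U_near_doubling[OF E_near[OF z(1)]]) auto
  then have "1 / D ^ 4 * measure M (U k x) \<le> measure M (U (k + 3) z)"
    using D_ge_1 by (simp add: divide_le_eq mult.commute)
  moreover have "measure M (U (k + 3) x) + measure M (U (k + 3) z) = measure M (U (k + 3) x \<union> U (k + 3) z)"
    using disj by (intro finite_measure_Union[symmetric]) auto
  moreover have "measure M (U (k + 3) x \<union> U (k + 3) z) \<le> measure M (U k x)"
    using sub U_mono[of k "k + 3" x] by (intro m_mono) auto
  ultimately show ?thesis by (simp add: \<tau>_def left_diff_distrib)
qed

lemma \<tau>: "0 < \<tau>" "\<tau> < 1"
proof -
  have "0 < \<tau> * measure M (U 0 undefined)" using reverse_doubling[of 0 undefined] E_pos[of 3 undefined] by simp
  then show "0 < \<tau>" using E_pos[of 0 undefined] by (simp add: zero_less_mult_iff)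
  show "\<tau> < 1" using D_ge_1 by (simp add: \<tau>_def)
qed

lemma measure_powr_sum:
  assumes "0 < \<beta>0" "\<beta>0 \<le> \<beta>"
  shows "(\<Sum>n\<le>k. measure M (U n x) powr (- \<beta>)) \<le> 3 / (1 - \<tau> powr \<beta>0) * measure M (U k x) powr (- \<beta>)"
proof (rule geometric_steps)
  fix n
  show "measure M (U n x) powr (- \<beta>) \<le> measure M (U (Suc n) x) powr (- \<beta>)"
    using assms E_pos[of "Suc n" x] by (intro powr_mono2' m_mono U_mono) auto
  have le: "measure M (U (n + 3) x) / \<tau> \<le> measure M (U n x)"
    using reverse_doubling[of n x] \<tau> by (simp add: divide_le_eq mult.commute)
  have pos: "0 < measure M (U (n + 3) x)" by (rule E_pos)
  have "measure M (U n x) powr (- \<beta>) \<le> (measure M (U (n + 3) x) / \<tau>) powr (- \<beta>)"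
    using assms le pos \<tau> by (intro powr_mono2') auto
  also have "\<dots> = \<tau> powr \<beta> * measure M (U (n + 3) x) powr (- \<beta>)"
    using pos \<tau> by (simp add: powr_divide powr_minus field_simps)
  also have "\<dots> \<le> \<tau> powr \<beta>0 * measure M (U (n + 3) x) powr (- \<beta>)"
    using assms \<tau> by (intro mult_right_mono powr_mono') auto
  finally show "measure M (U n x) powr (- \<beta>) \<le> \<tau> powr \<beta>0 * measure M (U (n + 3) x) powr (- \<beta>)" .
next
  show "\<tau> powr \<beta>0 < 1" using powr_less_mono2[of \<beta>0 \<tau> 1] assms \<tau> by simp
qed auto

text \<open>Outside the enlarged ball, the shell of \<open>y\<close> around \<open>x0\<close>
  determines the size of the kernel at \<open>x\<close>; \<open>D ^ 3\<close> pays for the change of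
  centre and of scale from \<open>U (n + 1) x\<close> to \<open>U (n - 1) x0\<close>.\<close>

lemma far_part_le:
  assumes f: "integrable M f" and x: "E k x0 x"
  shows "\<bar>LINT y:- U (k - dil) x0|M. K x y * f y\<bar> \<le>
    A * D ^ 3 * (\<Sum>n<k. 1 / measure M (U n x0) * (LINT y:U n x0|M. \<bar>f y\<bar>))"
proof -
  let ?N = "k - dil"
  let ?S = "- U ?N x0"
  have S [measurable]: "?S \<in> sets M"
    using sets.compl_sets[OF U_sets[of ?N x0]] by (simp add: space_M Compl_eq_Diff_UNIV)
  have x': "E (k - 1) x0 x" using x by (rule E_mono[rotated]) simp
  have i1: "set_integrable M ?S (\<lambda>y. K x y * f y)"
    using far_from_cube[OF x'] by (intro K_integrable[OF f S, of "Suc ?N"]) auto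
  let ?c = "\<lambda>n. A * D ^ 3 / measure M (U n x0)"
  have fi: "integrable M (\<lambda>y. indicator (U j x0) y * \<bar>f y\<bar>)" for j
    using integrable_mult_indicator[OF U_sets integrable_abs[OF f], of j x0] by simp
  have c0: "0 \<le> ?c n" for n using A_pos D_ge_1 by simp
  have "\<bar>LINT y:?S|M. K x y * f y\<bar> \<le> (LINT y:?S|M. \<bar>K x y * f y\<bar>)" by (rule set_integral_abs_le)
  also have "\<dots> \<le> (LINT y|M. (\<Sum>n<k. ?c n * (indicator (U n x0) y * \<bar>f y\<bar>)))"
    unfolding set_lebesgue_integral_def
  proof (rule integral_mono)
    show "integrable M (\<lambda>y. indicator ?S y *\<^sub>R \<bar>K x y * f y\<bar>)"
      using set_integrable_abs[OF i1] by (simp add: set_integrable_def)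
    show "integrable M (\<lambda>y. \<Sum>n<k. ?c n * (indicator (U n x0) y * \<bar>f y\<bar>))"
      by (intro Bochner_Integration.integrable_sum integrable_mult_right fi)
    fix y
    have nonneg: "0 \<le> ?c n * (indicator (U n x0) y * \<bar>f y\<bar>)" for n
      using c0[of n] by (intro mult_nonneg_nonneg) auto
    show "indicator ?S y *\<^sub>R \<bar>K x y * f y\<bar> \<le> (\<Sum>n<k. ?c n * (indicator (U n x0) y * \<bar>f y\<bar>))"
    proof (cases "y \<in> ?S")
      case True
      then have "\<not> E ?N x0 y" by simp
      then obtain n where n: "1 \<le> n" "n \<le> ?N" "E (n - 1) x0 y" "\<not> E n x0 y" by (rule shell)
      have nk: "n + 2 \<le> k" using n by (auto simp: dil_def)
      have "\<not> E (n + 1) x y"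
      proof
        assume "E (n + 1) x y"
        then have "E n x0 y" using nk by (intro chain2[OF E_near[OF x] E_near]) auto
        with n(4) show False by simp
      qed
      then have "\<bar>K x y * f y\<bar> \<le> A / measure M (U (n + 1) x) * \<bar>f y\<bar>" by (rule K_size_mult)
      also have "\<dots> \<le> ?c (n - 1) * \<bar>f y\<bar>"
      proof (rule mult_right_mono)
        have "measure M (U (n - 1) x0) \<le> D ^ 3 * measure M (U (n + 1) x)"
          using nk n by (intro U_near_doubling[OF E_near[OF x]]) auto
        then have "A * measure M (U (n - 1) x0) \<le> A * (D ^ 3 * measure M (U (n + 1) x))"
          using A_pos by (intro mult_left_mono) auto
        then show "A / measure M (U (n + 1) x) \<le> ?c (n - 1)"
          using E_pos[of "n - 1" x0] E_pos[of "n + 1" x] by (simp add: field_simps)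
      qed simp
      also have "\<dots> = ?c (n - 1) * (indicator (U (n - 1) x0) y * \<bar>f y\<bar>)" using n(3) by simp
      also have "\<dots> \<le> (\<Sum>n<k. ?c n * (indicator (U n x0) y * \<bar>f y\<bar>))"
        using nk n(1) by (intro member_le_sum nonneg) auto
      finally show ?thesis using True by simp
    next
      case False
      then show ?thesis using nonneg by (simp add: sum_nonneg)
    qed
  qed
  also have "\<dots> = (\<Sum>n<k. ?c n * (LINT y:U n x0|M. \<bar>f y\<bar>))"
    by (subst Bochner_Integration.integral_sum, intro integrable_mult_right fi)
      (simp add: set_lebesgue_integral_def)
  also have "\<dots> = A * D ^ 3 * (\<Sum>n<k. 1 / measure M (U n x0) * (LINT y:U n x0|M. \<bar>f y\<bar>))"
    unfolding sum_distrib_left by (intro sum.cong refl) simp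
  finally show ?thesis .
qed

text \<open>The bound \<open>N\<close> enters linearly and \<open>C\<close> depends neither on
  \<open>s\<close> nor on \<open>N\<close>, so a weight that varies with the exponent can be put
  into \<open>N\<close> without harm.\<close>

lemma morrey_bound:
  assumes s0: "1 < s0" "s0 \<le> p" and \<kappa>: "0 \<le> \<kappa>" "\<kappa> < 1"
  shows "\<exists>C>0. \<forall>s f N. s0 \<le> s \<longrightarrow> s \<le> p \<longrightarrow> f \<in> borel_measurable M \<longrightarrow> integrable M (\<lambda>x. \<bar>f x\<bar> powr s) \<longrightarrow>
    0 < N \<longrightarrow> (\<forall>k x. (LINT y:U k x|M. \<bar>f y\<bar> powr s) \<le> N * measure M (U k x) powr \<kappa>) \<longrightarrow>
    integrable M (\<lambda>x. \<bar>T f x\<bar> powr s) \<and>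
    (\<forall>k x. (LINT y:U k x|M. \<bar>T f y\<bar> powr s) \<le> C * N * measure M (U k x) powr \<kappa>)"
proof -
  obtain Cs where Cs: "0 < Cs" "\<And>s f. s0 \<le> s \<Longrightarrow> s \<le> p \<Longrightarrow> f \<in> borel_measurable M \<Longrightarrow>
      integrable M (\<lambda>x. \<bar>f x\<bar> powr s) \<Longrightarrow> integrable M (\<lambda>x. \<bar>T f x\<bar> powr s) \<and>
      (LINT x|M. \<bar>T f x\<bar> powr s) \<le> Cs * (LINT x|M. \<bar>f x\<bar> powr s)"
    using strong_type[OF s0(1), of p] by blast
  \<comment> \<open>The averages of |f| over \<open>U n x0\<close> are bounded by a multiple of the
    measure to the power \<open>- (1 - \<kappa>) / s\<close>; \<open>\<beta>0\<close> is the least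
    of these rates for \<open>s \<le> p\<close> and controls all the geometric sums at once.\<close>
  define \<beta>0 where "\<beta>0 = (1 - \<kappa>) / p"
  have \<beta>0: "0 < \<beta>0" using s0 \<kappa> by (simp add: \<beta>0_def)
  \<comment> \<open>The maximum with 1 allows \<open>L powr s\<close> to be replaced by
    \<open>L powr p\<close>.\<close>
  define L where "L = max 1 (A * D ^ 3 * (2 * (3 / (1 - \<tau> powr \<beta>0))))"
  define C where "C = 2 powr p * (Cs * D ^ dil + L powr p)"
  have L1: "1 \<le> L" by (simp add: L_def)
  have "0 < C" unfolding C_def using Cs(1) D_ge_1 L1 by (intro mult_pos_pos add_pos_pos) auto
  moreover have "integrable M (\<lambda>x. \<bar>T f x\<bar> powr s) \<and>
    (\<forall>k x. (LINT y:U k x|M. \<bar>T f y\<bar> powr s) \<le> C * N * measure M (U k x) powr \<kappa>)"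
    if s: "s0 \<le> s" "s \<le> p" and f: "f \<in> borel_measurable M" "integrable M (\<lambda>x. \<bar>f x\<bar> powr s)"
      and N: "0 < N" and le: "\<And>k x. (LINT y:U k x|M. \<bar>f y\<bar> powr s) \<le> N * measure M (U k x) powr \<kappa>" for s f N
  proof (intro conjI allI)
    have s1: "1 < s" using s s0 by simp
    have fi: "integrable M f" using s1 by (intro integrable_of_powr[OF f(1) _ f(2)]) auto
    show Tf: "integrable M (\<lambda>x. \<bar>T f x\<bar> powr s)" using Cs(2)[OF s f] by simp
    fix k x0
    let ?V = "U k x0" and ?W = "U (k - dil) x0"
    let ?m = "measure M ?V"
    have m: "0 < ?m" by (rule E_pos)
    let ?f1 = "\<lambda>y. indicator ?W y * f y" and ?f2 = "\<lambda>y. indicator (- ?W) y * f y"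
    let ?F = "\<lambda>x. LINT y:- ?W|M. K x y * f y"
    have W' [measurable]: "- ?W \<in> sets M"
      using sets.compl_sets[OF U_sets[of "k - dil" x0]] by (simp add: space_M Compl_eq_Diff_UNIV)
    have f1: "integrable M ?f1" using integrable_mult_indicator[OF U_sets fi] by simp
    have f2: "integrable M ?f2" using integrable_mult_indicator[OF W' fi] by simp
    have f1s_eq: "(\<lambda>y. \<bar>?f1 y\<bar> powr s) = (\<lambda>y. indicator ?W y * \<bar>f y\<bar> powr s)"
      by (rule ext) (simp add: indicator_def)
    have f1s: "integrable M (\<lambda>y. \<bar>?f1 y\<bar> powr s)"
      unfolding f1s_eq using integrable_mult_indicator[OF U_sets f(2)] by simp
    have T1: "integrable M (\<lambda>x. \<bar>T ?f1 x\<bar> powr s)"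
      "(LINT x|M. \<bar>T ?f1 x\<bar> powr s) \<le> Cs * (LINT x|M. \<bar>?f1 x\<bar> powr s)"
      using Cs(2)[OF s _ f1s] f1 by auto
    have near_part: "(LINT x|M. \<bar>T ?f1 x\<bar> powr s) \<le> Cs * D ^ dil * N * ?m powr \<kappa>"
    proof -
      have "(LINT x|M. \<bar>?f1 x\<bar> powr s) = (LINT y:?W|M. \<bar>f y\<bar> powr s)"
        unfolding f1s_eq by (simp add: set_lebesgue_integral_def)
      also have "\<dots> \<le> N * measure M ?W powr \<kappa>" by (rule le)
      also have "\<dots> \<le> N * (D ^ dil * ?m) powr \<kappa>"
        using N \<kappa> by (intro mult_left_mono powr_mono2 U_doubling) auto
      also have "\<dots> = N * ((D ^ dil) powr \<kappa> * ?m powr \<kappa>)" using D_ge_1 by (simp add: powr_mult)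
      also have "\<dots> \<le> N * (D ^ dil * ?m powr \<kappa>)"
      proof -
        have "(D ^ dil) powr \<kappa> \<le> (D ^ dil) powr 1" using \<kappa> D_ge_1 by (intro powr_mono) auto
        also have "\<dots> = D ^ dil" using D_ge_1 by simp
        finally show ?thesis using N by (intro mult_left_mono mult_right_mono) auto
      qed
      finally have "Cs * (LINT x|M. \<bar>?f1 x\<bar> powr s) \<le> Cs * (N * (D ^ dil * ?m powr \<kappa>))"
        using Cs(1) by (intro mult_left_mono) auto
      with T1(2) show ?thesis by (simp add: mult_ac)
    qed
    let ?\<beta> = "(1 - \<kappa>) / s"
    have \<beta>: "\<beta>0 \<le> ?\<beta>" unfolding \<beta>0_def using s s1 \<kappa> by (intro divide_left_mono) auto
    have far_part: "\<bar>?F x\<bar> powr s \<le> L powr p * N * ?m powr (\<kappa> - 1)" if x: "x \<in> ?V" for x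
    proof -
      have x': "E k x0 x" using x by simp
      have term_le: "1 / measure M (U n x0) * (LINT y:U n x0|M. \<bar>f y\<bar>) \<le> 2 * N powr (1 / s) * measure M (U n x0) powr (- ?\<beta>)" for n
      proof -
        let ?mn = "measure M (U n x0)"
        have mn: "0 < ?mn" by (rule E_pos)
        have "(LINT y:U n x0|M. \<bar>f y\<bar> powr 1) \<le> 2 * (N * ?mn powr (\<kappa> - 1)) powr (1 / s) * ?mn"
          using s1 N mn f by (intro morrey_holder(2) le set_integrable_of_integrable) auto
        also have "(N * ?mn powr (\<kappa> - 1)) powr (1 / s) = N powr (1 / s) * ?mn powr (- ?\<beta>)"
          using N mn by (simp add: powr_mult powr_powr) (simp add: minus_divide_left)
        finally show ?thesis using mn by (simp add: field_simps)
      qed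
      have "\<bar>?F x\<bar> \<le> A * D ^ 3 * (\<Sum>n<k. 1 / measure M (U n x0) * (LINT y:U n x0|M. \<bar>f y\<bar>))"
        by (rule far_part_le[OF fi x'])
      also have "\<dots> \<le> A * D ^ 3 * (\<Sum>n<k. 2 * N powr (1 / s) * measure M (U n x0) powr (- ?\<beta>))"
        using A_pos D_ge_1 by (intro mult_left_mono sum_mono term_le) auto
      also have "\<dots> \<le> A * D ^ 3 * (\<Sum>n\<le>k. 2 * N powr (1 / s) * measure M (U n x0) powr (- ?\<beta>))"
        using A_pos D_ge_1 by (intro mult_left_mono sum_mono2) auto
      also have "\<dots> = A * D ^ 3 * (2 * N powr (1 / s) * (\<Sum>n\<le>k. measure M (U n x0) powr (- ?\<beta>)))"
        by (simp add: sum_distrib_left)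
      also have "\<dots> \<le> A * D ^ 3 * (2 * N powr (1 / s) * (3 / (1 - \<tau> powr \<beta>0) * ?m powr (- ?\<beta>)))"
        using A_pos D_ge_1 by (intro mult_left_mono measure_powr_sum \<beta>0 \<beta>) auto
      also have "\<dots> = A * D ^ 3 * (2 * (3 / (1 - \<tau> powr \<beta>0))) * (N powr (1 / s) * ?m powr (- ?\<beta>))"
        by (simp add: mult_ac)
      also have "\<dots> \<le> L * (N powr (1 / s) * ?m powr (- ?\<beta>))"
        by (intro mult_right_mono) (auto simp: L_def)
      finally have "\<bar>?F x\<bar> powr s \<le> (L * (N powr (1 / s) * ?m powr (- ?\<beta>))) powr s"
        using s1 by (intro powr_mono2) auto
      also have "\<dots> = L powr s * (N * ?m powr (\<kappa> - 1))"
        using s1 N m L1 by (simp add: powr_mult powr_powr)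
      also have "\<dots> \<le> L powr p * (N * ?m powr (\<kappa> - 1))"
        using s L1 N by (intro mult_right_mono powr_mono) auto
      finally show ?thesis by (simp add: mult_ac)
    qed
    have "AE x in M. T (\<lambda>y. ?f1 y + ?f2 y) x = T ?f1 x + T ?f2 x" by (rule T_add[OF f1 f2])
    moreover have "(\<lambda>y. ?f1 y + ?f2 y) = f" by (rule ext) (simp add: indicator_def)
    ultimately have ae: "AE x in M. T f x = T ?f1 x + T ?f2 x" by simp
    have Tf2: "T ?f2 x = ?F x" if "x \<in> ?V" for x
    proof (rule cz_op_eq, rule far_pv[OF fi W'])
      have "E (k - 1) x0 x" using that E_mono[of "k - 1" k x0 x] by simp
      then show "\<not> E (Suc (k - dil)) x y" if "y \<in> - ?W" for y
        using far_from_cube that by auto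
    qed
    let ?c = "L powr p * N * ?m powr (\<kappa> - 1)"
    have bd: "set_integrable M ?V (\<lambda>x. 2 powr s * (\<bar>T ?f1 x\<bar> powr s + ?c))"
      using T1(1) by (intro set_integrable_of_integrable) auto
    have "(LINT x:?V|M. \<bar>T f x\<bar> powr s) \<le> (LINT x:?V|M. 2 powr s * (\<bar>T ?f1 x\<bar> powr s + ?c))"
    proof (rule set_integral_mono_AE[OF set_integrable_of_integrable[OF Tf U_sets] bd])
      show "AE x\<in>?V in M. \<bar>T f x\<bar> powr s \<le> 2 powr s * (\<bar>T ?f1 x\<bar> powr s + ?c)"
        using ae
      proof (rule eventually_mono, intro impI)
        fix x assume eq: "T f x = T ?f1 x + T ?f2 x" and x: "x \<in> ?V"
        have "\<bar>T f x\<bar> powr s \<le> (\<bar>T ?f1 x\<bar> + \<bar>?F x\<bar>) powr s"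
          unfolding eq Tf2[OF x] using s1 by (intro powr_mono2 abs_triangle_ineq) auto
        also have "\<dots> \<le> 2 powr s * (\<bar>T ?f1 x\<bar> powr s + \<bar>?F x\<bar> powr s)"
          using s1 by (intro powr_add_le) auto
        also have "\<dots> \<le> 2 powr s * (\<bar>T ?f1 x\<bar> powr s + ?c)"
          using far_part[OF x] by (intro mult_left_mono add_left_mono) auto
        finally show "\<bar>T f x\<bar> powr s \<le> 2 powr s * (\<bar>T ?f1 x\<bar> powr s + ?c)" .
      qed
    qed
    also have "\<dots> = 2 powr s * ((LINT x:?V|M. \<bar>T ?f1 x\<bar> powr s) + ?c * ?m)"
      using T1(1) by (simp add: set_integral_add set_integrable_of_integrable set_integral_const')
    also have "\<dots> \<le> 2 powr s * (Cs * D ^ dil * N * ?m powr \<kappa> + L powr p * N * ?m powr \<kappa>)"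
    proof (intro mult_left_mono add_mono)
      show "(LINT x:?V|M. \<bar>T ?f1 x\<bar> powr s) \<le> Cs * D ^ dil * N * ?m powr \<kappa>"
        using set_integral_le_all[OF T1(1) U_sets[of k x0]] near_part by simp
      show "?c * ?m \<le> L powr p * N * ?m powr \<kappa>" using m by (simp add: powr_diff)
    qed simp
    also have "\<dots> = 2 powr s * (Cs * D ^ dil + L powr p) * (N * ?m powr \<kappa>)" by (simp add: algebra_simps)
    also have "\<dots> \<le> 2 powr p * (Cs * D ^ dil + L powr p) * (N * ?m powr \<kappa>)"
      using s Cs(1) D_ge_1 N by (intro mult_right_mono powr_mono) (auto intro!: add_nonneg_nonneg mult_nonneg_nonneg)
    finally show "(LINT x:?V|M. \<bar>T f x\<bar> powr s) \<le> C * N * ?m powr \<kappa>" by (simp add: C_def mult_ac)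
  qed
  ultimately show ?thesis by blast
qed

end

section \<open>Grand Morrey bounds\<close>

lemma powr_le_powr_inverse:
  fixes X s N :: real
  assumes "0 \<le> X" "0 < s" "X powr (1 / s) \<le> N"
  shows "X \<le> N powr s"
proof -
  have "X = (X powr (1 / s)) powr s" using assms by (simp add: powr_powr)
  also have "\<dots> \<le> N powr s" using assms by (intro powr_mono2) auto
  finally show ?thesis .
qed

text \<open>Twice the diameter makes scale 0 the whole space even if the diameter is attained. The
  bound on \<open>\<delta>\<close> puts all later scales below the diameter, where the norm and the
  annulus condition apply.\<close>

locale small_scale_kernel_space = annular_kernel_space M E D \<pi> \<rho> K R \<delta> A B q w
  for M :: "'a measure" and E D \<pi> \<rho> K R \<delta> A B q w +
  assumes R_eq: "R = 2 * qdiam \<rho>" and \<delta>_half: "2 * \<delta> < 1"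
begin

lemma U_eq_qball: "U k x = qball \<rho> x (R * \<delta> ^ k)"
  by (auto simp: qball_def E_iff)

lemma qdiam_pos: "0 < qdiam \<rho>"
  using R_pos by (simp add: R_eq)

lemma radius_lt_qdiam:
  assumes "1 \<le> k"
  shows "R * \<delta> ^ k < qdiam \<rho>"
proof -
  have "R * \<delta> ^ k \<le> R * \<delta> ^ 1" using assms R_pos \<delta> by (intro mult_left_mono power_decreasing) auto
  also have "\<dots> = qdiam \<rho> * (2 * \<delta>)" by (simp add: R_eq)
  also have "\<dots> < qdiam \<rho> * 1" using qdiam_pos \<delta>_half by (intro mult_strict_left_mono)
  finally show ?thesis by simp
qed

lemma qball_comparison:
  assumes "0 < r" "r < qdiam \<rho>"
  obtains k where "qball \<rho> x r \<subseteq> U k x" "measure M (U k x) \<le> D * measure M (qball \<rho> x r)"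
    "0 < measure M (qball \<rho> x r)" "qball \<rho> x r \<in> sets M"
proof -
  have "r < R * \<delta> ^ 0" using assms by (simp add: R_eq)
  then obtain k where k: "R * \<delta> ^ Suc k \<le> r" "r < R * \<delta> ^ k" using truncation_scale assms by metis
  have "{y \<in> space M. \<rho> x y < r} \<in> sets M" using \<rho>_measurable by measurable
  then have sets: "qball \<rho> x r \<in> sets M" by (simp add: qball_def space_M)
  have "U (Suc k) x \<subseteq> qball \<rho> x r" using k by (auto simp: U_eq_qball qball_def)
  then have le: "measure M (U (Suc k) x) \<le> measure M (qball \<rho> x r)" using sets by (intro m_mono)
  then have "measure M (U k x) \<le> D * measure M (qball \<rho> x r)"
    using D_ge_1 by (intro order_trans[OF E_doubling[of k x] mult_left_mono]) auto
  moreover have "qball \<rho> x r \<subseteq> U k x" using k by (auto simp: U_eq_qball qball_def)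
  ultimately show thesis using that sets le E_pos[of "Suc k" x] by (meson less_le_trans)
qed

lemma finite_cover: "\<exists>Z. finite Z \<and> (\<Union>z\<in>Z. U 1 z) = UNIV"
proof -
  obtain Z where Z: "finite Z" "\<And>x. \<exists>z\<in>Z. near 2 z x" using net_exists[of 2] by blast
  have "\<exists>z\<in>Z. E 1 z x" for x using Z(2)[of x] chain1[of 2 _ x 1] by auto
  then show ?thesis using Z(1) by (intro exI[of _ Z]) auto
qed

lemma qball_to_U:
  fixes f :: "'a \<Rightarrow> real"
  assumes Z: "finite Z" "(\<Union>z\<in>Z. U 1 z) = UNIV" and \<kappa>: "0 \<le> \<kappa>" and N: "0 \<le> N"
    and f: "f \<in> borel_measurable M"
    and le: "\<And>x r. 0 < r \<Longrightarrow> r < qdiam \<rho> \<Longrightarrow> set_integrable M (qball \<rho> x r) (\<lambda>y. \<bar>f y\<bar> powr s) \<and>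
      (LINT y:qball \<rho> x r|M. \<bar>f y\<bar> powr s) \<le> N * measure M (qball \<rho> x r) powr \<kappa>"
  shows "integrable M (\<lambda>y. \<bar>f y\<bar> powr s)"
    and "(LINT y:U k x|M. \<bar>f y\<bar> powr s) \<le> (real (card Z) + 1) * N * measure M (U k x) powr \<kappa>"
proof -
  have small: "set_integrable M (U j z) (\<lambda>y. \<bar>f y\<bar> powr s)"
    "(LINT y:U j z|M. \<bar>f y\<bar> powr s) \<le> N * measure M (U j z) powr \<kappa>" if "1 \<le> j" for j z
    unfolding U_eq_qball using le radius_lt_qdiam[OF that] R_pos \<delta> by auto
  have "set_integrable M (\<Union>z\<in>Z. U 1 z) (\<lambda>y. \<bar>f y\<bar> powr s)"
    using Z small(1) by (intro set_integrable_UN) auto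
  then show int: "integrable M (\<lambda>y. \<bar>f y\<bar> powr s)"
    unfolding Z(2) by (simp add: set_integrable_def)
  show "(LINT y:U k x|M. \<bar>f y\<bar> powr s) \<le> (real (card Z) + 1) * N * measure M (U k x) powr \<kappa>"
  proof (cases "k = 0")
    case False
    then have "(LINT y:U k x|M. \<bar>f y\<bar> powr s) \<le> 1 * (N * measure M (U k x) powr \<kappa>)" using small(2) by simp
    also have "\<dots> \<le> (real (card Z) + 1) * (N * measure M (U k x) powr \<kappa>)"
      using N by (intro mult_right_mono) auto
    finally show ?thesis by (simp add: mult_ac)
  next
    case True
    have zi: "integrable M (\<lambda>y. indicator (U 1 z) y * \<bar>f y\<bar> powr s)" for z
      using small(1)[of 1 z] by (simp add: set_integrable_def)
    have "(LINT y|M. \<bar>f y\<bar> powr s) \<le> (LINT y|M. (\<Sum>z\<in>Z. indicator (U 1 z) y * \<bar>f y\<bar> powr s))"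
    proof (rule integral_mono[OF int])
      show "integrable M (\<lambda>y. \<Sum>z\<in>Z. indicator (U 1 z) y * \<bar>f y\<bar> powr s)"
        by (intro Bochner_Integration.integrable_sum zi)
      fix y
      obtain z where z: "z \<in> Z" "y \<in> U 1 z" using Z(2) by blast
      have "indicator (U 1 z) y * \<bar>f y\<bar> powr s \<le> (\<Sum>z\<in>Z. indicator (U 1 z) y * \<bar>f y\<bar> powr s)"
        using z(1) Z(1) by (intro member_le_sum) auto
      then show "\<bar>f y\<bar> powr s \<le> (\<Sum>z\<in>Z. indicator (U 1 z) y * \<bar>f y\<bar> powr s)" using z(2) by simp
    qed
    also have "\<dots> = (\<Sum>z\<in>Z. LINT y:U 1 z|M. \<bar>f y\<bar> powr s)"
      by (subst Bochner_Integration.integral_sum, rule zi) (simp add: set_lebesgue_integral_def)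
    also have "\<dots> \<le> (\<Sum>z\<in>Z. N * measure M UNIV powr \<kappa>)"
    proof (rule sum_mono)
      fix z
      have "measure M (U 1 z) \<le> measure M UNIV" by (rule m_mono) auto
      then have "measure M (U 1 z) powr \<kappa> \<le> measure M UNIV powr \<kappa>" using \<kappa> by (intro powr_mono2) auto
      from order_trans[OF small(2)[OF order_refl] mult_left_mono[OF this N]]
      show "(LINT y:U 1 z|M. \<bar>f y\<bar> powr s) \<le> N * measure M UNIV powr \<kappa>" .
    qed
    also have "\<dots> = real (card Z) * (N * measure M UNIV powr \<kappa>)" by simp
    also have "\<dots> \<le> (real (card Z) + 1) * (N * measure M UNIV powr \<kappa>)" using N by (intro mult_right_mono) auto
    finally show ?thesis using True by (simp add: U_0 integral_UNIV mult_ac)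
  qed
qed

text \<open>\<open>N\<close> is any positive bound for the norm, not the norm itself, so that the
  powers of \<open>N\<close> are positive for functions of norm 0 as well.\<close>

lemma grand_term_bound:
  assumes p: "1 < p" and \<theta>: "0 < \<theta>" and \<kappa>: "0 < \<kappa>" "\<kappa> < 1"
  shows "\<exists>C>0. \<forall>f N. f \<in> grand_morrey_space M \<rho> p \<theta> \<kappa> \<longrightarrow> 0 < N \<longrightarrow> grand_morrey_norm M \<rho> p \<theta> \<kappa> f \<le> N \<longrightarrow>
    integrable M f \<and> (\<forall>(\<epsilon>, x, r)\<in>grand_morrey_index \<rho> p.
      set_integrable M (qball \<rho> x r) (\<lambda>y. \<bar>T f y\<bar> powr (p - \<epsilon>)) \<and>
      grand_morrey_term M \<rho> p \<theta> \<kappa> (T f) (\<epsilon>, x, r) \<le> C * N)"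
proof -
  define \<sigma> where "\<sigma> = (p - 1) / 2"
  define s0 where "s0 = p - \<sigma>"
  have \<sigma>: "0 < \<sigma>" "\<sigma> < p - 1" and s0: "1 < s0" "s0 \<le> p" using p by (auto simp: \<sigma>_def s0_def field_simps)
  obtain C0 where C0: "0 < C0" "\<And>s f N. s0 \<le> s \<Longrightarrow> s \<le> p \<Longrightarrow> f \<in> borel_measurable M \<Longrightarrow>
      integrable M (\<lambda>x. \<bar>f x\<bar> powr s) \<Longrightarrow> 0 < N \<Longrightarrow>
      (\<forall>k x. (LINT y:U k x|M. \<bar>f y\<bar> powr s) \<le> N * measure M (U k x) powr \<kappa>) \<Longrightarrow>
      integrable M (\<lambda>x. \<bar>T f x\<bar> powr s) \<and>
      (\<forall>k x. (LINT y:U k x|M. \<bar>T f y\<bar> powr s) \<le> C0 * N * measure M (U k x) powr \<kappa>)"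
    using morrey_bound[OF s0, of \<kappa>] \<kappa> by fastforce
  obtain Z where Z: "finite Z" "(\<Union>z\<in>Z. U 1 z) = UNIV" using finite_cover by blast
  define C1 where "C1 = C0 * (real (card Z) + 1) * D"
  have C1: "0 < C1" using C0(1) D_ge_1 by (simp add: C1_def add_nonneg_pos)
  define mx where "mx = max 1 (measure M UNIV)"
  \<comment> \<open>The 1 serves \<open>\<epsilon> \<le> \<sigma>\<close>, the product the other
    values: \<open>p powr \<theta>\<close> bounds the weight at \<epsilon>, the power of
    \<open>\<sigma>\<close> undoes the weight at \<open>\<sigma>\<close>, the 2 is the loss in
    \<open>morrey_holder\<close>, and \<open>mx\<close> bounds the remaining power of the measure of
    the ball.\<close>
  define C where "C = max 1 C1 * (1 + p powr \<theta> * 2 * \<sigma> powr (- \<theta> / s0) * mx)"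
  have mx: "1 \<le> mx" by (simp add: mx_def)
  have C: "0 < C" unfolding C_def using mx by (intro mult_pos_pos add_pos_nonneg) auto
  show ?thesis
  proof (intro exI[of _ C] conjI C allI impI)
    fix f N assume f: "f \<in> grand_morrey_space M \<rho> p \<theta> \<kappa>" and N: "0 < N"
      and norm: "grand_morrey_norm M \<rho> p \<theta> \<kappa> f \<le> N"
    have f_meas: "f \<in> borel_measurable M" using f by (simp add: grand_morrey_space_def)
    have f_le: "set_integrable M (qball \<rho> x r) (\<lambda>y. \<bar>f y\<bar> powr (p - \<epsilon>)) \<and>
      (LINT y:qball \<rho> x r|M. \<bar>f y\<bar> powr (p - \<epsilon>)) \<le> N powr (p - \<epsilon>) / \<epsilon> powr \<theta> * measure M (qball \<rho> x r) powr \<kappa>"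
      if \<epsilon>: "0 < \<epsilon>" "\<epsilon> < p - 1" and r: "0 < r" "r < qdiam \<rho>" for \<epsilon> x r
    proof -
      have idx: "(\<epsilon>, x, r) \<in> grand_morrey_index \<rho> p" using \<epsilon> r by (simp add: grand_morrey_index_def)
      have int: "set_integrable M (qball \<rho> x r) (\<lambda>y. \<bar>f y\<bar> powr (p - \<epsilon>))"
        using f idx by (auto simp: grand_morrey_space_def)
      have m: "0 < measure M (qball \<rho> x r)" using qball_comparison[OF r] by metis
      let ?I = "LINT y:qball \<rho> x r|M. \<bar>f y\<bar> powr (p - \<epsilon>)"
      have I: "0 \<le> ?I" unfolding set_lebesgue_integral_def by (intro Bochner_Integration.integral_nonneg) auto
      have "bdd_above (grand_morrey_term M \<rho> p \<theta> \<kappa> f ` grand_morrey_index \<rho> p)"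
        using f by (simp add: grand_morrey_space_def)
      then have "grand_morrey_term M \<rho> p \<theta> \<kappa> f (\<epsilon>, x, r) \<le> N"
        using cSUP_upper[OF idx] norm unfolding grand_morrey_norm_def by force
      then have "(\<epsilon> powr \<theta> / measure M (qball \<rho> x r) powr \<kappa> * ?I) powr (1 / (p - \<epsilon>)) \<le> N"
        by (simp add: grand_morrey_term_def)
      then have "\<epsilon> powr \<theta> / measure M (qball \<rho> x r) powr \<kappa> * ?I \<le> N powr (p - \<epsilon>)"
        using I \<epsilon> by (intro powr_le_powr_inverse) auto
      then have "?I \<le> N powr (p - \<epsilon>) / \<epsilon> powr \<theta> * measure M (qball \<rho> x r) powr \<kappa>"
        using \<epsilon> m by (simp add: field_simps)
      with int show ?thesis by blast
    qed
    have Tf_le: "integrable M (\<lambda>y. \<bar>f y\<bar> powr (p - \<epsilon>)) \<and> set_integrable M (qball \<rho> x r) (\<lambda>y. \<bar>T f y\<bar> powr (p - \<epsilon>)) \<and>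
      (LINT y:qball \<rho> x r|M. \<bar>T f y\<bar> powr (p - \<epsilon>)) \<le> C1 * (N powr (p - \<epsilon>) / \<epsilon> powr \<theta>) * measure M (qball \<rho> x r) powr \<kappa>"
      if \<epsilon>: "0 < \<epsilon>" "\<epsilon> \<le> \<sigma>" and r: "0 < r" "r < qdiam \<rho>" for \<epsilon> x r
    proof -
      \<comment> \<open>The Morrey bound contained in the grand norm at this exponent. Its factor
        \<open>1 / \<epsilon> powr \<theta>\<close> passes through \<open>morrey_bound\<close>
        unchanged and is cancelled by the weight in front of the integral for
        \<open>T f\<close>.\<close>
      let ?s = "p - \<epsilon>" and ?N = "N powr (p - \<epsilon>) / \<epsilon> powr \<theta>"
      have \<epsilon>': "\<epsilon> < p - 1" using \<epsilon> \<sigma> by simp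
      have N0: "0 < ?N" using N \<epsilon> by simp
      note fU = qball_to_U[OF Z less_imp_le[OF \<kappa>(1)] less_imp_le[OF N0] f_meas f_le[OF \<epsilon>(1) \<epsilon>']]
      have s: "s0 \<le> ?s" "?s \<le> p" using \<epsilon> by (auto simp: s0_def)
      have "0 < (real (card Z) + 1) * ?N" using N0 by (intro mult_pos_pos) auto
      from C0(2)[OF s f_meas fU(1) this] fU(2)
      have T: "integrable M (\<lambda>x. \<bar>T f x\<bar> powr ?s)"
        "\<And>k x. (LINT y:U k x|M. \<bar>T f y\<bar> powr ?s) \<le> C0 * ((real (card Z) + 1) * ?N) * measure M (U k x) powr \<kappa>"
        by blast+
      obtain k where k: "qball \<rho> x r \<subseteq> U k x" "measure M (U k x) \<le> D * measure M (qball \<rho> x r)"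
        "0 < measure M (qball \<rho> x r)" "qball \<rho> x r \<in> sets M" using qball_comparison[OF r] by metis
      let ?m = "measure M (qball \<rho> x r)"
      have "(LINT y:qball \<rho> x r|M. \<bar>T f y\<bar> powr ?s) \<le> (LINT y:U k x|M. \<bar>T f y\<bar> powr ?s)"
        using T(1) k by (intro set_integral_le_subset set_integrable_of_integrable) auto
      also have "\<dots> \<le> C0 * ((real (card Z) + 1) * ?N) * measure M (U k x) powr \<kappa>" by (rule T(2))
      also have "\<dots> \<le> C0 * ((real (card Z) + 1) * ?N) * (D * ?m powr \<kappa>)"
      proof (rule mult_left_mono)
        have "measure M (U k x) powr \<kappa> \<le> (D * ?m) powr \<kappa>" using k(2) \<kappa> by (intro powr_mono2) auto
        also have "\<dots> = D powr \<kappa> * ?m powr \<kappa>" using D_ge_1 by (simp add: powr_mult)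
        also have "\<dots> \<le> D powr 1 * ?m powr \<kappa>" using \<kappa> D_ge_1 by (intro mult_right_mono powr_mono) auto
        finally show "measure M (U k x) powr \<kappa> \<le> D * ?m powr \<kappa>" using D_ge_1 by simp
      qed (use C0(1) N0 in \<open>auto intro!: mult_nonneg_nonneg\<close>)
      also have "\<dots> = C1 * ?N * ?m powr \<kappa>" by (simp add: C1_def mult_ac)
      finally show ?thesis using T(1) k(4) fU(1) by (auto intro: set_integrable_of_integrable)
    qed
    show fi: "integrable M f"
      using Tf_le[of \<sigma> "qdiam \<rho> / 2" undefined] \<sigma> qdiam_pos s0
      by (intro integrable_of_powr[OF f_meas, of s0]) (auto simp: s0_def)
    have Tf_meas: "T f \<in> borel_measurable M" by (rule T_measurable[OF fi])
    have C1_root: "C1 powr (1 / s) \<le> max 1 C1" if "1 \<le> s" for s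
    proof -
      have "C1 powr (1 / s) \<le> max 1 C1 powr (1 / s)" using C1 that by (intro powr_mono2) auto
      also have "\<dots> \<le> max 1 C1 powr 1" using that by (intro powr_mono) auto
      finally show ?thesis by simp
    qed
    have C_ge: "max 1 C1 \<le> C" unfolding C_def using mx
      by (subst mult_le_cancel_left1) auto
    have C_ge': "max 1 C1 * (p powr \<theta> * 2 * \<sigma> powr (- \<theta> / s0) * mx) \<le> C"
      unfolding C_def by (intro mult_left_mono) auto
    show "\<forall>(\<epsilon>, x, r)\<in>grand_morrey_index \<rho> p.
      set_integrable M (qball \<rho> x r) (\<lambda>y. \<bar>T f y\<bar> powr (p - \<epsilon>)) \<and>
      grand_morrey_term M \<rho> p \<theta> \<kappa> (T f) (\<epsilon>, x, r) \<le> C * N"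
    proof (intro ballI, clarify)
      fix \<epsilon> x r assume "(\<epsilon>, x, r) \<in> grand_morrey_index \<rho> p"
      then have \<epsilon>: "0 < \<epsilon>" "\<epsilon> < p - 1" and r: "0 < r" "r < qdiam \<rho>" by (auto simp: grand_morrey_index_def)
      let ?B = "qball \<rho> x r"
      let ?m = "measure M ?B"
      have B: "0 < ?m" "?B \<in> sets M" using qball_comparison[OF r] by metis+
      show "set_integrable M ?B (\<lambda>y. \<bar>T f y\<bar> powr (p - \<epsilon>)) \<and>
        grand_morrey_term M \<rho> p \<theta> \<kappa> (T f) (\<epsilon>, x, r) \<le> C * N"
      proof (cases "\<epsilon> \<le> \<sigma>")
        case True
        let ?s = "p - \<epsilon>"
        have s: "1 < ?s" using \<epsilon> by simp
        let ?I = "LINT y:?B|M. \<bar>T f y\<bar> powr ?s"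
        have int: "set_integrable M ?B (\<lambda>y. \<bar>T f y\<bar> powr ?s)"
          and le: "?I \<le> C1 * (N powr ?s / \<epsilon> powr \<theta>) * ?m powr \<kappa>" using Tf_le[OF \<epsilon>(1) True r] by auto
        have I: "0 \<le> ?I" unfolding set_lebesgue_integral_def by (intro Bochner_Integration.integral_nonneg) auto
        have "\<epsilon> powr \<theta> / ?m powr \<kappa> * ?I \<le> \<epsilon> powr \<theta> / ?m powr \<kappa> * (C1 * (N powr ?s / \<epsilon> powr \<theta>) * ?m powr \<kappa>)"
          using le by (intro mult_left_mono) auto
        also have "\<dots> = C1 * N powr ?s" using B(1) \<epsilon>(1) by simp
        finally have "(\<epsilon> powr \<theta> / ?m powr \<kappa> * ?I) powr (1 / ?s) \<le> (C1 * N powr ?s) powr (1 / ?s)"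
          using I s by (intro powr_mono2) auto
        also have "\<dots> = C1 powr (1 / ?s) * N" using C1 N s by (simp add: powr_mult powr_powr)
        also have "\<dots> \<le> C * N"
          using N s by (intro mult_right_mono order_trans[OF C1_root C_ge]) auto
        finally show ?thesis using int by (simp add: grand_morrey_term_def)
      next
        case False
        let ?a = "p - \<epsilon>" and ?N = "C1 * (N powr s0 / \<sigma> powr \<theta>)"
        have a: "1 < ?a" "?a \<le> s0" using \<epsilon> False by (auto simp: s0_def)
        have N0: "0 < ?N" using C1 N \<sigma> by simp
        let ?I = "LINT y:?B|M. \<bar>T f y\<bar> powr ?a"
        have Tf0: "set_integrable M ?B (\<lambda>y. \<bar>T f y\<bar> powr s0)"
          "(LINT y:?B|M. \<bar>T f y\<bar> powr s0) \<le> ?N * ?m powr \<kappa>"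
          using Tf_le[OF \<sigma>(1) order_refl r, of x] by (auto simp: s0_def)
        have a0: "0 < ?a" using a by simp
        note holder = morrey_holder[OF B(2,1) Tf_meas Tf0(1) a0 a(2) N0 Tf0(2)]
        have I: "0 \<le> ?I" unfolding set_lebesgue_integral_def by (intro Bochner_Integration.integral_nonneg) auto
        \<comment> \<open>The power of the measure of the ball that remains after Hoelder's
          inequality. It lies between 0 and 1, so the factor is at most \<open>mx\<close> for every
          radius.\<close>
        let ?g = "(1 - \<kappa>) * (1 / ?a - 1 / s0)"
        have "(\<epsilon> powr \<theta> / ?m powr \<kappa> * ?I) powr (1 / ?a) \<le>
          (\<epsilon> powr \<theta> / ?m powr \<kappa> * (2 * (?N * ?m powr (\<kappa> - 1)) powr (?a / s0) * ?m)) powr (1 / ?a)"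
          using holder(2) I a by (intro powr_mono2 mult_left_mono) auto
        also have "\<epsilon> powr \<theta> / ?m powr \<kappa> * (2 * (?N * ?m powr (\<kappa> - 1)) powr (?a / s0) * ?m) =
          \<epsilon> powr \<theta> * 2 * (?N powr (?a / s0) * ?m powr ((\<kappa> - 1) * (?a / s0) + (1 - \<kappa>)))"
        proof -
          have h1: "(?N * ?m powr (\<kappa> - 1)) powr (?a / s0) = ?N powr (?a / s0) * ?m powr ((\<kappa> - 1) * (?a / s0))"
            unfolding powr_mult powr_powr ..
          have h2: "?m / ?m powr \<kappa> = ?m powr (1 - \<kappa>)" using B(1) by (simp add: powr_diff)
          have "e / d * (2 * (n * v) * m) = e * 2 * (n * (v * (m / d)))" for e d n v m :: real by simp
          then show ?thesis by (simp only: h1 h2 powr_add)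
        qed
        also have "(\<epsilon> powr \<theta> * 2 * (?N powr (?a / s0) * ?m powr ((\<kappa> - 1) * (?a / s0) + (1 - \<kappa>)))) powr (1 / ?a) =
          \<epsilon> powr (\<theta> / ?a) * 2 powr (1 / ?a) * (?N powr (1 / s0) * ?m powr ?g)"
        proof -
          have "((\<kappa> - 1) * (?a / s0) + (1 - \<kappa>)) * (1 / ?a) = ?g" using a s0 by (simp add: field_simps)
          then have e1: "(?m powr ((\<kappa> - 1) * (?a / s0) + (1 - \<kappa>))) powr (1 / ?a) = ?m powr ?g"
            by (simp only: powr_powr)
          have e2: "(?N powr (?a / s0)) powr (1 / ?a) = ?N powr (1 / s0)" using a by (simp add: powr_powr)
          have e3: "(\<epsilon> powr \<theta>) powr (1 / ?a) = \<epsilon> powr (\<theta> / ?a)" by (simp add: powr_powr)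
          have "(a * 2 * (b * c)) powr h = a powr h * 2 powr h * (b powr h * c powr h)" for a b c h :: real
            by (simp only: powr_mult)
          then show ?thesis by (simp only: e1 e2 e3)
        qed
        also have "\<dots> \<le> p powr \<theta> * 2 * (max 1 C1 * N * \<sigma> powr (- \<theta> / s0) * mx)"
        proof (intro mult_mono)
          have "\<epsilon> powr (\<theta> / ?a) \<le> p powr (\<theta> / ?a)" using \<epsilon> \<theta> a by (intro powr_mono2) auto
          also have "\<dots> \<le> p powr \<theta>"
            using p \<theta> a by (intro powr_mono) (auto simp: divide_le_eq)
          finally show "\<epsilon> powr (\<theta> / ?a) \<le> p powr \<theta>" .
          have "(2::real) powr (1 / ?a) \<le> 2 powr 1" using a by (intro powr_mono) auto
          then show "(2::real) powr (1 / ?a) \<le> 2" by simp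
          have "?N powr (1 / s0) = C1 powr (1 / s0) * (N * \<sigma> powr (- \<theta> / s0))"
            using C1 N \<sigma> s0 by (simp add: powr_mult powr_divide powr_powr powr_minus_divide)
          also have "\<dots> \<le> max 1 C1 * (N * \<sigma> powr (- \<theta> / s0))"
            using s0 N by (intro mult_right_mono C1_root) auto
          finally show "?N powr (1 / s0) \<le> max 1 C1 * N * \<sigma> powr (- \<theta> / s0)" by (simp add: mult_ac)
          have g0: "0 \<le> 1 / ?a - 1 / s0" using a s0 by (simp add: frac_le)
          have g1: "1 / ?a - 1 / s0 \<le> 1" using a s0 by (simp add: add_increasing2 diff_le_eq)
          have g: "0 \<le> ?g" using g0 \<kappa> by simp
          have g': "?g \<le> 1" using mult_mono[of "1 - \<kappa>" 1 "1 / ?a - 1 / s0" 1] g0 g1 \<kappa> by simp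
          have "?m \<le> mx" using m_mono[of ?B UNIV] by (simp add: mx_def)
          then have "?m powr ?g \<le> mx powr ?g" using g by (intro powr_mono2) auto
          also have "\<dots> \<le> mx powr 1" using g' mx by (intro powr_mono) auto
          finally show "?m powr ?g \<le> mx" using mx by simp
        qed (use N in auto)
        also have "\<dots> = max 1 C1 * (p powr \<theta> * 2 * \<sigma> powr (- \<theta> / s0) * mx) * N" by (simp add: mult_ac)
        also have "\<dots> \<le> C * N" using C_ge' N by (intro mult_right_mono) auto
        finally show ?thesis using holder(1) by (simp add: grand_morrey_term_def)
      qed
    qed
  qed
qed

lemma grand_morrey_bound:
  assumes p: "1 < p" and \<theta>: "0 < \<theta>" and \<kappa>: "0 < \<kappa>" "\<kappa> < 1"
  shows "\<exists>C>0. \<forall>f\<in>grand_morrey_space M \<rho> p \<theta> \<kappa>. cz_op_defined M \<rho> K f \<and>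
    T f \<in> grand_morrey_space M \<rho> p \<theta> \<kappa> \<and>
    grand_morrey_norm M \<rho> p \<theta> \<kappa> (T f) \<le> C * grand_morrey_norm M \<rho> p \<theta> \<kappa> f"
proof -
  let ?I = "grand_morrey_index \<rho> p" and ?t = "grand_morrey_term M \<rho> p \<theta> \<kappa>"
    and ?n = "grand_morrey_norm M \<rho> p \<theta> \<kappa>" and ?S = "grand_morrey_space M \<rho> p \<theta> \<kappa>"
  obtain C where C: "0 < C" and T: "\<And>f N. f \<in> ?S \<Longrightarrow> 0 < N \<Longrightarrow> ?n f \<le> N \<Longrightarrow> integrable M f \<and> (\<forall>(\<epsilon>, x, r)\<in>?I.
      set_integrable M (qball \<rho> x r) (\<lambda>y. \<bar>T f y\<bar> powr (p - \<epsilon>)) \<and> ?t (T f) (\<epsilon>, x, r) \<le> C * N)"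
    using grand_term_bound[OF assms] by blast
  have idx: "((p - 1) / 2, undefined, qdiam \<rho> / 2) \<in> ?I"
    using p qdiam_pos by (simp add: grand_morrey_index_def)
  have nonneg: "0 \<le> ?n f" if "f \<in> ?S" for f
  proof -
    have "0 \<le> ?t f ((p - 1) / 2, undefined, qdiam \<rho> / 2)" by (simp add: grand_morrey_term_def)
    also have "\<dots> \<le> ?n f"
      unfolding grand_morrey_norm_def using that by (intro cSUP_upper idx) (simp add: grand_morrey_space_def)
    finally show ?thesis .
  qed
  show ?thesis
  proof (intro exI[of _ C] conjI C ballI)
    fix f assume f: "f \<in> ?S"
    note Tf = T[OF f, of "?n f + 1"]
    have Tf: "integrable M f" "\<And>\<epsilon> x r. (\<epsilon>, x, r) \<in> ?I \<Longrightarrow> set_integrable M (qball \<rho> x r) (\<lambda>y. \<bar>T f y\<bar> powr (p - \<epsilon>))"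
      "\<And>i. i \<in> ?I \<Longrightarrow> ?t (T f) i \<le> C * (?n f + 1)"
      using Tf nonneg[OF f] by (auto simp: add_nonneg_pos)
    show "cz_op_defined M \<rho> K f" by (rule T_defined_integrable[OF Tf(1)])
    show "T f \<in> ?S"
      unfolding grand_morrey_space_def using T_measurable[OF Tf(1)] Tf(2,3) by (auto intro!: bdd_aboveI2)
    show "?n (T f) \<le> C * ?n f"
    \<comment> \<open>The norm of \<open>f\<close> may be 0, while a positive bound is required;
      \<open>e / C\<close> is added to it and then removed.\<close>
    proof (rule field_le_epsilon)
      fix e :: real assume e: "0 < e"
      have "?n (T f) \<le> C * (?n f + e / C)"
        unfolding grand_morrey_norm_def[of M \<rho> p \<theta> \<kappa> "T f"]
      proof (rule cSUP_least)
        show "?I \<noteq> {}" using idx by blast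
        show "?t (T f) i \<le> C * (?n f + e / C)" if "i \<in> ?I" for i
          using T[OF f, of "?n f + e / C"] nonneg[OF f] e C that by (auto simp: add_nonneg_pos)
      qed
      also have "\<dots> = C * ?n f + e" using C by (simp add: distrib_left)
      finally show "?n (T f) \<le> C * ?n f + e" .
    qed
  qed
qed

end

section \<open>Spaces of homogeneous type\<close>

text \<open>Points that share their cube on every level coincide, so the diagonal is a countable
  intersection of finite unions of measurable rectangles. It must lie in the product sigma-algebra
  before the kernel can be extended across it.\<close>

lemma (in cube_space) diagonal_measurable:
  assumes sep: "\<And>x y. (\<And>n. E n x y) \<Longrightarrow> x = y"
  shows "{p \<in> space (M \<Otimes>\<^sub>M M). fst p = snd p} \<in> sets (M \<Otimes>\<^sub>M M)"
proof -
  have "{p \<in> space (M \<Otimes>\<^sub>M M). fst p = snd p} = (\<Inter>n. \<Union>z\<in>range (\<pi> n). Q n z \<times> Q n z)"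
  proof (intro set_eqI iffI)
    fix p assume p: "p \<in> (\<Inter>n. \<Union>z\<in>range (\<pi> n). Q n z \<times> Q n z)"
    have eq: "\<pi> n (fst p) = \<pi> n (snd p)" for n
    proof -
      from p have "p \<in> (\<Union>z\<in>range (\<pi> n). Q n z \<times> Q n z)" by blast
      then show ?thesis by (auto simp: mem_Times_iff)
    qed
    have "E n (fst p) (snd p)" for n
    proof (rule chain2)
      show "near (n + 1) (fst p) (\<pi> (n + 2) (fst p))" using \<pi>_near[of "n + 2" "fst p"] by (auto intro: E_near')
      show "near (n + 1) (\<pi> (n + 2) (fst p)) (snd p)"
        unfolding eq using \<pi>_near[of "n + 2" "snd p"] by (auto intro: E_near)
    qed auto
    then have "fst p = snd p" by (rule sep)
    then show "p \<in> {p \<in> space (M \<Otimes>\<^sub>M M). fst p = snd p}" by (simp add: space_pair_measure space_M)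
  qed (auto simp: mem_Times_iff)
  also have "\<dots> \<in> sets (M \<Otimes>\<^sub>M M)"
    by (intro sets.countable_INT image_subsetI sets.finite_UN \<pi>_finite pair_measureI Q_sets) simp
  finally show ?thesis .
qed

lemma off_diagonal_measurable:
  fixes k :: "'a \<Rightarrow> 'a \<Rightarrow> real"
  assumes k: "(\<lambda>(x, y). k x y) \<in> borel_measurable (restrict_space N {(x, y). x \<noteq> y})"
    and diag: "{p \<in> space N. fst p = snd p} \<in> sets N"
  shows "(\<lambda>(x, y). if x = y then 0 else k x y) \<in> borel_measurable N"
proof -
  have "{(x, y). x \<noteq> y} \<inter> space N = space N - {p \<in> space N. fst p = snd p}" by auto
  then have "{(x, y). x \<noteq> y} \<inter> space N \<in> sets N" using diag by auto
  then have "(\<lambda>p. indicator {(x, y). x \<noteq> y} p *\<^sub>R (case p of (x, y) \<Rightarrow> k x y)) \<in> borel_measurable N"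
    using k by (subst (asm) borel_measurable_restrict_space_iff) auto
  moreover have "(\<lambda>p. indicator {(x, y). x \<noteq> y} p *\<^sub>R (case p of (x, y) \<Rightarrow> k x y)) =
      (\<lambda>(x, y). if x = y then 0 else k x y)" by (auto simp: indicator_def fun_eq_iff)
  ultimately show ?thesis by simp
qed

text \<open>Between \<open>\<delta> ^ Suc n\<close> and \<open>\<delta> ^ n\<close> the integrand is
  at least \<open>\<omega> (\<delta> ^ Suc n) / \<delta> ^ n\<close> by monotonicity, and the
  interval has length \<open>(1 - \<delta>) * \<delta> ^ n\<close>; these disjoint intervals fill
  the domain of the Dini integral.\<close>

lemma dini_summable:
  assumes \<omega>: "dini_modulus \<omega>" and \<delta>: "0 < \<delta>" "\<delta> < 1"
  shows "summable (\<lambda>j. \<omega> (\<delta> ^ j))"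
proof -
  have pos: "0 < \<omega> t" if "0 < t" for t using \<omega> that by (simp add: dini_modulus_def)
  have mono: "\<omega> s \<le> \<omega> t" if "0 < s" "s \<le> t" for s t
    using \<omega> that by (auto simp: dini_modulus_def mono_on_def)
  have int: "set_integrable lborel {0<..<1} (\<lambda>t. \<omega> t / t)" using \<omega> by (simp add: dini_modulus_def)
  have sub: "set_integrable lborel {a<..<b} (\<lambda>t. \<omega> t / t)" if "0 \<le> a" "b \<le> 1" for a b
    by (rule set_integrable_subset[OF int]) (use that in auto)
  have step: "(1 - \<delta>) * \<omega> (\<delta> ^ Suc n) \<le> (LINT t:{\<delta> ^ Suc n<..<\<delta> ^ n}|lborel. \<omega> t / t)" for n
  proof -
    have lt: "\<delta> ^ Suc n \<le> \<delta> ^ n" "0 < \<delta> ^ n" using \<delta> by (auto simp: mult_le_cancel_right1)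
    have "(1 - \<delta>) * \<omega> (\<delta> ^ Suc n) = \<omega> (\<delta> ^ Suc n) / \<delta> ^ n * measure lborel {\<delta> ^ Suc n<..<\<delta> ^ n}"
      using lt \<delta> by (simp add: field_simps)
    also have "\<dots> = (LINT t:{\<delta> ^ Suc n<..<\<delta> ^ n}|lborel. \<omega> (\<delta> ^ Suc n) / \<delta> ^ n)"
      by (simp add: set_lebesgue_integral_def)
    also have "\<dots> \<le> (LINT t:{\<delta> ^ Suc n<..<\<delta> ^ n}|lborel. \<omega> t / t)"
    proof (rule set_integral_mono)
      show "set_integrable lborel {\<delta> ^ Suc n<..<\<delta> ^ n} (\<lambda>_. \<omega> (\<delta> ^ Suc n) / \<delta> ^ n)"
        using lt by (simp add: set_integrable_def)
      show "set_integrable lborel {\<delta> ^ Suc n<..<\<delta> ^ n} (\<lambda>t. \<omega> t / t)"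
        using \<delta> by (intro sub) (auto simp: power_le_one)
      fix t assume t: "t \<in> {\<delta> ^ Suc n<..<\<delta> ^ n}"
      have "0 < \<delta> ^ Suc n" using \<delta> by simp
      then show "\<omega> (\<delta> ^ Suc n) / \<delta> ^ n \<le> \<omega> t / t"
        using t pos[of t] by (intro frac_le mono less_imp_le[OF pos]) auto
    qed
    finally show ?thesis .
  qed
  have partial: "(1 - \<delta>) * (\<Sum>j<n. \<omega> (\<delta> ^ Suc j)) \<le> (LINT t:{\<delta> ^ n<..<1}|lborel. \<omega> t / t)" for n
  proof (induction n)
    case 0
    then show ?case by (simp add: set_lebesgue_integral_def)
  next
    case (Suc n)
    have lt: "\<delta> ^ Suc n \<le> \<delta> ^ n" "0 < \<delta> ^ Suc n" "\<delta> ^ n \<le> 1" using \<delta> by (auto simp: mult_le_cancel_right1 power_le_one)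
    let ?A = "{\<delta> ^ Suc n<..<\<delta> ^ n}" and ?B = "{\<delta> ^ n<..<1}"
    have "(1 - \<delta>) * (\<Sum>j<Suc n. \<omega> (\<delta> ^ Suc j)) \<le> (LINT t:?B|lborel. \<omega> t / t) + (LINT t:?A|lborel. \<omega> t / t)"
      using Suc step[of n] by (simp add: distrib_left)
    also have "\<dots> = (LINT t:?B \<union> ?A|lborel. \<omega> t / t)"
      using lt by (intro set_integral_Un[symmetric] sub) auto
    also have "\<dots> \<le> (LINT t:{\<delta> ^ Suc n<..<1}|lborel. \<omega> t / t)"
    proof (rule set_integral_le_subset)
      show "set_integrable lborel {\<delta> ^ Suc n<..<1} (\<lambda>t. \<omega> t / t)" using lt by (intro sub) auto
      show "?B \<union> ?A \<subseteq> {\<delta> ^ Suc n<..<1}" using lt by auto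
      show "0 \<le> \<omega> t / t" if "t \<in> {\<delta> ^ Suc n<..<1}" for t
        using that lt pos[of t] by (intro divide_nonneg_nonneg) auto
    qed auto
    finally show ?case .
  qed
  have "summable (\<lambda>j. \<omega> (\<delta> ^ Suc j))"
  proof (rule summableI_nonneg_bounded)
    show "0 \<le> \<omega> (\<delta> ^ Suc j)" for j using pos \<delta> by (intro less_imp_le[OF pos]) simp
    show "(\<Sum>j<n. \<omega> (\<delta> ^ Suc j)) \<le> (LINT t:{0<..<1}|lborel. \<omega> t / t) / (1 - \<delta>)" for n
    proof -
      have "(LINT t:{\<delta> ^ n<..<1}|lborel. \<omega> t / t) \<le> (LINT t:{0<..<1}|lborel. \<omega> t / t)"
      proof (rule set_integral_le_subset[OF int])
        show "{\<delta> ^ n<..<1} \<subseteq> {0<..<1}" using zero_less_power[OF \<delta>(1), of n] by auto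
        show "0 \<le> \<omega> t / t" if "t \<in> {0<..<1}" for t
          using that pos[of t] by (intro divide_nonneg_nonneg) auto
      qed auto
      with partial[of n] have "(1 - \<delta>) * (\<Sum>j<n. \<omega> (\<delta> ^ Suc j)) \<le> (LINT t:{0<..<1}|lborel. \<omega> t / t)"
        by (rule order_trans)
      then show ?thesis using \<delta> by (simp add: le_divide_eq mult.commute)
    qed
  qed
  then show ?thesis by (rule iffD1[OF summable_Suc_iff[of "\<lambda>j. \<omega> (\<delta> ^ j)"]])
qed

text \<open>No truncation set around \<open>x\<close> contains \<open>x\<close>, so values of the
  kernel on the diagonal are never seen.\<close>

lemma has_pv_integral_cong_off_diagonal:
  assumes "\<And>x y. x \<noteq> y \<Longrightarrow> K x y = k x y" "\<And>x. \<rho> x x = 0"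
  shows "has_pv_integral M \<rho> K f x l \<longleftrightarrow> has_pv_integral M \<rho> k f x l"
proof -
  have eq: "indicator {y. \<epsilon> < \<rho> x y} y *\<^sub>R (K x y * f y) = indicator {y. \<epsilon> < \<rho> x y} y *\<^sub>R (k x y * f y)"
    if "0 < \<epsilon>" for \<epsilon> y
    using assms that by (cases "x = y") (auto simp: indicator_def)
  have "set_integrable M {y. \<epsilon> < \<rho> x y} (\<lambda>y. K x y * f y) \<longleftrightarrow> set_integrable M {y. \<epsilon> < \<rho> x y} (\<lambda>y. k x y * f y)"
    if "0 < \<epsilon>" for \<epsilon>
    by (simp only: set_integrable_def eq[OF that])
  moreover have "((\<lambda>\<epsilon>. LINT y:{y. \<epsilon> < \<rho> x y}|M. K x y * f y) \<longlongrightarrow> l) (at_right 0) \<longleftrightarrow>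
    ((\<lambda>\<epsilon>. LINT y:{y. \<epsilon> < \<rho> x y}|M. k x y * f y) \<longlongrightarrow> l) (at_right 0)"
  proof (rule tendsto_cong, rule eventually_mono[OF eventually_at_right_less[of "0::real"]])
    fix \<epsilon> :: real assume "0 < \<epsilon>"
    then show "(LINT y:{y. \<epsilon> < \<rho> x y}|M. K x y * f y) = (LINT y:{y. \<epsilon> < \<rho> x y}|M. k x y * f y)"
      by (simp only: set_lebesgue_integral_def eq)
  qed
  ultimately show ?thesis unfolding has_pv_integral_def by blast
qed

section \<open>Discretising the quasi-metric and the kernel\<close>

context homogeneous_type_space
begin

lemma rho_le_qdiam: "\<rho> x y \<le> qdiam \<rho>"
proof -
  have "(\<lambda>(x, y). \<rho> x y) (x, y) \<le> (SUP p. (\<lambda>(x, y). \<rho> x y) p)"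
    by (rule cSUP_upper) (use rho_bounded in auto)
  then show ?thesis by (simp add: qdiam_def)
qed

lemma qball_measure_pos: "0 < r \<Longrightarrow> 0 < measure M (qball \<rho> x r)"
  using qball_emeasure[of r x] by (simp add: measure_def enn2real_positive_iff less_top)

text \<open>A space of diameter 0 is a single point and hence a null set, whereas balls have
  positive measure.\<close>

lemma qdiam_pos: "0 < qdiam \<rho>"
proof (rule ccontr)
  assume "\<not> 0 < qdiam \<rho>"
  then have z: "\<rho> x y = 0" for x y using rho_le_qdiam[of x y] rho_nonneg[of x y] by linarith
  have "y = undefined" for y :: 'a using z[of undefined y] rho_eq_0_iff[of undefined y] by simp
  then have "qball \<rho> undefined 1 \<subseteq> {undefined}" by blast
  then have "emeasure M (qball \<rho> undefined 1) \<le> emeasure M {undefined}"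
    using singleton_null[of undefined] by (intro emeasure_mono) auto
  then show False using singleton_null[of undefined] qball_emeasure[of 1 undefined] by (auto simp: null_sets_def)
qed

lemma finite_measure_M: "finite_measure M"
proof (rule finite_measureI)
  have "\<rho> undefined y < 2 * qdiam \<rho>" for y using rho_le_qdiam[of undefined y] qdiam_pos by linarith
  then have "qball \<rho> undefined (2 * qdiam \<rho>) = UNIV" by (simp add: qball_def)
  then show "emeasure M (space M) \<noteq> \<infinity>"
    using qball_emeasure[of "2 * qdiam \<rho>" undefined] qdiam_pos by (auto simp: space_eq_UNIV)
qed

lemma qball_measure_mono: "r \<le> s \<Longrightarrow> measure M (qball \<rho> x r) \<le> measure M (qball \<rho> x s)"
  by (rule finite_measure.finite_measure_mono[OF finite_measure_M])
    (auto simp: qball_def intro: qball_sets[unfolded qball_def])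

lemma rho_measurable: "\<rho> x \<in> borel_measurable M"
  unfolding borel_measurable_iff_less using qball_sets[of x] by (auto simp: space_eq_UNIV qball_def)

lemma doubling_iterated:
  assumes "0 < \<eta>" "\<eta> < 1"
  shows "\<exists>D. \<forall>x. \<forall>r>0. measure M (qball \<rho> x r) \<le> D * measure M (qball \<rho> x (\<eta> * r))"
proof -
  obtain c where c: "0 < c" "\<And>x r. 0 < r \<Longrightarrow> measure M (qball \<rho> x (2 * r)) \<le> c * measure M (qball \<rho> x r)"
    using doubling by blast
  obtain i where i: "1 / \<eta> < 2 ^ i" using real_arch_pow[of 2 "1 / \<eta>"] by auto
  have iter: "measure M (qball \<rho> x (2 ^ n * r)) \<le> c ^ n * measure M (qball \<rho> x r)" if "0 < r" for x r n
  proof (induction n)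
    case (Suc n)
    have "measure M (qball \<rho> x (2 ^ Suc n * r)) \<le> c * measure M (qball \<rho> x (2 ^ n * r))"
      using c(2)[of "2 ^ n * r" x] that by (simp add: mult.assoc)
    also have "\<dots> \<le> c * (c ^ n * measure M (qball \<rho> x r))" using Suc c(1) by (intro mult_left_mono) auto
    finally show ?case by (simp add: mult.assoc)
  qed simp
  have "measure M (qball \<rho> x r) \<le> c ^ i * measure M (qball \<rho> x (\<eta> * r))" if r: "0 < r" for x r
  proof -
    have "1 \<le> 2 ^ i * \<eta>" using i assms(1) by (simp add: divide_less_eq)
    then have "r \<le> 2 ^ i * (\<eta> * r)" using r mult_right_mono[of 1 "2 ^ i * \<eta>" r] by (simp add: mult.assoc)
    then have "measure M (qball \<rho> x r) \<le> measure M (qball \<rho> x (2 ^ i * (\<eta> * r)))" by (rule qball_measure_mono)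
    also have "\<dots> \<le> c ^ i * measure M (qball \<rho> x (\<eta> * r))" using r assms(1) by (intro iter) auto
    finally show ?thesis .
  qed
  then show ?thesis by blast
qed

lemma quasi_constant: "\<exists>a\<ge>1. \<forall>x y z. \<rho> x y \<le> a * (\<rho> x z + \<rho> z y) \<and> \<rho> x y \<le> a * \<rho> y x"
proof -
  obtain a1 a0 where a1: "0 < a1" "\<And>x y z. \<rho> x y \<le> a1 * (\<rho> x z + \<rho> z y)"
    and a0: "0 < a0" "\<And>x y. \<rho> x y \<le> a0 * \<rho> y x"
    using rho_quasi_triangle rho_quasi_sym by blast
  let ?a = "max 1 (max a1 a0)"
  have "\<rho> x y \<le> ?a * (\<rho> x z + \<rho> z y)" for x y z
    using rho_nonneg[of x z] rho_nonneg[of z y]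
    by (intro order_trans[OF a1(2)[of x y z] mult_right_mono]) auto
  moreover have "\<rho> x y \<le> ?a * \<rho> y x" for x y
    using rho_nonneg[of y x] by (intro order_trans[OF a0(2) mult_right_mono]) auto
  ultimately show ?thesis by (intro exI[of _ ?a]) auto
qed

text \<open>Reversing a step costs a factor \<open>a\<close>, and two quasi-triangle inequalities
  turn three steps of length at most \<open>a * r\<close> into at most \<open>3 * a ^ 3 * r\<close>.
  The choice of \<open>\<eta>\<close> makes this three quarters of the radius one scale up.\<close>

lemma scaled_space_exists:
  assumes a: "1 \<le> a" "\<And>x y z. \<rho> x y \<le> a * (\<rho> x z + \<rho> z y)" "\<And>x y. \<rho> x y \<le> a * \<rho> y x"
    and \<eta>: "\<eta> = 1 / (4 * a ^ 3)"
  shows "\<exists>D. scaled_space M (\<lambda>k x y. \<rho> x y < 2 * qdiam \<rho> * \<eta> ^ k) D"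
proof -
  have a3: "1 \<le> a ^ 3" using a(1) by (rule one_le_power)
  have "1 < 4 * a ^ 3" using a3 by linarith
  then have \<eta>1: "0 < \<eta>" "\<eta> < 1" "3 * a ^ 3 * \<eta> < 1" using a(1) by (auto simp: \<eta> divide_less_eq)
  obtain D where D: "\<And>x r. 0 < r \<Longrightarrow> measure M (qball \<rho> x r) \<le> D * measure M (qball \<rho> x (\<eta> * r))"
    using doubling_iterated[OF \<eta>1(1,2)] by blast
  let ?R = "2 * qdiam \<rho>"
  have R: "0 < ?R" using qdiam_pos by simp
  have pos: "0 < ?R * \<eta> ^ k" for k using R \<eta>1 by simp
  have "scaled_space M (\<lambda>k x y. \<rho> x y < ?R * \<eta> ^ k) D"
  proof (rule scaled_space.intro[OF finite_measure_M scaled_space_axioms.intro])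
    show "space M = UNIV" by (rule space_eq_UNIV)
    show "\<rho> x y < ?R * \<eta> ^ 0" for x y using rho_le_qdiam[of x y] qdiam_pos by simp
    show "\<rho> x x < ?R * \<eta> ^ k" for k x using pos[of k] rho_eq_0_iff[of x x] by simp
    show "{y. \<rho> x y < ?R * \<eta> ^ k} \<in> sets M" for k x using qball_sets[of x] by (simp add: qball_def)
    show "0 < measure M {y. \<rho> x y < ?R * \<eta> ^ k}" for k x
      using qball_measure_pos[OF pos[of k]] by (simp add: qball_def)
    show "measure M {y. \<rho> x y < ?R * \<eta> ^ k} \<le> D * measure M {y. \<rho> x y < ?R * \<eta> ^ Suc k}" for k x
      using D[OF pos[of k], of x] by (simp add: qball_def mult_ac)
    fix k x y z v
    let ?r = "?R * \<eta> ^ Suc k"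
    assume h: "\<rho> x y < ?r \<or> \<rho> y x < ?r" "\<rho> y z < ?r \<or> \<rho> z y < ?r" "\<rho> z v < ?r \<or> \<rho> v z < ?r"
    have r_le: "?r \<le> a * ?r"
      using mult_right_mono[OF a(1) less_imp_le[OF pos[of "Suc k"]]] by (simp only: mult_1)
    have le: "\<rho> u w \<le> a * ?r" if "\<rho> u w < ?r \<or> \<rho> w u < ?r" for u w
      using that
    proof
      assume "\<rho> u w < ?r"
      also note r_le
      finally show ?thesis by simp
    next
      assume "\<rho> w u < ?r"
      then have "a * \<rho> w u \<le> a * ?r" using a(1) by (intro mult_left_mono) auto
      then show ?thesis using a(3)[of u w] by linarith
    qed
    have "\<rho> y v \<le> a * (\<rho> y z + \<rho> z v)" by (rule a(2))
    also have "\<dots> \<le> a * (a * ?r + a * ?r)" using le h a(1) by (intro mult_left_mono add_mono) auto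
    finally have yv: "\<rho> y v \<le> a * (a * ?r + a * ?r)" .
    have "\<rho> x v \<le> a * (\<rho> x y + \<rho> y v)" by (rule a(2))
    also have "\<dots> \<le> a * (a * (a * ?r) + a * (a * ?r + a * ?r))"
    proof (intro mult_left_mono add_mono yv)
      have "\<rho> x y \<le> a * ?r" using le h(1) by blast
      also have "\<dots> \<le> a * (a * ?r)" using a(1) by (intro mult_left_mono r_le) auto
      finally show "\<rho> x y \<le> a * (a * ?r)" .
    qed (use a(1) in auto)
    also have "\<dots> = (3 * a ^ 3 * \<eta>) * (?R * \<eta> ^ k)" by (simp add: power3_eq_cube algebra_simps)
    also have "\<dots> < 1 * (?R * \<eta> ^ k)" using \<eta>1(3) pos[of k] by (intro mult_strict_right_mono)
    finally show "\<rho> x v < ?R * \<eta> ^ k" by simp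
  qed
  then show ?thesis by blast
qed

lemma kernel_space_exists:
  assumes cz: "calderon_zygmund_operator M \<rho> k"
  defines "K \<equiv> \<lambda>x y. if x = y then 0 else k x y"
  shows "\<exists>E D \<pi> R \<delta> A B q w. small_scale_kernel_space M E D \<pi> \<rho> K R \<delta> A B q w"
proof -
  obtain a where a: "1 \<le> a" "\<And>x y z. \<rho> x y \<le> a * (\<rho> x z + \<rho> z y)" "\<And>x y. \<rho> x y \<le> a * \<rho> y x"
    using quasi_constant by blast
  define \<eta> where "\<eta> = 1 / (4 * a ^ 3)"
  define R where "R = 2 * qdiam \<rho>"
  \<comment> \<open>The cubes are constructed on every third scale of the original sequence.\<close>
  define \<delta> where "\<delta> = \<eta> ^ 3"
  have a3: "1 \<le> a ^ 3" using a(1) by (rule one_le_power)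
  have \<eta>1: "0 < \<eta>" "\<eta> \<le> 1 / 4" using a3 a(1) by (simp_all add: \<eta>_def)
  have \<delta>1: "0 < \<delta>" "2 * \<delta> < 1" "\<delta> < 1"
  proof -
    show pos: "0 < \<delta>" using \<eta>1 by (simp add: \<delta>_def)
    have "\<eta> ^ 3 \<le> (1 / 4) ^ 3" using \<eta>1 by (intro power_mono) auto
    also have "\<dots> < 1 / 2" by (simp add: power3_eq_cube)
    finally show "2 * \<delta> < 1" by (simp add: \<delta>_def)
    with pos show "\<delta> < 1" by linarith
  qed
  have R: "0 < R" using qdiam_pos by (simp add: R_def)
  have R\<delta>: "0 < R * \<delta> ^ n" for n using R \<delta>1 by simp
  obtain D0 where "scaled_space M (\<lambda>k x y. \<rho> x y < R * \<eta> ^ k) D0"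
    using scaled_space_exists[OF a \<eta>_def] unfolding R_def by blast
  then obtain \<pi> where \<pi>: "cube_space M (\<lambda>n x y. \<rho> x y < R * \<eta> ^ (3 * n)) (D0 ^ 3) \<pi>"
    using scaled_space.cube_space_exists by blast
  define E where "E n x y \<longleftrightarrow> \<rho> x y < R * \<delta> ^ n" for n x y
  have E_eq: "E = (\<lambda>n x y. \<rho> x y < R * \<eta> ^ (3 * n))"
    by (simp add: E_def[abs_def] \<delta>_def power_mult)
  have cube: "cube_space M E (D0 ^ 3) \<pi>" unfolding E_eq by (rule \<pi>)
  have arch: "\<exists>n. R * \<delta> ^ n < r" if r: "0 < r" for r
  proof -
    obtain n where "\<delta> ^ n < r / R"
      using real_arch_pow_inv[OF divide_pos_pos[OF r R] \<delta>1(3)] by blast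
    then show ?thesis using R by (intro exI[of _ n]) (simp add: field_simps)
  qed
  have sep: "x = y" if "\<And>n. E n x y" for x y
  proof (rule ccontr)
    assume "x \<noteq> y"
    then have "0 < \<rho> x y" using rho_nonneg[of x y] rho_eq_0_iff[of x y] by simp
    then obtain n where "R * \<delta> ^ n < \<rho> x y" using arch by blast
    with that[of n] show False by (simp add: E_def)
  qed
  have lebesgue: "lebesgue_cube_space M E (D0 ^ 3) \<pi>"
  proof (rule lebesgue_cube_space.intro[OF cube lebesgue_cube_space_axioms.intro])
    fix f :: "'a \<Rightarrow> real" and e :: real
    assume "integrable M f" "0 < e"
    then obtain g where g: "continuous_compact_support g" "(LINT x|M. \<bar>f x - g x\<bar>) < e"
      using compact_support_dense by blast
    have "\<exists>n. \<forall>y. E n x y \<longrightarrow> \<bar>g y - g x\<bar> < r" if "0 < r" for x r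
    proof -
      have "open (g -` {g x - r<..<g x + r})"
        using g(1) by (intro open_vimage) (auto simp: continuous_compact_support_def)
      then have "x \<in> interior (g -` {g x - r<..<g x + r})" using that by (simp add: interior_open)
      then obtain s where s: "0 < s" "qball \<rho> x s \<subseteq> g -` {g x - r<..<g x + r}"
        using qball_in_neighborhood by blast
      obtain n where n: "R * \<delta> ^ n < s" using arch[OF s(1)] by blast
      show ?thesis
      proof (intro exI[of _ n] allI impI)
        fix y assume "E n x y"
        then have "y \<in> qball \<rho> x s" using n by (simp add: E_def qball_def)
        then have "g y \<in> {g x - r<..<g x + r}" using s(2) by blast
        then show "\<bar>g y - g x\<bar> < r" by auto
      qed
    qed
    with g compact_support_integrable[OF g(1)]
    show "\<exists>g. integrable M g \<and> (LINT x|M. \<bar>f x - g x\<bar>) < e \<and>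
      (\<forall>x. \<forall>r>0. \<exists>n. \<forall>y. E n x y \<longrightarrow> \<bar>g y - g x\<bar> < r)" by blast
  qed
  obtain \<omega> where \<omega>: "dini_modulus \<omega>" "cz_kernel M \<rho> \<omega> k"
    using cz by (auto simp: calderon_zygmund_operator_def)
  note kernel_bounds = \<omega>(2)[unfolded cz_kernel_def, THEN conjunct2]
  from kernel_bounds[THEN conjunct1] obtain A where A: "0 < A"
    "\<forall>x y. x \<noteq> y \<longrightarrow> \<bar>k x y\<bar> \<le> A / measure M (qball \<rho> x (\<rho> x y))"
    by (elim exE conjE) (rule that)
  from kernel_bounds[THEN conjunct2] obtain b c where b: "0 < b" and c: "0 < c" and smooth:
    "\<forall>x1 x2 y. x1 \<noteq> x2 \<longrightarrow> x1 \<noteq> y \<longrightarrow> b * \<rho> x1 x2 < \<rho> x2 y \<longrightarrow> \<bar>k x1 y - k x2 y\<bar> + \<bar>k y x1 - k y x2\<bar>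
      \<le> c * \<omega> (\<rho> x2 x1 / \<rho> x2 y) * (1 / measure M (qball \<rho> x2 (\<rho> x2 y)))"
    by (elim exE conjE) (rule that)
  have "0 < 1 / (b * a)" using a(1) b by simp
  \<comment> \<open>With a gap of \<open>q\<close> scales, \<open>E m z x\<close> and
    \<open>\<not> E n z y\<close> yield \<open>b * \<rho> x z < \<rho> z y\<close>, as the
    smoothness estimate demands; \<open>a\<close> pays for exchanging \<open>x\<close> and
    \<open>z\<close>.\<close>
  then obtain q where q: "\<delta> ^ q < 1 / (b * a)" using real_arch_pow_inv[OF _ \<delta>1(3)] by blast
  define w where "w j = c * \<omega> (\<delta> ^ j)" for j
  have \<omega>_pos: "0 < \<omega> t" if "0 < t" for t using \<omega>(1) that by (simp add: dini_modulus_def)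
  have \<omega>_mono: "\<omega> s \<le> \<omega> t" if "0 < s" "s \<le> t" for s t
    using \<omega>(1) that by (auto simp: dini_modulus_def mono_on_def)
  have K_meas: "(\<lambda>(x, y). K x y) \<in> borel_measurable (M \<Otimes>\<^sub>M M)"
    unfolding K_def
  proof (rule off_diagonal_measurable)
    show "(\<lambda>(x, y). k x y) \<in> borel_measurable (restrict_space (M \<Otimes>\<^sub>M M) {(x, y). x \<noteq> y})"
      using \<omega>(2) unfolding cz_kernel_def by (rule conjunct1)
    show "{p \<in> space (M \<Otimes>\<^sub>M M). fst p = snd p} \<in> sets (M \<Otimes>\<^sub>M M)"
      by (rule cube_space.diagonal_measurable[OF cube]) (rule sep)
  qed
  have m_le: "measure M {v. E n x v} \<le> measure M (qball \<rho> x (\<rho> x y))" if "\<not> E n x y" for n x y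
  proof -
    have "{v. E n x v} = qball \<rho> x (R * \<delta> ^ n)" by (simp add: E_def qball_def)
    then show ?thesis using that by (simp add: E_def qball_measure_mono)
  qed
  have m_pos: "0 < measure M {v. E n x v}" for n x
    using qball_measure_pos[OF R\<delta>[of n], of x] by (simp add: E_def qball_def)
  have neq: "x \<noteq> y" if "\<not> E n x y" for n x y
    using that R\<delta>[of n] rho_eq_0_iff[of x x] by (auto simp: E_def)
  have K_size: "\<bar>K x y\<bar> \<le> A / measure M {v. E n x v}" if "\<not> E n x y" for n x y
  proof -
    have "\<bar>K x y\<bar> \<le> A / measure M (qball \<rho> x (\<rho> x y))" using A(2)[rule_format, OF neq[OF that]] neq[OF that] by (simp add: K_def)
    also have "\<dots> \<le> A / measure M {v. E n x v}" using A(1) less_le_trans[OF m_pos m_le[OF that]] m_pos[of n x]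
      by (intro divide_left_mono m_le[OF that] mult_pos_pos) auto
    finally show ?thesis .
  qed
  have K_smooth: "\<bar>K x y - K z y\<bar> \<le> w (m - n) / measure M {v. E n z v} \<and>
      \<bar>K y x - K y z\<bar> \<le> w (m - n) / measure M {v. E n z v}"
    if zx: "E m z x" and zy: "\<not> E n z y" and nm: "n + q \<le> m" for m n x y z
  proof (cases "x = z")
    case True
    have "0 \<le> w (m - n)" using c \<omega>_pos[of "\<delta> ^ (m - n)"] \<delta>1 by (simp add: w_def)
    then show ?thesis using True by simp
  next
    case False
    have "\<delta> ^ m \<le> \<delta> ^ n" using nm \<delta>1 by (intro power_decreasing) auto
    then have "R * \<delta> ^ m \<le> R * \<delta> ^ n" using R by (intro mult_left_mono) auto
    then have "\<not> E m z y" using zy by (simp add: E_def)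
    then have xy: "x \<noteq> y" using zx by blast
    have zy': "z \<noteq> y" using neq[OF zy] .
    have rzx: "0 < \<rho> z x" using False rho_nonneg[of z x] rho_eq_0_iff[of z x] by simp
    have "b * a * \<delta> ^ (m - n) \<le> 1"
    proof -
      have "\<delta> ^ (m - n) \<le> \<delta> ^ q" using nm \<delta>1 by (intro power_decreasing) auto
      then have "b * a * \<delta> ^ (m - n) \<le> b * a * \<delta> ^ q" using a(1) b by (intro mult_left_mono) auto
      also have "\<dots> \<le> b * a * (1 / (b * a))" using q a(1) b by (intro mult_left_mono) auto
      also have "\<dots> = 1" using a(1) b by simp
      finally show ?thesis .
    qed
    have pow: "\<delta> ^ m = \<delta> ^ (m - n) * \<delta> ^ n" using nm by (simp add: power_add[symmetric])
    have "b * \<rho> x z \<le> b * (a * \<rho> z x)" using b a(3)[of x z] by (intro mult_left_mono) auto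
    also have "\<dots> < b * (a * (R * \<delta> ^ m))"
      using zx b a(1) by (intro mult_strict_left_mono) (auto simp: E_def)
    also have "\<dots> = (b * a * \<delta> ^ (m - n)) * (R * \<delta> ^ n)" by (simp add: pow mult_ac)
    also have "\<dots> \<le> 1 * (R * \<delta> ^ n)" using \<open>b * a * \<delta> ^ (m - n) \<le> 1\<close> R\<delta>[of n] by (intro mult_right_mono) auto
    also have "\<dots> \<le> \<rho> z y" using zy by (simp add: E_def)
    finally have sep': "b * \<rho> x z < \<rho> z y" .
    have rzy: "0 < \<rho> z y" using zy R\<delta>[of n] by (simp add: E_def)
    have ratio: "\<rho> z x / \<rho> z y \<le> \<delta> ^ (m - n)"
    proof -
      have "\<rho> z x \<le> \<delta> ^ (m - n) * (R * \<delta> ^ n)" using zx by (simp add: E_def pow mult_ac)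
      also have "\<dots> \<le> \<delta> ^ (m - n) * \<rho> z y" using zy \<delta>1 by (intro mult_left_mono) (auto simp: E_def)
      finally show ?thesis using rzy by (simp add: divide_le_eq)
    qed
    have "\<bar>k x y - k z y\<bar> + \<bar>k y x - k y z\<bar> \<le> c * \<omega> (\<rho> z x / \<rho> z y) * (1 / measure M (qball \<rho> z (\<rho> z y)))"
      by (rule smooth[rule_format, OF False xy sep'])
    also have "\<dots> \<le> w (m - n) * (1 / measure M {v. E n z v})"
    proof (rule mult_mono)
      show "c * \<omega> (\<rho> z x / \<rho> z y) \<le> w (m - n)"
        unfolding w_def using c rzx rzy by (intro mult_left_mono \<omega>_mono ratio) auto
      show "1 / measure M (qball \<rho> z (\<rho> z y)) \<le> 1 / measure M {v. E n z v}"
        using less_le_trans[OF m_pos m_le[OF zy]] m_pos[of n z]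
        by (intro divide_left_mono m_le[OF zy] mult_pos_pos) auto
      show "0 \<le> w (m - n)" using c \<omega>_pos[of "\<delta> ^ (m - n)"] \<delta>1 by (simp add: w_def)
    qed auto
    finally show ?thesis using False xy zy' by (auto simp: K_def)
  qed
  have pv_eq: "has_pv_integral M \<rho> K f x l \<longleftrightarrow> has_pv_integral M \<rho> k f x l" for f x l
    by (rule has_pv_integral_cong_off_diagonal) (auto simp: K_def rho_eq_0_iff)
  have T_eq: "cz_op M \<rho> K = cz_op M \<rho> k" "cz_op_defined M \<rho> K = cz_op_defined M \<rho> k"
    by (simp_all add: fun_eq_iff cz_op_def cz_op_defined_def pv_eq)
  obtain B where B: "0 < B" "\<And>f. f \<in> L2_space M \<Longrightarrow>
      cz_op M \<rho> k f \<in> L2_space M \<and> L2_norm M (cz_op M \<rho> k f) \<le> B * L2_norm M f"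
    using cz unfolding calderon_zygmund_operator_def by blast
  have kernel: "kernel_space M E (D0 ^ 3) \<pi> \<rho> K R \<delta> A B q w"
  proof (rule kernel_space.intro[OF lebesgue complete_measure_axioms kernel_space_axioms.intro])
    show "x = y" if "\<rho> x y \<le> 0" for x y using that rho_nonneg[of x y] rho_eq_0_iff[of x y] by simp
    show "0 \<le> w n" for n using c \<omega>_pos[of "\<delta> ^ n"] \<delta>1 by (simp add: w_def)
    show "summable w" unfolding w_def[abs_def] using \<delta>1 by (intro summable_mult dini_summable[OF \<omega>(1)]) auto
    show "cz_op_defined M \<rho> K f" if "f \<in> L2_space M" for f
      unfolding T_eq using cz that by (auto simp: calderon_zygmund_operator_def)
    show "cz_op M \<rho> K f \<in> L2_space M \<and> L2_norm M (cz_op M \<rho> K f) \<le> B * L2_norm M f" if "f \<in> L2_space M" for f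
      unfolding T_eq by (rule B(2)[OF that])
    show "\<delta> < 1" using \<delta>1 by simp
  qed (fact E_def R \<delta>1(1) rho_measurable K_meas K_size K_smooth A(1) B(1))+
  have "annular_kernel_space M E (D0 ^ 3) \<pi> \<rho> K R \<delta> A B q w"
  proof (rule annular_kernel_space.intro[OF kernel annular_kernel_space_axioms.intro])
    fix n :: nat and x assume n: "1 \<le> n"
    have "\<delta> ^ n \<le> \<delta> ^ 1" using n \<delta>1 by (intro power_decreasing) auto
    then have "R * \<delta> ^ n \<le> R * \<delta>" using R by (intro mult_left_mono) auto
    also have "\<dots> = qdiam \<rho> * (2 * \<delta>)" by (simp add: R_def)
    also have "\<dots> < qdiam \<rho> * 1" using \<delta>1 qdiam_pos by (intro mult_strict_left_mono)
    finally have "R * \<delta> ^ n < qdiam \<rho>" by simp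
    moreover have "R * \<delta> ^ Suc n < R * \<delta> ^ n"
      using mult_strict_right_mono[OF \<delta>1(3) R\<delta>[of n]] by (simp add: mult_ac)
    ultimately have "qball \<rho> x (R * \<delta> ^ n) - qball \<rho> x (R * \<delta> ^ Suc n) \<noteq> {}"
      by (intro annulus_nonempty R\<delta>)
    then show "\<exists>z. E n x z \<and> \<not> E (Suc n) x z" by (auto simp: qball_def E_def)
  qed
  then have "small_scale_kernel_space M E (D0 ^ 3) \<pi> \<rho> K R \<delta> A B q w"
    by (rule small_scale_kernel_space.intro[OF _ small_scale_kernel_space_axioms.intro])
      (use R_def \<delta>1 in auto)
  then show ?thesis by blast
qed

end

theorem theorem3p1:
  fixes M :: "'a::topological_space measure"
    and \<rho> k :: "'a \<Rightarrow> 'a \<Rightarrow> real"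
    and p \<theta> \<kappa> :: real
  assumes "homogeneous_type_space M \<rho>"
    and "calderon_zygmund_operator M \<rho> k"
    and "1 < p" and "0 < \<theta>" and "0 < \<kappa>" and "\<kappa> < 1"
  shows "\<exists>C>0. \<forall>f \<in> grand_morrey_space M \<rho> p \<theta> \<kappa>.
           cz_op_defined M \<rho> k f \<and>
           cz_op M \<rho> k f \<in> grand_morrey_space M \<rho> p \<theta> \<kappa> \<and>
           grand_morrey_norm M \<rho> p \<theta> \<kappa> (cz_op M \<rho> k f) \<le> C * grand_morrey_norm M \<rho> p \<theta> \<kappa> f"
proof -
  interpret homogeneous_type_space M \<rho> by (rule assms(1))
  \<comment> \<open>The given kernel is measurable only off the diagonal. Extended by 0 it is
    jointly measurable, and its principal values are the same.\<close>
  let ?K = "\<lambda>x y. if x = y then 0 else k x y"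
  obtain E D \<pi> R \<delta> A B q w where "small_scale_kernel_space M E D \<pi> \<rho> ?K R \<delta> A B q w"
    using kernel_space_exists[OF assms(2)] by blast
  from small_scale_kernel_space.grand_morrey_bound[OF this assms(3-6)]
  have main: "\<exists>C>0. \<forall>f \<in> grand_morrey_space M \<rho> p \<theta> \<kappa>. cz_op_defined M \<rho> ?K f \<and>
    cz_op M \<rho> ?K f \<in> grand_morrey_space M \<rho> p \<theta> \<kappa> \<and>
    grand_morrey_norm M \<rho> p \<theta> \<kappa> (cz_op M \<rho> ?K f) \<le> C * grand_morrey_norm M \<rho> p \<theta> \<kappa> f" .
  have pv_eq: "has_pv_integral M \<rho> ?K f x l \<longleftrightarrow> has_pv_integral M \<rho> k f x l" for f x l
    by (rule has_pv_integral_cong_off_diagonal) (auto simp: rho_eq_0_iff)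
  have "cz_op M \<rho> ?K = cz_op M \<rho> k" "cz_op_defined M \<rho> ?K = cz_op_defined M \<rho> k"
    by (simp_all add: fun_eq_iff cz_op_def cz_op_defined_def pv_eq)
  with main show ?thesis by simp
qed

end
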